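(* Suppose that the no-relaxation-gap assumption stated in the context holds, and let $(t_0,x_0)\in\mathscr{A}$. Let $(v_k)_{k\in\mathbb{N}}$ be any maximizing sequence for the dual linear program $d^*(t_0,x_0)$, i.e. each $v_k\in\mathscr{C}^1([t_0,T]\times X)$ is admissible for the dual LP and $\lim_{k\to\infty}v_k(t_0,x_0)=d^*(t_0,x_0)$. Then for any solution (minimizer) $(x,\omega_t)$ of the relaxed control problem with value $v_R^*(t_0,x_0)$, and for any $t\in[t_0,T]$, $$0\le v^*(t,x(t))-v_k(t,x(t))\le v^*(t_0,x_0)-v_k(t_0,x_0)\quad\text{for all }k\in\mathbb{N},$$ and $$v^*(t_0,x_0)-v_k(t_0,x_0)\underset{k\to\infty}{\longrightarrow}0 .$$
   Context: Data: $n,m\ge 1$; polynomials $l\in\mathbb{R}[x,u]$, $l_T\in\mathbb{R}[x]$, $f\in\mathbb{R}[x,u]^n$; compact sets $X\subset\mathbb{R}^n$, $U\subset\mathbb{R}^m$, $X_T\subset X$; a terminal time $T\ge0$. Initial data are $(t_0,x_0)\in[0,T]\times X$. Differential equations are understood in the integral sense, e.g. $x(t)=x_0+\int_{t_0}^t f(x(s),u(s))\,ds$. Optimal control problem: for initial data $(t_0,x_0)$, a pair $(x,u)\in\mathscr{L}^\infty([t_0,T];X\times U)$ is admissible if $\dot x(t)=f(x(t),u(t))$, $x(t_0)=x_0$, $x(t)\in X$ and $u(t)\in U$ on $[t_0,T]$, and $x(T)\in X_T$. The value function is $$v^*(t_0,x_0)=\inf \int_{t_0}^T l(x(t),u(t))\,dt+l_T(x(T))$$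 over admissible pairs. $\mathscr{A}\subset[0,T]\times X$ is the set of $(t_0,x_0)$ for which an admissible pair exists. Relaxed problem: $\mathscr{P}(U)$ is the set of Borel probability measures on $U$, and $\langle\cdot,\cdot\rangle$ denotes integration of a function against a measure. A pair $(x,\omega_t)$, where $t\mapsto\omega_t\in\mathscr{P}(U)$ is a (measurable) time-dependent probability measure, is admissible for the relaxed problem with initial data $(t_0,x_0)$ if $\dot x(t)=\langle f(x(t),\cdot),\omega_t\rangle$, $x(t_0)=x_0$, $x(t)\in X$ on $[t_0,T]$, and $x(T)\in X_T$. Its value is $$v_R^*(t_0,x_0)=\min\int_{t_0}^T\langle l(x(t),\cdot),\omega_t\rangle\,dt+l_T(x(T))$$ over such pairs. No-relaxation-gap assumption: for any initial data $(t_0,x_0)$ and any relaxed pair $(x,\omega_t)$ admissible for the relaxed problem with these initial data, there is a sequence $(x_k,u_k)_{k\in\mathbb{N}}$ of pairs admissible for the optimal control problem with the same initial data such that $\lim_{k\to\infty}\int_{t_0}^T v(x_k(t),u_k(t))\,dt=\int_{t_0}^T\langle v(x(t),\cdot),\omega_t\rangle\,dt$ for every $v\in\mathscr{C}(X\times U)$. Then $v^*(t_0,x_0)=v_R^*(t_0,x_0)$ for every $(t_0,x_0)\in\mathscr{A}$. Dual LP: $\mathscr{C}_+(K)$ is the cone of nonnegative continuous functions on a compact set $K$; $\mathscr{C}^1([t_0,T]\times X)$ is the set of continuously differentiable functions on $[t_0,T]\times X$ (understood as continuously differentiable on a neighbourhood of this set in $\mathbb{R}^{n+1}$). A function $v\in\mathscr{C}^1([t_0,T]\times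 X)$ is admissible for the dual LP if $$l+\frac{\partial v}{\partial t}+\mathrm{grad}\,v\cdot f\in\mathscr{C}_+([t_0,T]\times X\times U),\qquad l_T-v(T,\cdot)\in\mathscr{C}_+(X_T),$$ where grad is the gradient in $x$. The dual value is $d^*(t_0,x_0)=\sup v(t_0,x_0)$ over admissible $v$. *)

theory Defs
  imports "HOL-Probability.Probability"
begin

(* Differential equations are read as integral equations; the initial condition x t0 = x0 is
   their case t = t0. Paths are functions on all of the real line of which only the restriction
   to {t0..T} matters; essential boundedness follows from compactness of X and U. *)
definition admissible ::
  "((real^'n) \<times> (real^'m) \<Rightarrow> real^'n) \<Rightarrow> (real^'n) set \<Rightarrow> (real^'m) set \<Rightarrow> (real^'n) set \<Rightarrow> real \<Rightarrow>
   real \<Rightarrow> real^'n \<Rightarrow> (real \<Rightarrow> real^'n) \<Rightarrow> (real \<Rightarrow> real^'m) \<Rightarrow> bool"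
where
  "admissible f X U XT T t0 x0 x u \<longleftrightarrow>
     x \<in> borel_measurable (lebesgue_on {t0..T}) \<and>
     u \<in> borel_measurable (lebesgue_on {t0..T}) \<and>
     (\<forall>t\<in>{t0..T}. x t = x0 + (LINT s:{t0..t}|lebesgue. f (x s, u s))) \<and>
     (\<forall>t\<in>{t0..T}. x t \<in> X \<and> u t \<in> U) \<and>
     x T \<in> XT"

definition cost ::
  "((real^'n) \<times> (real^'m) \<Rightarrow> real) \<Rightarrow> (real^'n \<Rightarrow> real) \<Rightarrow> real \<Rightarrow>
   real \<Rightarrow> (real \<Rightarrow> real^'n) \<Rightarrow> (real \<Rightarrow> real^'m) \<Rightarrow> real"
where
  "cost l lT T t0 x u = (LINT t:{t0..T}|lebesgue. l (x t, u t)) + lT (x T)"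

(* Extended-real valued, so that the value is \<infinity> where no admissible pair exists. *)
definition value_fun ::
  "((real^'n) \<times> (real^'m) \<Rightarrow> real) \<Rightarrow> (real^'n \<Rightarrow> real) \<Rightarrow> ((real^'n) \<times> (real^'m) \<Rightarrow> real^'n) \<Rightarrow>
   (real^'n) set \<Rightarrow> (real^'m) set \<Rightarrow> (real^'n) set \<Rightarrow> real \<Rightarrow> real \<times> (real^'n) \<Rightarrow> ereal"
where
  "value_fun l lT f X U XT T = (\<lambda>(t0, x0).
     INF (x, u) \<in> {(x, u). admissible f X U XT T t0 x0 x u}. ereal (cost l lT T t0 x u))"

definition admissible_data ::
  "((real^'n) \<times> (real^'m) \<Rightarrow> real^'n) \<Rightarrow> (real^'n) set \<Rightarrow> (real^'m) set \<Rightarrow> (real^'n) set \<Rightarrow> real \<Rightarrow>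
   (real \<times> (real^'n)) set"
where
  "admissible_data f X U XT T =
     {(t0, x0). t0 \<in> {0..T} \<and> x0 \<in> X \<and> (\<exists>x u. admissible f X U XT T t0 x0 x u)}"

(* Measurability into prob_algebra says that t \<mapsto> \<omega> t B is measurable for every Borel subset B
   of U; it also contains \<omega> t being a Borel probability measure on U for t in {t0..T}. *)
definition relaxed_admissible ::
  "((real^'n) \<times> (real^'m) \<Rightarrow> real^'n) \<Rightarrow> (real^'n) set \<Rightarrow> (real^'m) set \<Rightarrow> (real^'n) set \<Rightarrow> real \<Rightarrow>
   real \<Rightarrow> real^'n \<Rightarrow> (real \<Rightarrow> real^'n) \<Rightarrow> (real \<Rightarrow> (real^'m) measure) \<Rightarrow> bool"
where
  "relaxed_admissible f X U XT T t0 x0 x \<omega> \<longleftrightarrow>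
     x \<in> borel_measurable (lebesgue_on {t0..T}) \<and>
     \<omega> \<in> lebesgue_on {t0..T} \<rightarrow>\<^sub>M prob_algebra (restrict_space borel U) \<and>
     (\<forall>t\<in>{t0..T}. x t = x0 + (LINT s:{t0..t}|lebesgue. (LINT u|\<omega> s. f (x s, u)))) \<and>
     (\<forall>t\<in>{t0..T}. x t \<in> X) \<and>
     x T \<in> XT"

definition relaxed_cost ::
  "((real^'n) \<times> (real^'m) \<Rightarrow> real) \<Rightarrow> (real^'n \<Rightarrow> real) \<Rightarrow> real \<Rightarrow>
   real \<Rightarrow> (real \<Rightarrow> real^'n) \<Rightarrow> (real \<Rightarrow> (real^'m) measure) \<Rightarrow> real"
where
  "relaxed_cost l lT T t0 x \<omega> = (LINT t:{t0..T}|lebesgue. (LINT u|\<omega> t. l (x t, u))) + lT (x T)"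

definition relaxed_value ::
  "((real^'n) \<times> (real^'m) \<Rightarrow> real) \<Rightarrow> (real^'n \<Rightarrow> real) \<Rightarrow> ((real^'n) \<times> (real^'m) \<Rightarrow> real^'n) \<Rightarrow>
   (real^'n) set \<Rightarrow> (real^'m) set \<Rightarrow> (real^'n) set \<Rightarrow> real \<Rightarrow> real \<times> (real^'n) \<Rightarrow> ereal"
where
  "relaxed_value l lT f X U XT T = (\<lambda>(t0, x0).
     INF (x, \<omega>) \<in> {(x, \<omega>). relaxed_admissible f X U XT T t0 x0 x \<omega>}.
       ereal (relaxed_cost l lT T t0 x \<omega>))"

definition relaxed_minimizer ::
  "((real^'n) \<times> (real^'m) \<Rightarrow> real) \<Rightarrow> (real^'n \<Rightarrow> real) \<Rightarrow> ((real^'n) \<times> (real^'m) \<Rightarrow> real^'n) \<Rightarrow>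
   (real^'n) set \<Rightarrow> (real^'m) set \<Rightarrow> (real^'n) set \<Rightarrow> real \<Rightarrow>
   real \<Rightarrow> real^'n \<Rightarrow> (real \<Rightarrow> real^'n) \<Rightarrow> (real \<Rightarrow> (real^'m) measure) \<Rightarrow> bool"
where
  "relaxed_minimizer l lT f X U XT T t0 x0 x \<omega> \<longleftrightarrow>
     relaxed_admissible f X U XT T t0 x0 x \<omega> \<and>
     ereal (relaxed_cost l lT T t0 x \<omega>) = relaxed_value l lT f X U XT T (t0, x0)"

definition no_relaxation_gap ::
  "((real^'n) \<times> (real^'m) \<Rightarrow> real^'n) \<Rightarrow> (real^'n) set \<Rightarrow> (real^'m) set \<Rightarrow> (real^'n) set \<Rightarrow> real \<Rightarrow> bool"
where
  "no_relaxation_gap f X U XT T \<longleftrightarrow>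
     (\<forall>t0\<in>{0..T}. \<forall>x0\<in>X. \<forall>x \<omega>. relaxed_admissible f X U XT T t0 x0 x \<omega> \<longrightarrow>
       (\<exists>xs us. (\<forall>k::nat. admissible f X U XT T t0 x0 (xs k) (us k)) \<and>
          (\<forall>v :: (real^'n) \<times> (real^'m) \<Rightarrow> real. continuous_on (X \<times> U) v \<longrightarrow>
             (\<lambda>k. LINT t:{t0..T}|lebesgue. v (xs k t, us k t))
               \<longlonglongrightarrow> (LINT t:{t0..T}|lebesgue. (LINT u|\<omega> t. v (x t, u))))))"

definition nonneg_continuous :: "'a::topological_space set \<Rightarrow> ('a \<Rightarrow> real) set" where
  "nonneg_continuous K = {g. continuous_on K g \<and> (\<forall>z\<in>K. 0 \<le> g z)}"

(* Continuously differentiable on some open neighbourhood of S. *)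
definition C1_near :: "'a::real_normed_vector set \<Rightarrow> ('a \<Rightarrow> real) set" where
  "C1_near S = {v. \<exists>N. open N \<and> S \<subseteq> N \<and>
     (\<exists>v'. (\<forall>z\<in>N. (v has_derivative blinfun_apply (v' z)) (at z)) \<and> continuous_on N v')}"

definition grad :: "('a::real_inner \<Rightarrow> real) \<Rightarrow> 'a \<Rightarrow> 'a" where
  "grad g x = (THE D. GDERIV g x :> D)"

definition dual_admissible ::
  "((real^'n) \<times> (real^'m) \<Rightarrow> real) \<Rightarrow> (real^'n \<Rightarrow> real) \<Rightarrow> ((real^'n) \<times> (real^'m) \<Rightarrow> real^'n) \<Rightarrow>
   (real^'n) set \<Rightarrow> (real^'m) set \<Rightarrow> (real^'n) set \<Rightarrow> real \<Rightarrow> real \<Rightarrow>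
   (real \<times> (real^'n) \<Rightarrow> real) \<Rightarrow> bool"
where
  "dual_admissible l lT f X U XT T t0 v \<longleftrightarrow>
     v \<in> C1_near ({t0..T} \<times> X) \<and>
     (\<lambda>(t, x, u). l (x, u) + deriv (\<lambda>s. v (s, x)) t + grad (\<lambda>y. v (t, y)) x \<bullet> f (x, u))
       \<in> nonneg_continuous ({t0..T} \<times> X \<times> U) \<and>
     (\<lambda>x. lT x - v (T, x)) \<in> nonneg_continuous XT"

definition dual_value ::
  "((real^'n) \<times> (real^'m) \<Rightarrow> real) \<Rightarrow> (real^'n \<Rightarrow> real) \<Rightarrow> ((real^'n) \<times> (real^'m) \<Rightarrow> real^'n) \<Rightarrow>
   (real^'n) set \<Rightarrow> (real^'m) set \<Rightarrow> (real^'n) set \<Rightarrow> real \<Rightarrow> real \<times> (real^'n) \<Rightarrow> ereal"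
where
  "dual_value l lT f X U XT T = (\<lambda>(t0, x0).
     SUP v \<in> {v. dual_admissible l lT f X U XT T t0 v}. ereal (v (t0, x0)))"

end

theory Submission
  imports Defs "HOL-Complex_Analysis.Great_Picard"
begin

text \<open>
  The two inequalities come from one monotonicity.  If \<open>v\<close> is admissible for the dual program and
  \<open>(x, \<omega>)\<close> is a relaxed trajectory, the chain rule and the dual constraint, averaged over \<open>\<omega>\<close>, show
  that \<open>v (t, x t)\<close> plus the running cost spent up to time \<open>t\<close> is nondecreasing in \<open>t\<close>
  (\<open>dual_increment_le_running_cost\<close>).  Read on pairs that start at \<open>(t, x t)\<close> and with the terminal
  constraint on \<open>v\<close>, this says that \<open>v\<close> lies below the value function.  Read on the minimizer from \<open>t0\<close>
  to \<open>t\<close>, it bounds \<open>v (t0, x0)\<close> by \<open>v (t, x t)\<close> plus the cost already spent.  The rest of a minimizer is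
  a relaxed trajectory from \<open>(t, x t)\<close>, and in the absence of a relaxation gap its cost is at least the
  value there (\<open>value_le_relaxed_cost\<close>).  The second inequality is the sum of these two bounds.

  The convergence is strong duality (\<open>relaxed_value_le_dual_value\<close>): the dual value is not smaller than
  the relaxed value.  Nearly optimal dual functions are constructed, not deduced from a separation
  theorem in a space of measures.  Replace the state and terminal constraints by penalties with a large
  weight, compose the data with the projection onto a ball around \<open>X\<close>, and discretize time with
  step \<open>\<tau>\<close>.  The value \<open>V\<close> of the discrete problem satisfies the dynamic programming inequality
  \<open>V \<tau> (Suc n) x \<le> \<tau> c(x, u) + V \<tau> n (x + \<tau> F(x, u))\<close> for each \<open>u\<close>.  Smoothing \<open>V\<close> in time and space at
  scale \<open>\<delta>\<close> turns it into the differential inequality of the dual program, with an error that vanishes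
  when first \<open>\<tau>\<close> and then \<open>\<delta>\<close> tends to 0 and that a small affine function of time absorbs
  (\<open>smooth_subsolution_near_V\<close>).  As the penalties vanish on the constraint sets, the result is
  admissible for the dual program.

  If the dual value were smaller than the relaxed value, the discrete penalized values would stay below
  some \<open>r\<close> strictly between them while the weight tends to infinity and \<open>\<tau>\<close> to 0.  Then there are Euler polygons
  whose penalized costs are less than \<open>r\<close>.  They have a uniform limit along a subsequence by the theorem of Arzela and
  Ascoli, and the growing penalties force this limit to stay in \<open>X\<close> and to end in \<open>XT\<close>.  The limit of the
  pair of state and running cost is Lipschitz, hence has a density, and comparison of support functions
  puts this density in the convex hull of the attainable velocities at almost every time.
  Caratheodory's theorem and a measurable selection represent it as an average over a measurable family
  of finitely supported probability measures (\<open>euler_relaxed_limit\<close>).  So the limit is a relaxed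
  trajectory of cost at most \<open>r\<close>, which contradicts the choice of \<open>r\<close>.
\<close>

section \<open>Densities of Lipschitz curves\<close>

text \<open>
  Adding a multiple of the identity makes the function expanding, hence a bijection of the line with a
  monotone inverse.  The image of Lebesgue measure under this inverse assigns to an interval the
  increment of the function.  It is absolutely continuous since Lipschitz maps preserve null sets, and
  its Radon-Nikodym derivative is the wanted density up to the added constant.
\<close>

lemma lipschitz_real_has_density:
  fixes \<phi> :: "real \<Rightarrow> real"
  assumes lip: "L-lipschitz_on UNIV \<phi>"
  obtains g where "g \<in> borel_measurable borel"
    "\<And>a b. a \<le> b \<Longrightarrow> set_integrable lborel {a..b} g"
    "\<And>a b. a \<le> b \<Longrightarrow> (LINT s:{a..b}|lborel. g s) = \<phi> b - \<phi> a"
proof -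
  have L0: "0 \<le> L" using lip lipschitz_on_nonneg by blast
  define \<Phi> where "\<Phi> = (\<lambda>t. \<phi> t + (L + 1) * t)"
  have \<phi>_bd: "\<bar>\<phi> b - \<phi> a\<bar> \<le> L * (b - a)" if "a \<le> b" for a b
    using lipschitz_onD[OF lip, of b a] that by (simp add: dist_real_def)
  \<comment> \<open>The slope \<open>L + 1\<close> in \<open>\<Phi>\<close> is one more than needed for monotonicity, so that \<open>\<Phi>\<close> expands distances.\<close>
  have lower: "b - a \<le> \<Phi> b - \<Phi> a" if "a \<le> b" for a b
    using \<phi>_bd[OF that] unfolding \<Phi>_def by (auto simp: algebra_simps abs_le_iff)
  have upper: "\<bar>\<Phi> b - \<Phi> a\<bar> \<le> (2 * L + 1) * \<bar>b - a\<bar>" for a b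
  proof -
    have *: "\<bar>\<Phi> b - \<Phi> a\<bar> \<le> (2 * L + 1) * \<bar>b - a\<bar>" if "a \<le> b" for a b
      using \<phi>_bd[OF that] lower[OF that] that unfolding \<Phi>_def by (auto simp: algebra_simps abs_le_iff)
    show ?thesis using *[of a b] *[of b a] by (cases "a \<le> b") (auto simp: abs_minus_commute)
  qed
  have strict: "\<Phi> a < \<Phi> b \<longleftrightarrow> a < b" for a b
    using lower[of a b] lower[of b a] by (cases "a < b") auto
  have mono: "\<Phi> a \<le> \<Phi> b \<longleftrightarrow> a \<le> b" for a b
    using strict[of b a] by (auto simp: not_less[symmetric])
  have cont: "continuous_on A \<Phi>" for A
    unfolding \<Phi>_def using lipschitz_on_continuous_on[OF lip]
    by (intro continuous_intros) (auto intro: continuous_on_subset)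
  have surj: "\<exists>x. \<Phi> x = y" for y
  proof -
    define r where "r = \<bar>y - \<Phi> 0\<bar>"
    have "\<Phi> (-r) \<le> y" "y \<le> \<Phi> r"
      using lower[of "-r" 0] lower[of 0 r] unfolding r_def by auto
    then show ?thesis using IVT'[of \<Phi> "-r" y r] cont by (auto simp: r_def)
  qed
  have inj: "inj \<Phi>"
    by (rule injI) (metis mono order_antisym order_refl)
  define \<Psi> where "\<Psi> = inv \<Phi>"
  have \<Phi>\<Psi>: "\<Phi> (\<Psi> y) = y" and \<Psi>\<Phi>: "\<Psi> (\<Phi> x) = x" for x y
    unfolding \<Psi>_def using surj[of y] by (auto simp: inj inv_f_f f_inv_into_f)
  have "mono \<Psi>" by (rule monoI) (metis \<Phi>\<Psi> mono)
  then have [measurable]: "\<Psi> \<in> borel_measurable borel" by (rule borel_measurable_mono)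
  have vim: "\<Psi> -` A = \<Phi> ` A" for A using \<Phi>\<Psi> \<Psi>\<Phi> by (auto simp: image_iff) metis
  define \<nu> where "\<nu> = distr lborel borel \<Psi>"
  have em\<nu>: "emeasure \<nu> A = emeasure lborel (\<Phi> ` A)" if "A \<in> sets borel" for A
    using that unfolding \<nu>_def by (simp add: emeasure_distr vim)
  have imgI: "\<Phi> ` {a..b} = {\<Phi> a..\<Phi> b}" for a b
    unfolding vim[symmetric] by (auto simp: mono) (metis \<Phi>\<Psi> mono)+
  have nuI: "emeasure \<nu> {a..b} = ennreal (\<Phi> b - \<Phi> a)" if "a \<le> b" for a b
    using that by (simp add: em\<nu> imgI mono)
  have ac: "absolutely_continuous lborel \<nu>"
    unfolding absolutely_continuous_def
  proof
    fix A :: "real set" assume A: "A \<in> null_sets lborel"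
    then have Ab: "A \<in> sets borel" by auto
    have "negligible A" using A by (simp add: negligible_iff_null_sets null_sets_completionI)
    then have "negligible (\<Phi> ` A)"
      by (intro negligible_locally_Lipschitz_image) (auto intro!: exI[of _ UNIV] exI[of _ "2*L+1"] simp: upper)
    moreover have "\<Phi> ` A \<in> sets lborel"
      unfolding vim[symmetric] using measurable_sets_borel[OF _ Ab, of \<Psi>] by simp
    ultimately have "emeasure lborel (\<Phi> ` A) = 0"
      by (simp add: negligible_iff_null_sets null_sets_completion_iff null_setsD1)
    then show "A \<in> null_sets \<nu>" using Ab em\<nu>[OF Ab] unfolding \<nu>_def by (auto intro!: null_setsI)
  qed
  have "sets \<nu> = sets lborel" by (simp add: \<nu>_def)
  from sigma_finite_measure.Radon_Nikodym[OF sigma_finite_lborel ac this] obtain h :: "real \<Rightarrow> ennreal" where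
    h[measurable]: "h \<in> borel_measurable borel" and d: "density lborel h = \<nu>" by auto
  have nnh: "(\<integral>\<^sup>+s. h s * indicator {a..b} s \<partial>lborel) = ennreal (\<Phi> b - \<Phi> a)" if "a \<le> b" for a b
    using nuI[OF that] unfolding d[symmetric] by (subst (asm) emeasure_density) auto
  define g0 where "g0 = (\<lambda>s. enn2real (h s))"
  have [measurable]: "g0 \<in> borel_measurable borel" unfolding g0_def by measurable
  have g0: "has_bochner_integral lborel (\<lambda>s. indicator {a..b} s * g0 s) (\<Phi> b - \<Phi> a)" if "a \<le> b" for a b
  proof (rule has_bochner_integral_nn_integral)
    have "AE s in lborel. h s * indicator {a..b} s \<noteq> \<infinity>"
      by (rule nn_integral_PInf_AE) (use nnh[OF that] in auto)
    then have "(\<integral>\<^sup>+s. ennreal (indicator {a..b} s * g0 s) \<partial>lborel) = (\<integral>\<^sup>+s. h s * indicator {a..b} s \<partial>lborel)"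
      by (intro nn_integral_cong_AE) (auto simp: g0_def indicator_def less_top ennreal_enn2real_if)
    then show "(\<integral>\<^sup>+s. ennreal (indicator {a..b} s * g0 s) \<partial>lborel) = ennreal (\<Phi> b - \<Phi> a)"
      using nnh[OF that] by simp
  qed (use that in \<open>auto simp: g0_def mono\<close>)
  define g where "g = (\<lambda>s. g0 s - (L + 1))"
  have c: "set_integrable lborel {a..b} (\<lambda>_. L + 1)" for a b :: real
    by (intro borel_integrable_atLeastAtMost') auto
  have i0: "set_integrable lborel {a..b} g0" "(LINT s:{a..b}|lborel. g0 s) = \<Phi> b - \<Phi> a" if "a \<le> b" for a b
    using g0[OF that] by (auto simp: set_integrable_def set_lebesgue_integral_def has_bochner_integral_iff)
  show ?thesis
  proof (rule that[of g])
    show "g \<in> borel_measurable borel" unfolding g_def by measurable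
    show "set_integrable lborel {a..b} g" if "a \<le> b" for a b
      unfolding g_def by (intro set_integral_diff i0 that c)
    show "(LINT s:{a..b}|lborel. g s) = \<phi> b - \<phi> a" if "a \<le> b" for a b
      unfolding g_def using that
      by (subst set_integral_diff(2)[OF i0(1)[OF that] c]) (simp add: i0 \<Phi>_def algebra_simps set_integral_const)
  qed
qed

lemma lipschitz_has_density:
  fixes y :: "real \<Rightarrow> 'a::euclidean_space"
  assumes lip: "L-lipschitz_on UNIV y"
  obtains g where "g \<in> borel_measurable borel"
    "\<And>a b. a \<le> b \<Longrightarrow> set_integrable lborel {a..b} g"
    "\<And>a b. a \<le> b \<Longrightarrow> (LINT s:{a..b}|lborel. g s) = y b - y a"
proof -
  have "\<exists>g. g \<in> borel_measurable borel \<and> (\<forall>a b. a \<le> b \<longrightarrow> set_integrable lborel {a..b} g \<and>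
      (LINT s:{a..b}|lborel. g s) = y b \<bullet> i - y a \<bullet> i)" if "i \<in> Basis" for i
  proof -
    have "L-lipschitz_on UNIV (\<lambda>t. y t \<bullet> i)"
    proof (rule lipschitz_onI)
      show "dist (y s \<bullet> i) (y t \<bullet> i) \<le> L * dist s t" for s t
        using lipschitz_onD[OF lip, of s t] Basis_le_norm[OF that, of "y s - y t"]
        by (simp add: dist_norm inner_diff_left)
    qed (use lip lipschitz_on_nonneg in blast)
    from lipschitz_real_has_density[OF this] show ?thesis by metis
  qed
  then obtain G where G: "\<And>i. i \<in> Basis \<Longrightarrow> G i \<in> borel_measurable borel"
    "\<And>i a b. i \<in> Basis \<Longrightarrow> a \<le> b \<Longrightarrow> set_integrable lborel {a..b} (G i)"
    "\<And>i a b. i \<in> Basis \<Longrightarrow> a \<le> b \<Longrightarrow> (LINT s:{a..b}|lborel. G i s) = y b \<bullet> i - y a \<bullet> i"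
    by metis
  define g where "g = (\<lambda>s. \<Sum>i\<in>Basis. G i s *\<^sub>R i)"
  have I: "has_bochner_integral lborel (\<lambda>s. indicator {a..b} s *\<^sub>R g s) (y b - y a)" if "a \<le> b" for a b
  proof -
    have "has_bochner_integral lborel (\<lambda>s. \<Sum>i\<in>Basis. (indicator {a..b} s * G i s) *\<^sub>R i)
       (\<Sum>i\<in>Basis. (y b \<bullet> i - y a \<bullet> i) *\<^sub>R i)"
      using G(2,3)[OF _ that]
      by (intro has_bochner_integral_sum has_bochner_integral_scaleR_left)
        (auto simp: set_integrable_def set_lebesgue_integral_def has_bochner_integral_iff)
    then show ?thesis
      by (simp add: g_def scaleR_sum_right inner_diff_left[symmetric] euclidean_representation)
  qed
  show ?thesis
  proof (rule that[of g])
    show "g \<in> borel_measurable borel" unfolding g_def using G(1) by measurable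
  qed (use I in \<open>auto simp: set_integrable_def set_lebesgue_integral_def has_bochner_integral_iff\<close>)
qed

text \<open>
  The indefinite integral of \<open>f\<close> is monotone and continuous, so it defines an interval measure.  This
  measure agrees with \<open>f\<close> times Lebesgue measure on half-open intervals and therefore on Borel sets.
  Its value on the set where \<open>f\<close> is negative is nonnegative, so this set is null.
\<close>

lemma AE_nonneg_if_interval_integrals_nonneg:
  fixes f :: "real \<Rightarrow> real"
  assumes AB: "A \<le> B" and int: "set_integrable lborel {A..B} f"
    and nonneg: "\<And>a b. A \<le> a \<Longrightarrow> a \<le> b \<Longrightarrow> b \<le> B \<Longrightarrow> 0 \<le> (LINT s:{a..b}|lborel. f s)"
  shows "AE s in lborel. s \<in> {A..B} \<longrightarrow> 0 \<le> f s"
proof -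
  define F where "F = (\<lambda>s. indicator {A..B} s * f s)"
  have F: "integrable lborel F" using int by (simp add: F_def set_integrable_def)
  then have [measurable]: "F \<in> borel_measurable borel" by auto
  have sub: "set_integrable lborel C f" if "C \<subseteq> {A..B}" "C \<in> sets borel" for C
    using set_integrable_subset[OF int _ that(1)] that(2) by simp
  define cl where "cl = (\<lambda>t::real. max A (min B t))"
  have cl: "A \<le> cl t" "cl t \<le> B" "s \<le> t \<Longrightarrow> cl s \<le> cl t" for s t using AB by (auto simp: cl_def)
  define \<Phi> where "\<Phi> = (\<lambda>t. integral {A..cl t} f)"
  have fint: "f integrable_on {A..B}" using set_borel_integral_eq_integral(1)[OF int] .
  have \<Phi>_diff: "\<Phi> b - \<Phi> a = (LINT s:{cl a..cl b}|lborel. f s)" if "a \<le> b" for a b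
  proof -
    have "integral {A..cl a} f + integral {cl a..cl b} f = integral {A..cl b} f"
      by (rule Henstock_Kurzweil_Integration.integral_combine)
        (use cl that integrable_on_subinterval[OF fint] in auto)
    moreover have "(LINT s:{cl a..cl b}|lborel. f s) = integral {cl a..cl b} f"
      by (rule set_borel_integral_eq_integral(2)) (use cl in \<open>auto intro!: sub intro: order_trans[OF cl(1)] order_trans[OF _ cl(2)]\<close>)
    ultimately show ?thesis unfolding \<Phi>_def by linarith
  qed
  have mono: "\<Phi> a \<le> \<Phi> b" if "a \<le> b" for a b
    using \<Phi>_diff[OF that] nonneg[of "cl a" "cl b"] cl that by auto
  have cont: "continuous_on UNIV \<Phi>"
    unfolding \<Phi>_def
    by (rule continuous_on_compose2[OF indefinite_integral_continuous_1[OF fint]])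
      (auto simp: cl_def intro!: continuous_intros AB)
  have rc: "continuous (at_right a) \<Phi>" for a
    using cont by (meson UNIV_I continuous_at_imp_continuous_within continuous_on_eq_continuous_at open_UNIV)
  define \<kappa> where "\<kappa> = interval_measure \<Phi>"
  have set\<kappa>: "sets \<kappa> = sets borel" by (simp add: \<kappa>_def)
  have FI: "(LINT s:C|lborel. F s) = (LINT s:(C \<inter> {A..B})|lborel. f s)" for C
    unfolding set_lebesgue_integral_def F_def
    by (intro Bochner_Integration.integral_cong) (auto simp: indicator_def)
  have Iio: "measure \<kappa> {a<..b} = (LINT s:{a<..b}|lborel. F s)" for a b
  proof (cases "a \<le> b")
    case True
    have "measure \<kappa> {a<..b} = \<Phi> b - \<Phi> a"
      using emeasure_interval_measure_Ioc[OF True mono rc] mono[OF True] unfolding \<kappa>_def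
      by (simp add: measure_def)
    also have "\<dots> = (LINT s:{cl a..cl b}|lborel. f s)" using \<Phi>_diff[OF True] .
    also have "\<dots> = (LINT s:({a<..b} \<inter> {A..B})|lborel. f s)"
    proof (rule set_integral_cong_set)
      show "AE x in lborel. (x \<in> {a<..b} \<inter> {A..B}) = (x \<in> {cl a..cl b})"
        using AE_lborel_singleton[of "cl a"] AE_lborel_singleton[of "cl b"]
        by eventually_elim (auto simp: cl_def max_def min_def split: if_splits)
    qed (use sub[of "{cl a..cl b}"] sub[of "{a<..b} \<inter> {A..B}"] cl in \<open>auto simp: set_borel_measurable_def set_integrable_def\<close>)
    finally show ?thesis by (simp add: FI)
  qed (simp add: set_lebesgue_integral_def)
  have fin: "emeasure \<kappa> {A-1<..B} < \<infinity>"
    unfolding \<kappa>_def using emeasure_interval_measure_Ioc[of "A-1" B \<Phi>] mono rc AB by simp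
  have stable: "Int_stable (range (\<lambda>(a, b). {a <.. b::real}))"
    by (auto simp: Int_stable_def image_iff)
  have Pow_UNIV': "range (\<lambda>(a, b). {a <.. b::real}) \<subseteq> Pow UNIV" by simp
  \<comment> \<open>Both sides are restricted to a bounded interval that contains \<open>{A..B}\<close> so that complements have finite
    measure; the left end \<open>A - 1\<close> keeps the point \<open>A\<close> inside the half-open interval.\<close>
  have key: "measure \<kappa> (C \<inter> {A-1<..B}) = (LINT s:(C \<inter> {A-1<..B})|lborel. F s)"
    if "C \<in> sigma_sets UNIV (range (\<lambda>(a, b). {a <.. b::real}))" for C
    using stable Pow_UNIV' that
  proof (induction rule: sigma_sets_induct_disjoint)
    case (basic C)
    then obtain a b where "C = {a<..b}" by auto
    then have "C \<inter> {A-1<..B} = {max a (A-1)<..min b B}" by auto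
    then show ?case using Iio by simp
  next
    case empty show ?case by (simp add: set_lebesgue_integral_def)
  next
    case (compl C)
    have [measurable]: "C \<in> sets borel" using compl(1) borel_sigma_sets_Ioc by (metis sets_measure_of top_greatest Pow_UNIV)
    have eq: "(UNIV - C) \<inter> {A-1<..B} = {A-1<..B} - (C \<inter> {A-1<..B})" by auto
    have "measure \<kappa> ({A-1<..B} - (C \<inter> {A-1<..B})) = measure \<kappa> {A-1<..B} - measure \<kappa> (C \<inter> {A-1<..B})"
      by (rule measure_Diff) (use fin in \<open>auto simp: set\<kappa>\<close>)
    also have "\<dots> = (LINT s:{A-1<..B}|lborel. F s) - (LINT s:(C \<inter> {A-1<..B})|lborel. F s)"
      using compl Iio by simp
    also have "\<dots> = (LINT s:({A-1<..B} - (C \<inter> {A-1<..B}))|lborel. F s)"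
    proof -
      have "(LINT s:(({A-1<..B} - (C \<inter> {A-1<..B})) \<union> (C \<inter> {A-1<..B}))|lborel. F s) =
        (LINT s:({A-1<..B} - (C \<inter> {A-1<..B}))|lborel. F s) + (LINT s:(C \<inter> {A-1<..B})|lborel. F s)"
        by (rule set_integral_Un) (auto intro!: integrable_mult_indicator F simp: set_integrable_def simp del: real_scaleR_def)
      moreover have "({A-1<..B} - (C \<inter> {A-1<..B})) \<union> (C \<inter> {A-1<..B}) = {A-1<..B}" by auto
      ultimately show ?thesis by simp
    qed
    finally show ?case unfolding eq .
  next
    case (union D)
    have Db: "D i \<in> sets borel" for i
      using union(2) borel_sigma_sets_Ioc by (metis UNIV_I image_subset_iff sets_measure_of top_greatest Pow_UNIV)
    let ?D = "\<lambda>i. D i \<inter> {A-1<..B}"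
    have eq: "(\<Union>i. D i) \<inter> {A-1<..B} = (\<Union>i. ?D i)" by auto
    have dj: "disjoint_family ?D" using union(1) by (auto simp: disjoint_family_on_def)
    have "(\<lambda>i. measure \<kappa> (?D i)) sums measure \<kappa> (\<Union>i. ?D i)"
    proof (rule measure_UNION)
      have "emeasure \<kappa> (\<Union>i. ?D i) \<le> emeasure \<kappa> {A-1<..B}"
        by (rule emeasure_mono) (auto simp: set\<kappa>)
      then show "emeasure \<kappa> (\<Union>i. ?D i) \<noteq> \<infinity>" using fin by (auto simp: top_unique)
    qed (use Db dj in \<open>auto simp: set\<kappa>\<close>)
    then have s1: "(\<lambda>i. LINT s:?D i|lborel. F s) sums measure \<kappa> (\<Union>i. ?D i)"
      using union.IH by simp
    have "(LINT s:(\<Union>i. ?D i)|lborel. F s) = (\<Sum>i. LINT s:?D i|lborel. F s)"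
    proof (rule lebesgue_integral_countable_add)
      have [measurable]: "(\<Union>i. ?D i) \<in> sets borel" using Db by auto
      show "set_integrable lborel (\<Union>i. ?D i) F"
        unfolding set_integrable_def by (rule integrable_mult_indicator[OF _ F]) measurable
    qed (use Db dj in \<open>auto simp: disjoint_family_on_def\<close>)
    then show ?case unfolding eq using sums_unique[OF s1] by simp
  qed
  define C where "C = {s \<in> {A..B}. F s < 0}"
  have Cb[measurable]: "C \<in> sets borel" unfolding C_def by measurable
  have "C \<in> sigma_sets UNIV (range (\<lambda>(a, b). {a <.. b::real}))"
    using Cb borel_sigma_sets_Ioc by (metis sets_measure_of top_greatest Pow_UNIV)
  from key[OF this] have "(LINT s:(C \<inter> {A-1<..B})|lborel. F s) \<ge> 0" by (metis measure_nonneg)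
  moreover have "C \<inter> {A-1<..B} = C" unfolding C_def by auto
  ultimately have ge: "(LINT s:C|lborel. F s) \<ge> 0" by simp
  let ?h = "\<lambda>s. indicator C s * - F s"
  have hi: "integrable lborel ?h"
    using integrable_mult_indicator[OF _ F, of C] by (simp add: integrable_minus[of _ "\<lambda>s. indicator C s * F s", simplified])
  have h0: "0 \<le> ?h s" for s by (auto simp: C_def indicator_def)
  have "integral\<^sup>L lborel ?h = - (LINT s:C|lborel. F s)" by (simp add: set_lebesgue_integral_def)
  then have "integral\<^sup>L lborel ?h = 0"
    using ge integral_nonneg_AE[of ?h lborel] h0 by (simp add: order_antisym_conv)
  then have "AE s in lborel. ?h s = 0"
    using integral_nonneg_eq_0_iff_AE[OF hi] h0 by simp
  then show ?thesis
    by eventually_elim (auto simp: C_def F_def indicator_def split: if_splits)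
qed

section \<open>Measurable selection of relaxed controls\<close>

text \<open>
  One step of the lexicographic selection below.  The minimum of a coordinate over the zero set of
  \<open>d s\<close> is at most \<open>a\<close> exactly when \<open>d s\<close> has a zero in a compact half of \<open>K\<close>, and by compactness this means
  that \<open>d s\<close> takes arbitrarily small values on a countable dense subset of that half.
\<close>

lemma measurable_attained_minimum:
  fixes d :: "'s \<Rightarrow> 'a::euclidean_space \<Rightarrow> real"
  assumes K: "compact K"
    and meas: "\<And>q. q \<in> K \<Longrightarrow> (\<lambda>s. d s q) \<in> borel_measurable M"
    and cont: "\<And>s. s \<in> space M \<Longrightarrow> continuous_on K (d s)"
    and nonneg: "\<And>s q. s \<in> space M \<Longrightarrow> q \<in> K \<Longrightarrow> 0 \<le> d s q"
    and zero: "\<And>s. s \<in> space M \<Longrightarrow> \<exists>q\<in>K. d s q = 0"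
  obtains m where "m \<in> borel_measurable M"
    "\<And>s. s \<in> space M \<Longrightarrow> \<exists>q\<in>K. d s q = 0 \<and> q \<bullet> b = m s"
proof -
  define Z where "Z = (\<lambda>s. {q \<in> K. d s q = 0})"
  define m where "m = (\<lambda>s. Inf ((\<lambda>q. q \<bullet> b) ` Z s))"
  have Zc: "compact (Z s)" if "s \<in> space M" for s
    unfolding Z_def compact_eq_bounded_closed
    using continuous_closed_preimage_constant[OF cont[OF that] compact_imp_closed[OF K], of 0]
      bounded_subset[OF compact_imp_bounded[OF K], of "{q \<in> K. d s q = 0}"] by auto
  have min: "\<exists>q\<in>Z s. q \<bullet> b = m s \<and> (\<forall>q'\<in>Z s. m s \<le> q' \<bullet> b)" if s: "s \<in> space M" for s
  proof -
    have "Z s \<noteq> {}" using zero[OF s] by (auto simp: Z_def)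
    then obtain q where q: "q \<in> Z s" "\<And>q'. q' \<in> Z s \<Longrightarrow> q \<bullet> b \<le> q' \<bullet> b"
      using continuous_attains_inf[OF Zc[OF s], of "\<lambda>q. q \<bullet> b"]
      continuous_on_inner[OF continuous_on_id continuous_on_const, of "Z s" b] by (auto simp: id_def)
    then have "m s = q \<bullet> b"
      unfolding m_def by (intro cInf_eq_minimum) auto
    then show ?thesis using q by auto
  qed
  have set_eq: "{s \<in> space M. m s \<le> a} \<in> sets M" for a
  proof -
    define Ka where "Ka = K \<inter> {q. q \<bullet> b \<le> a}"
    have Ka: "compact Ka" unfolding Ka_def
      by (intro compact_Int_closed K) (intro closed_Collect_le continuous_intros)
    obtain D where D: "countable D" "D \<subseteq> Ka" "Ka \<subseteq> closure D"
      using separable by blast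
    have iff: "m s \<le> a \<longleftrightarrow> (\<forall>n::nat. \<exists>q\<in>D. d s q < 1 / (real n + 1))" if s: "s \<in> space M" for s
    proof
      assume "m s \<le> a"
      moreover obtain q where "q \<in> Z s" "q \<bullet> b = m s" using min[OF s] by blast
      ultimately have q: "q \<in> Ka" "d s q = 0" by (auto simp: Z_def Ka_def)
      show "\<forall>n::nat. \<exists>q\<in>D. d s q < 1 / (real n + 1)"
      proof
        fix n :: nat
        have "continuous_on Ka (d s)" using cont[OF s] by (rule continuous_on_subset) (auto simp: Ka_def)
        then obtain e where e: "e > 0" "\<And>q'. q' \<in> Ka \<Longrightarrow> dist q' q < e \<Longrightarrow> dist (d s q') (d s q) < 1 / (real n + 1)"
          using q(1) unfolding continuous_on_iff by (metis inverse_eq_divide inverse_positive_iff_positive of_nat_Suc of_nat_0_less_iff zero_less_Suc add.commute)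
        from q(1) D(3) e(1) obtain q' where "q' \<in> D" "dist q' q < e"
          by (metis closure_approachable subsetD)
        then show "\<exists>q\<in>D. d s q < 1 / (real n + 1)"
          using e(2)[of q'] D(2) q(2) by (auto simp: dist_real_def abs_less_iff intro!: bexI[of _ q'])
      qed
    next
      assume A: "\<forall>n::nat. \<exists>q\<in>D. d s q < 1 / (real n + 1)"
      then have "Ka \<noteq> {}" using D(2) by blast
      moreover have "continuous_on Ka (d s)" using cont[OF s] by (rule continuous_on_subset) (auto simp: Ka_def)
      ultimately obtain q where q: "q \<in> Ka" "\<And>q'. q' \<in> Ka \<Longrightarrow> d s q \<le> d s q'"
        using continuous_attains_inf[OF Ka] by blast
      have "d s q < 1 / (real n + 1)" for n
        using A D(2) q(2) by (meson order_le_less_trans subsetD)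
      then have "d s q < inverse (real (Suc n))" for n
        by (simp add: inverse_eq_divide add.commute)
      then have "d s q \<le> 0"
        using reals_Archimedean[of "d s q"] by (meson not_le order_less_asym)
      then have "q \<in> Z s" using nonneg[OF s, of q] q(1) by (auto simp: Z_def Ka_def)
      then show "m s \<le> a" using min[OF s] q(1) by (auto simp: Ka_def)
    qed
    have "{s \<in> space M. m s \<le> a} = (\<Inter>n::nat. \<Union>q\<in>D. {s \<in> space M. d s q < 1 / (real n + 1)}) \<inter> space M"
      using iff by auto
    also have "\<dots> \<in> sets M"
    proof -
      have "{s \<in> space M. d s q < 1 / (real n + 1)} \<in> sets M" if "q \<in> D" for n :: nat and q
      proof -
        have [measurable]: "(\<lambda>s. d s q) \<in> borel_measurable M" using that meas D(2) by (auto simp: Ka_def)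
        show ?thesis by measurable
      qed
      then have "(\<Union>q\<in>D. {s \<in> space M. d s q < 1 / (real n + 1)}) \<in> sets M" for n :: nat
        by (intro sets.countable_UN' D(1)) auto
      then show ?thesis by (intro sets.Int sets.countable_INT) auto
    qed
    finally show ?thesis .
  qed
  show ?thesis
  proof (rule that)
    show "m \<in> borel_measurable M" using set_eq by (simp add: borel_measurable_iff_le)
    show "\<exists>q\<in>K. d s q = 0 \<and> q \<bullet> b = m s" if "s \<in> space M" for s
      using min[OF that] by (auto simp: Z_def)
  qed
qed

text \<open>
  Choose the lexicographically smallest zero: minimize one coordinate after the other and, after each
  step, add the distance to the coordinates already found to \<open>d\<close>.  Each step keeps the measurability in \<open>s\<close> and the
  continuity in \<open>q\<close>, and after the last step the zero set is a single point with measurable coordinates.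
\<close>

lemma measurable_selection_compact:
  fixes d :: "'s \<Rightarrow> 'a::euclidean_space \<Rightarrow> real"
  assumes K: "compact K"
    and meas: "\<And>q. q \<in> K \<Longrightarrow> (\<lambda>s. d s q) \<in> borel_measurable M"
    and cont: "\<And>s. s \<in> space M \<Longrightarrow> continuous_on K (d s)"
    and nonneg: "\<And>s q. s \<in> space M \<Longrightarrow> q \<in> K \<Longrightarrow> 0 \<le> d s q"
    and zero: "\<And>s. s \<in> space M \<Longrightarrow> \<exists>q\<in>K. d s q = 0"
  obtains p where "p \<in> borel_measurable M"
    "\<And>s. s \<in> space M \<Longrightarrow> p s \<in> K \<and> d s (p s) = 0"
proof -
  have "\<exists>p\<in>borel_measurable M. \<forall>s\<in>space M. \<exists>q\<in>K. d s q = 0 \<and> (\<forall>b\<in>B. q \<bullet> b = p s \<bullet> b)"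
    if "B \<subseteq> Basis" for B :: "'a set"
    using finite_subset[OF that finite_Basis] that
  proof (induction B rule: finite_induct)
    case empty
    show ?case using zero by (intro bexI[of _ "\<lambda>_. 0"]) auto
  next
    case (insert b B)
    then obtain p where p[measurable]: "p \<in> borel_measurable M"
      and pq: "\<And>s. s \<in> space M \<Longrightarrow> \<exists>q\<in>K. d s q = 0 \<and> (\<forall>b\<in>B. q \<bullet> b = p s \<bullet> b)" by auto
    define d' where "d' = (\<lambda>s q. d s q + (\<Sum>c\<in>B. \<bar>q \<bullet> c - p s \<bullet> c\<bar>))"
    have d'0: "d' s q = 0 \<longleftrightarrow> d s q = 0 \<and> (\<forall>c\<in>B. q \<bullet> c = p s \<bullet> c)" if "s \<in> space M" "q \<in> K" for s q
      unfolding d'_def using nonneg[OF that] insert(1)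
      by (subst add_nonneg_eq_0_iff) (auto simp: sum_nonneg sum_nonneg_eq_0_iff)
    obtain m where m[measurable]: "m \<in> borel_measurable M"
      and mq: "\<And>s. s \<in> space M \<Longrightarrow> \<exists>q\<in>K. d' s q = 0 \<and> q \<bullet> b = m s"
    proof (rule measurable_attained_minimum[OF K, of d' M b])
      show "(\<lambda>s. d' s q) \<in> borel_measurable M" if "q \<in> K" for q
        using meas[OF that] unfolding d'_def by measurable
      show "continuous_on K (d' s)" if "s \<in> space M" for s
        using cont[OF that] unfolding d'_def by (intro continuous_intros)
      show "0 \<le> d' s q" if "s \<in> space M" "q \<in> K" for s q
        using nonneg[OF that] unfolding d'_def by (auto intro: add_nonneg_nonneg sum_nonneg)
      show "\<exists>q\<in>K. d' s q = 0" if "s \<in> space M" for s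
        using pq[OF that] d'0[OF that] by blast
    qed blast
    define p' where "p' = (\<lambda>s. p s + (m s - p s \<bullet> b) *\<^sub>R b)"
    have p'c: "p' s \<bullet> c = (if c = b then m s else p s \<bullet> c)" if "c \<in> insert b B" for s c
      using that insert(4) by (auto simp: p'_def inner_add_left inner_Basis subset_iff)
    show ?case
    proof (intro bexI[of _ p'] ballI)
      fix s assume s: "s \<in> space M"
      from mq[OF s] obtain q where q: "q \<in> K" "d' s q = 0" "q \<bullet> b = m s" by blast
      then show "\<exists>q\<in>K. d s q = 0 \<and> (\<forall>c\<in>insert b B. q \<bullet> c = p' s \<bullet> c)"
        using d'0[OF s q(1)] insert(2) by (intro bexI[of _ q]) (auto simp: p'c)
    qed (auto simp: p'_def)
  qed
  from this[OF order_refl] obtain p where p: "p \<in> borel_measurable M"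
    "\<And>s. s \<in> space M \<Longrightarrow> \<exists>q\<in>K. d s q = 0 \<and> (\<forall>b\<in>Basis. q \<bullet> b = p s \<bullet> b)" by auto
  show ?thesis
  proof (rule that[OF p(1)])
    show "p s \<in> K \<and> d s (p s) = 0" if "s \<in> space M" for s
      using p(2)[OF that] euclidean_eqI by metis
  qed
qed

text \<open>
  A fixed finite index type, with zero weights for surplus indices, makes the points of the convex hull
  the image of one compact parameter set, on which a measurable selection can work.
\<close>

lemma caratheodory_indexed:
  fixes S :: "'a::euclidean_space set" and k :: "'k::finite itself"
  assumes y: "y \<in> convex hull S" and card: "DIM('a) + 1 \<le> CARD('k)"
  obtains w :: "'k \<Rightarrow> real" and z :: "'k \<Rightarrow> 'a"
  where "\<And>i. 0 \<le> w i" "sum w UNIV = 1" "\<And>i. z i \<in> S" "y = (\<Sum>i\<in>UNIV. w i *\<^sub>R z i)"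
proof -
  from y obtain P u where P: "finite P" "P \<subseteq> S" "card P \<le> DIM('a) + 1"
    and u: "\<forall>x\<in>P. 0 \<le> u x" "sum u P = 1" "(\<Sum>v\<in>P. u v *\<^sub>R v) = y"
    unfolding convex_hull_caratheodory by auto
  have "card P \<le> card (UNIV :: 'k set)" using P(3) card by linarith
  then obtain h :: "'a \<Rightarrow> 'k" where h: "inj_on h P"
    using card_le_inj[OF P(1) finite_class.finite_UNIV] by blast
  from u(2) obtain v0 where v0: "v0 \<in> P" by fastforce
  define g where "g = (\<lambda>i. if i \<in> h ` P then inv_into P h i else v0)"
  define w where "w = (\<lambda>i. if i \<in> h ` P then u (g i) else 0)"
  have gh: "g (h v) = v" if "v \<in> P" for v using that h by (simp add: g_def)
  have gP: "g i \<in> P" for i using v0 by (auto simp: g_def inv_into_into)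
  have tr: "(\<Sum>i\<in>UNIV. w i *\<^sub>R c i) = (\<Sum>v\<in>P. u v *\<^sub>R c (h v))" for c :: "'k \<Rightarrow> 'c::real_vector"
  proof -
    have "(\<Sum>i\<in>UNIV. w i *\<^sub>R c i) = (\<Sum>i\<in>h ` P. w i *\<^sub>R c i)"
      by (rule sum.mono_neutral_right) (auto simp: w_def)
    also have "\<dots> = (\<Sum>v\<in>P. w (h v) *\<^sub>R c (h v))" using h by (simp add: sum.reindex)
    also have "\<dots> = (\<Sum>v\<in>P. u v *\<^sub>R c (h v))" by (rule sum.cong) (auto simp: w_def gh)
    finally show ?thesis .
  qed
  show ?thesis
  proof (rule that[of w g])
    show "0 \<le> w i" for i using u(1) gP by (simp add: w_def)
    show "sum w UNIV = 1" using tr[of "\<lambda>_. 1::real"] u(2) by simp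
    show "g i \<in> S" for i using gP P(2) by auto
    show "y = (\<Sum>i\<in>UNIV. w i *\<^sub>R g i)" using tr[of g] u(3) by (simp add: gh cong: sum.cong)
  qed
qed

lemma integrable_continuous_prob_compact:
  fixes h :: "'b::topological_space \<Rightarrow> 'a::euclidean_space"
  assumes \<mu>: "\<mu> \<in> space (prob_algebra (restrict_space borel U))"
    and U: "compact U" and h: "continuous_on U h"
  shows "integrable \<mu> h"
proof -
  from \<mu> have s: "sets \<mu> = sets (restrict_space borel U)" and "prob_space \<mu>"
    by (auto simp: space_prob_algebra)
  interpret prob_space \<mu> by fact
  have sp: "space \<mu> = U" using sets_eq_imp_space_eq[OF s] by (simp add: space_restrict_space)
  have hm: "h \<in> borel_measurable \<mu>"
    using borel_measurable_continuous_on_restrict[OF h] measurable_cong_sets[OF s refl] by blast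
  have "bounded (h ` U)" using compact_continuous_image[OF h U] compact_imp_bounded by blast
  then obtain B where "\<And>u. u \<in> U \<Longrightarrow> norm (h u) \<le> B" unfolding bounded_iff by auto
  then show ?thesis
    by (intro integrable_const_bound[OF _ hm, of B] AE_I2) (simp add: sp)
qed

lemma compact_weighted_points:
  fixes U :: "'b::euclidean_space set"
  assumes U: "compact U"
  shows "compact {q :: (real \<times> 'b) ^ ('k::finite). (\<forall>i. fst (q $ i) \<in> {0..1} \<and> snd (q $ i) \<in> U) \<and> (\<Sum>i\<in>UNIV. fst (q $ i)) = 1}"
    (is "compact ?K")
proof -
  let ?C = "{0..1::real} \<times> U"
  have C: "compact ?C" by (intro compact_Times U compact_Icc)
  have eq: "?K = (\<Inter>i. (\<lambda>q. q $ i) -` ?C) \<inter> {q. (\<Sum>i\<in>UNIV. fst (q $ i)) = 1}"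
    by (auto simp: mem_Times_iff)
  have "closed ?K" unfolding eq
    by (intro closed_Int closed_INT ballI continuous_closed_vimage closed_Collect_eq compact_imp_closed[OF C])
      (auto intro!: continuous_intros)
  moreover have "bounded ?K"
  proof -
    obtain B where B: "\<And>c. c \<in> ?C \<Longrightarrow> norm c \<le> B" using compact_imp_bounded[OF C] unfolding bounded_iff by blast
    have "norm q \<le> (\<Sum>i\<in>(UNIV::'k set). B)" if "q \<in> ?K" for q
    proof -
      have "norm q \<le> (\<Sum>i\<in>UNIV. norm (q $ i))" unfolding norm_vec_def by (rule L2_set_le_sum) auto
      also have "\<dots> \<le> (\<Sum>i\<in>(UNIV::'k set). B)"
        using that by (intro sum_mono B) (auto simp: mem_Times_iff)
      finally show ?thesis .
    qed
    then show ?thesis unfolding bounded_iff by blast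
  qed
  ultimately show ?thesis by (simp add: compact_eq_bounded_closed)
qed

text \<open>
  A velocity field with values in the convex hull of the attainable velocities is realized by relaxed
  controls: select weights and points of \<open>U\<close> measurably and take the finitely supported measures that
  they define.
\<close>

lemma measurable_relaxed_control_selection:
  fixes F :: "'s \<Rightarrow> 'b::euclidean_space \<Rightarrow> 'a::euclidean_space" and k :: "'k::finite itself"
  assumes card: "DIM('a) + 1 \<le> CARD('k)"
    and U: "compact U"
    and meas: "\<And>u. u \<in> U \<Longrightarrow> (\<lambda>s. F s u) \<in> borel_measurable M"
    and cont: "\<And>s. continuous_on U (F s)"
    and y: "y \<in> borel_measurable M"
    and hull: "\<And>s. s \<in> space M \<Longrightarrow> y s \<in> convex hull (F s ` U)"
  obtains \<omega> where "\<omega> \<in> M \<rightarrow>\<^sub>M prob_algebra (restrict_space borel U)"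
    "\<And>s. s \<in> space M \<Longrightarrow> (LINT u|\<omega> s. F s u) = y s"
proof -
  define K where "K = {q :: (real \<times> 'b) ^ 'k. (\<forall>i. fst (q $ i) \<in> {0..1} \<and> snd (q $ i) \<in> U) \<and> (\<Sum>i\<in>UNIV. fst (q $ i)) = 1}"
  define d where "d = (\<lambda>s (q :: (real \<times> 'b) ^ 'k). norm ((\<Sum>i\<in>UNIV. fst (q $ i) *\<^sub>R F s (snd (q $ i))) - y s))"
  obtain q where q: "q \<in> borel_measurable M" "\<And>s. s \<in> space M \<Longrightarrow> q s \<in> K \<and> d s (q s) = 0"
  proof (rule measurable_selection_compact[of K d M])
    show "compact K" unfolding K_def by (rule compact_weighted_points[OF U])
    show "(\<lambda>s. d s q) \<in> borel_measurable M" if "q \<in> K" for q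
    proof -
      have [measurable]: "(\<lambda>s. F s (snd (q $ i))) \<in> borel_measurable M" for i
        using that by (intro meas) (auto simp: K_def)
      show ?thesis using y unfolding d_def by measurable
    qed
    show "continuous_on K (d s)" for s
      unfolding d_def
      by (intro continuous_intros continuous_on_compose2[OF cont[of s]]) (auto simp: K_def)
    show "0 \<le> d s q" for s q by (simp add: d_def)
    show "\<exists>q\<in>K. d s q = 0" if s: "s \<in> space M" for s
    proof -
      obtain w :: "'k \<Rightarrow> real" and z where wz: "\<And>i. 0 \<le> w i" "sum w UNIV = 1" "\<And>i. z i \<in> F s ` U"
        "y s = (\<Sum>i\<in>UNIV. w i *\<^sub>R z i)"
        using caratheodory_indexed[OF hull[OF s] card] by blast
      then have "\<forall>i. \<exists>u. u \<in> U \<and> z i = F s u" by auto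
      then obtain v where v: "\<And>i. v i \<in> U" "\<And>i. z i = F s (v i)" by metis
      have "w i \<le> 1" for i
        using member_le_sum[of i UNIV w] wz(1,2) by simp
      then show ?thesis using wz v
        by (intro bexI[of _ "\<chi> i. (w i, v i)"]) (auto simp: K_def d_def)
    qed
  qed blast
  note [measurable] = q(1)
  have qi[measurable]: "(\<lambda>s. q s $ i) \<in> borel_measurable M" for i
    by (rule borel_measurable_continuous_on[OF _ q(1)]) (intro continuous_intros)
  have ql[measurable]: "(\<lambda>s. fst (q s $ i)) \<in> borel_measurable M" for i
    by (rule borel_measurable_continuous_on[OF _ qi]) (intro continuous_intros)
  have qu[measurable]: "(\<lambda>s. snd (q s $ i)) \<in> borel_measurable M" for i
    by (rule borel_measurable_continuous_on[OF _ qi]) (intro continuous_intros)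
  let ?N = "restrict_space borel U"
  define P where "P = (\<lambda>s. point_measure (UNIV :: 'k set) (\<lambda>i. ennreal (fst (q s $ i))))"
  define \<omega> where "\<omega> = (\<lambda>s. distr (P s) ?N (\<lambda>i. snd (q s $ i)))"
  have Pm: "(\<lambda>i. snd (q s $ i)) \<in> P s \<rightarrow>\<^sub>M ?N" if "s \<in> space M" for s
    using q(2)[OF that] unfolding P_def
    by (auto simp: measurable_def K_def space_point_measure sets_point_measure space_restrict_space)
  have em: "emeasure (\<omega> s) A = (\<Sum>i\<in>UNIV. ennreal (fst (q s $ i)) * indicator A (snd (q s $ i)))"
    if s: "s \<in> space M" and A: "A \<in> sets ?N" for s A
  proof -
    have "emeasure (\<omega> s) A = emeasure (P s) ((\<lambda>i. snd (q s $ i)) -` A \<inter> UNIV)"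
      unfolding \<omega>_def using emeasure_distr[OF Pm[OF s] A] by (simp add: P_def space_point_measure)
    also have "\<dots> = (\<Sum>i\<in>(\<lambda>i. snd (q s $ i)) -` A. ennreal (fst (q s $ i)))"
      unfolding P_def by (subst emeasure_point_measure_finite) auto
    also have "\<dots> = (\<Sum>i\<in>UNIV. ennreal (fst (q s $ i)) * indicator A (snd (q s $ i)))"
      by (intro sum.mono_neutral_cong_left) (auto simp: indicator_def)
    finally show ?thesis .
  qed
  have sets\<omega>: "sets (\<omega> s) = sets ?N" for s by (simp add: \<omega>_def)
  have ps: "prob_space (\<omega> s)" if s: "s \<in> space M" for s
  proof
    have "emeasure (\<omega> s) (space (\<omega> s)) = emeasure (\<omega> s) U"
      by (simp add: \<omega>_def space_restrict_space)
    also have "\<dots> = (\<Sum>i\<in>UNIV. ennreal (fst (q s $ i)))"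
      using q(2)[OF s] U
      by (subst em[OF s]) (auto simp: K_def sets_restrict_space_iff borel_compact)
    also have "\<dots> = 1"
      using q(2)[OF s] by (subst sum_ennreal) (auto simp: K_def)
    finally show "emeasure (\<omega> s) (space (\<omega> s)) = 1" .
  qed
  have \<omega>m: "\<omega> \<in> M \<rightarrow>\<^sub>M prob_algebra ?N"
    unfolding prob_algebra_def
  proof (rule measurable_restrict_space2)
    show "\<omega> \<in> space M \<rightarrow> {M. prob_space M}" using ps by auto
    show "\<omega> \<in> M \<rightarrow>\<^sub>M subprob_algebra ?N"
    proof (rule measurable_subprob_algebra)
      show "subprob_space (\<omega> s)" if "s \<in> space M" for s
        using ps[OF that] by (rule prob_space_imp_subprob_space)
      show "sets (\<omega> s) = sets ?N" for s by (rule sets\<omega>)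
      show "(\<lambda>s. emeasure (\<omega> s) A) \<in> borel_measurable M" if A: "A \<in> sets ?N" for A
      proof -
        have [measurable]: "A \<in> sets borel"
          using A U by (auto simp: sets_restrict_space_iff borel_compact)
        show ?thesis
          by (subst measurable_cong[OF em[OF _ A]]) (assumption, measurable)
      qed
    qed
  qed
  show ?thesis
  proof (rule that[OF \<omega>m])
    show "(LINT u|\<omega> s. F s u) = y s" if s: "s \<in> space M" for s
    proof -
      have Fm: "F s \<in> borel_measurable ?N"
        by (rule borel_measurable_continuous_on_restrict[OF cont])
      have "(LINT u|\<omega> s. F s u) = (LINT i|P s. F s (snd (q s $ i)))"
        unfolding \<omega>_def by (rule integral_distr[OF Pm[OF s] Fm])
      also have "\<dots> = (\<Sum>i\<in>UNIV. fst (q s $ i) *\<^sub>R F s (snd (q s $ i)))"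
        unfolding P_def using q(2)[OF s]
        by (subst lebesgue_integral_point_measure_finite) (auto simp: K_def)
      also have "\<dots> = y s" using q(2)[OF s] by (simp add: d_def)
      finally show ?thesis .
    qed
  qed
qed

section \<open>Integrals over intervals\<close>

lemma set_integrable_bounded_Icc:
  fixes g :: "real \<Rightarrow> 'a::euclidean_space"
  assumes "g \<in> borel_measurable borel" "\<And>s. norm (g s) \<le> B"
  shows "set_integrable lborel {a..b} g"
proof -
  have "integrable lborel (\<lambda>s. indicator {a..b} s *\<^sub>R B)"
    using borel_integrable_atLeastAtMost'[of a b "\<lambda>_. B"] by (simp add: set_integrable_def)
  then show ?thesis
    unfolding set_integrable_def
    by (rule Bochner_Integration.integrable_bound)
      (use assms order_trans[OF norm_ge_zero assms(2)] in \<open>auto simp: indicator_def\<close>)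
qed

lemma set_integral_Icc_combine:
  fixes g :: "real \<Rightarrow> 'a::euclidean_space"
  assumes "set_integrable lborel {a..c} g" "a \<le> b" "b \<le> c"
  shows "(LINT s:{a..b}|lborel. g s) + (LINT s:{b..c}|lborel. g s) = (LINT s:{a..c}|lborel. g s)"
proof -
  have "set_integrable lborel {a..b} g" "set_integrable lborel {b..c} g"
    using assms by (auto intro: set_integrable_subset)
  then show ?thesis
    using assms Henstock_Kurzweil_Integration.integral_combine[of a b c g]
    by (simp add: set_borel_integral_eq_integral)
qed

lemma norm_set_integral_Icc_le:
  fixes g :: "real \<Rightarrow> 'a::euclidean_space"
  assumes "g \<in> borel_measurable borel" "\<And>s. norm (g s) \<le> B" "a \<le> b"
  shows "norm (LINT s:{a..b}|lborel. g s) \<le> B * (b - a)"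
proof -
  have i: "set_integrable lborel {a..b} g" by (rule set_integrable_bounded_Icc[OF assms(1,2)])
  have "0 \<le> B" using assms(2) norm_ge_zero order_trans by blast
  then show ?thesis
    using has_integral_bound[of B g "integral {a..b} g" a b] i assms(2,3)
    by (simp add: set_borel_integral_eq_integral box_real integrable_integral)
qed

lemma set_integrable_lebesgue_bounded_Icc:
  fixes H :: "real \<Rightarrow> 'a::euclidean_space"
  assumes H: "H \<in> borel_measurable (lebesgue_on {a..b})" and bd: "\<And>s. s \<in> {a..b} \<Longrightarrow> norm (H s) \<le> B"
    and sub: "{c..d} \<subseteq> {a..b}"
  shows "set_integrable lebesgue {c..d} H"
proof -
  have "set_integrable lebesgue {a..b} H"
    unfolding set_integrable_def
  proof (rule Bochner_Integration.integrable_bound)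
    show "integrable lebesgue (\<lambda>s. \<bar>B\<bar> * indicator {a..b} s)"
      by (intro integrable_mult_right integrable_real_indicator) (auto simp: emeasure_lborel_Icc_eq)
    show "(\<lambda>s. indicator {a..b} s *\<^sub>R H s) \<in> borel_measurable lebesgue"
      using H by (subst (asm) borel_measurable_restrict_space_iff) auto
    show "AE s in lebesgue. norm (indicator {a..b} s *\<^sub>R H s) \<le> norm (\<bar>B\<bar> * indicator {a..b} s)"
      using bd by (intro AE_I2) (auto simp: indicator_def intro: order_trans[OF bd abs_ge_self])
  qed
  then show ?thesis by (rule set_integrable_subset) (use sub in auto)
qed

lemma set_integral_lebesgue_Icc_combine:
  fixes H :: "real \<Rightarrow> 'a::euclidean_space"
  assumes "set_integrable lebesgue {a..c} H" "a \<le> b" "b \<le> c"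
  shows "(LINT s:{a..b}|lebesgue. H s) + (LINT s:{b..c}|lebesgue. H s) = (LINT s:{a..c}|lebesgue. H s)"
proof -
  have "set_integrable lebesgue {a..b} H" "set_integrable lebesgue {b..c} H"
    using assms by (auto intro: set_integrable_subset)
  then show ?thesis
    using assms Henstock_Kurzweil_Integration.integral_combine[of a b c H]
    by (simp add: set_lebesgue_integral_eq_integral)
qed

lemma norm_set_integral_lebesgue_Icc_le:
  fixes H :: "real \<Rightarrow> 'a::euclidean_space"
  assumes "set_integrable lebesgue {a..b} H" "\<And>s. s \<in> {a..b} \<Longrightarrow> norm (H s) \<le> B" "0 \<le> B" "a \<le> b"
  shows "norm (LINT s:{a..b}|lebesgue. H s) \<le> B * (b - a)"
  using has_integral_bound[of B H "integral {a..b} H" a b] assms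
  by (simp add: set_lebesgue_integral_eq_integral box_real integrable_integral)

section \<open>Velocities constrained by support functions\<close>

text \<open>
  The support function, in direction \<open>p\<close>, of the velocities attainable at \<open>z\<close>.
\<close>

definition support_value :: "('x \<Rightarrow> 'b \<Rightarrow> 'a::real_inner) \<Rightarrow> 'b set \<Rightarrow> 'a \<Rightarrow> 'x \<Rightarrow> real" where
  "support_value G U p z = (SUP u\<in>U. p \<bullet> G z u)"

lemma support_value_lipschitz:
  fixes G :: "'x::real_normed_vector \<Rightarrow> 'b \<Rightarrow> 'a::real_inner"
  assumes U: "U \<noteq> {}" and bd: "\<And>z u. u \<in> U \<Longrightarrow> norm (G z u) \<le> B"
    and lip: "\<And>z z' u. u \<in> U \<Longrightarrow> norm (G z u - G z' u) \<le> L * norm (z - z')"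
  shows "u \<in> U \<Longrightarrow> p \<bullet> G z u \<le> support_value G U p z"
    and "support_value G U p z \<le> support_value G U p z' + norm p * (L * norm (z - z'))"
proof -
  have bdd: "bdd_above ((\<lambda>u. p \<bullet> G z u) ` U)" for z
  proof (rule bdd_aboveI2)
    show "p \<bullet> G z u \<le> norm p * B" if "u \<in> U" for u
      using norm_cauchy_schwarz[of p "G z u"] mult_left_mono[OF bd[OF that, of z] norm_ge_zero[of p]] by linarith
  qed
  show 1: "p \<bullet> G z u \<le> support_value G U p z" if "u \<in> U" for u z
    unfolding support_value_def using that bdd by (rule cSUP_upper)
  show "support_value G U p z \<le> support_value G U p z' + norm p * (L * norm (z - z'))"
    unfolding support_value_def[of G U p z]
  proof (rule cSUP_least[OF U])
    fix u assume u: "u \<in> U"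
    have "p \<bullet> G z u = p \<bullet> G z' u + p \<bullet> (G z u - G z' u)" by (simp add: inner_diff_right)
    also have "\<dots> \<le> support_value G U p z' + norm p * norm (G z u - G z' u)"
      by (intro add_mono 1 u norm_cauchy_schwarz)
    also have "\<dots> \<le> support_value G U p z' + norm p * (L * norm (z - z'))"
      by (intro add_left_mono mult_left_mono lip u norm_ge_zero)
    finally show "p \<bullet> G z u \<le> support_value G U p z' + norm p * (L * norm (z - z'))" .
  qed
qed

text \<open>
  A point outside the compact convex hull is strictly separated from it, and the separating direction can be
  perturbed into the dense set.  A countable set of directions thus suffices, which matters since each
  direction costs a null set of times.
\<close>

lemma in_convex_hull_if_support_le:
  fixes S :: "'a::euclidean_space set"
  assumes S: "compact S" "S \<noteq> {}" and D: "closure D = UNIV"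
    and le: "\<And>p. p \<in> D \<Longrightarrow> p \<bullet> y \<le> (SUP c\<in>S. p \<bullet> c)"
  shows "y \<in> convex hull S"
proof (rule ccontr)
  assume "y \<notin> convex hull S"
  then obtain a b where ab: "a \<bullet> y < b" "\<And>c. c \<in> convex hull S \<Longrightarrow> b < a \<bullet> c"
    using separating_hyperplane_closed_point[of "convex hull S" y] compact_convex_hull[OF S(1)]
    by (auto simp: compact_imp_closed)
  obtain B where B: "\<And>c. c \<in> S \<Longrightarrow> norm c \<le> B" using compact_imp_bounded[OF S(1)] unfolding bounded_iff by auto
  have B0: "0 \<le> B" using B S(2) norm_ge_zero order_trans by blast
  \<comment> \<open>Half of the separation gap; a perturbation of \<open>- a\<close> by less than \<open>r\<close> moves each inner product below
    by less than \<open>\<eta>\<close>.\<close>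
  define \<eta> where "\<eta> = (b - a \<bullet> y) / 2"
  have \<eta>: "\<eta> > 0" using ab(1) by (simp add: \<eta>_def)
  define r where "r = \<eta> / (B + norm y + 1)"
  have den: "B + norm y + 1 > 0" using B0 norm_ge_zero[of y] by linarith
  have r: "r > 0" using \<eta> den by (simp add: r_def)
  have "- a \<in> closure D" by (simp add: D)
  then obtain p where p: "p \<in> D" "dist p (- a) < r" using r unfolding closure_approachable by blast
  have close: "\<bar>p \<bullet> c + a \<bullet> c\<bar> < \<eta>" if "norm c \<le> B + norm y" for c
  proof -
    have "\<bar>p \<bullet> c + a \<bullet> c\<bar> \<le> norm (p + a) * norm c"
      using Cauchy_Schwarz_ineq2[of "p + a" c] by (simp add: inner_add_left)
    also have "\<dots> \<le> norm (p + a) * (B + norm y)" using that by (rule mult_left_mono) simp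
    also have "\<dots> \<le> r * (B + norm y)"
      using p(2) B0 by (intro mult_right_mono) (auto simp: dist_norm)
    also have "\<dots> < r * (B + norm y + 1)" using r by simp
    also have "\<dots> = \<eta>" using den by (simp add: r_def)
    finally show ?thesis .
  qed
  have "(SUP c\<in>S. p \<bullet> c) \<le> \<eta> - b"
  proof (rule cSUP_least[OF S(2)])
    fix c assume c: "c \<in> S"
    have "norm c \<le> B + norm y" using B[OF c] norm_ge_zero[of y] by linarith
    from close[OF this] ab(2)[OF hull_inc[OF c]] show "p \<bullet> c \<le> \<eta> - b" by (simp add: abs_less_iff)
  qed
  with le[OF p(1)] have "p \<bullet> y \<le> \<eta> - b" by linarith
  moreover have "norm y \<le> B + norm y" using B0 by simp
  from close[OF this] have "p \<bullet> y > - (a \<bullet> y) - \<eta>" by (simp add: abs_less_iff)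
  ultimately show False unfolding \<eta>_def using ab(1) by (simp add: field_simps)
qed

text \<open>
  The hypothesis is the integrated form of \<open>p \<bullet> y' \<le> support_value G U p x\<close>, which unlike statements
  about velocities survives uniform limits of curves.  Differentiating it in countably many directions
  recovers that the density of \<open>y\<close> lies in the convex hull of the attainable velocities.
\<close>

lemma relaxed_control_of_support_inequality:
  fixes G :: "'x::euclidean_space \<Rightarrow> 'b::euclidean_space \<Rightarrow> 'a::euclidean_space" and k :: "'k::finite itself"
  assumes card: "DIM('a) + 1 \<le> CARD('k)"
    and U: "compact U" "U \<noteq> {}"
    and cont: "\<And>z. continuous_on U (G z)"
    and bd: "\<And>z u. u \<in> U \<Longrightarrow> norm (G z u) \<le> B"
    and lipU: "\<And>z z' u. u \<in> U \<Longrightarrow> norm (G z u - G z' u) \<le> L0 * norm (z - z')"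
    and L0': "0 \<le> L0"
    and x: "continuous_on UNIV x"
    and y: "M-lipschitz_on UNIV (y :: real \<Rightarrow> 'a)"
    and t0T: "t0 \<le> T"
    and ineq: "\<And>p a b. t0 \<le> a \<Longrightarrow> a \<le> b \<Longrightarrow> b \<le> T \<Longrightarrow>
        p \<bullet> (y b - y a) \<le> (LINT s:{a..b}|lborel. support_value G U p (x s))"
  obtains \<omega> where "\<omega> \<in> borel \<rightarrow>\<^sub>M prob_algebra (restrict_space borel U)"
    "(\<lambda>s. LINT u|\<omega> s. G (x s) u) \<in> borel_measurable borel"
    "\<And>a b. t0 \<le> a \<Longrightarrow> a \<le> b \<Longrightarrow> b \<le> T \<Longrightarrow>
       set_integrable lborel {a..b} (\<lambda>s. LINT u|\<omega> s. G (x s) u) \<and>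
       (LINT s:{a..b}|lborel. LINT u|\<omega> s. G (x s) u) = y b - y a"
proof -
  obtain g where g[measurable]: "g \<in> borel_measurable borel"
    and gi: "\<And>a b. a \<le> b \<Longrightarrow> set_integrable lborel {a..b} g"
    and gy: "\<And>a b. a \<le> b \<Longrightarrow> (LINT s:{a..b}|lborel. g s) = y b - y a"
    using lipschitz_has_density[OF y] by blast
  have sup: "support_value G U p z \<le> support_value G U p z' + norm p * (L0 * norm (z - z'))" for p z z'
    by (rule support_value_lipschitz(2)[OF U(2), of G B L0]) (use bd lipU in auto)
  have L0: "0 \<le> norm p * L0" for p :: 'a using L0' by simp
  have sup_cont: "continuous_on UNIV (support_value G U p)" for p
  proof (rule lipschitz_on_continuous_on)
    show "(norm p * L0)-lipschitz_on UNIV (support_value G U p)"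
    proof (rule lipschitz_onI[OF _ L0])
      show "dist (support_value G U p z) (support_value G U p z') \<le> norm p * L0 * dist z z'" for z z'
        using sup[of p z z'] sup[of p z' z] by (auto simp: dist_norm abs_le_iff norm_minus_commute mult.assoc)
    qed
  qed
  have supx: "continuous_on UNIV (\<lambda>s. support_value G U p (x s))" for p
    using continuous_on_compose2[OF sup_cont x] by auto
  then have [measurable]: "(\<lambda>s. support_value G U p (x s)) \<in> borel_measurable borel" for p
    by (rule borel_measurable_continuous_onI)
  obtain D :: "'a set" where "countable D" "D \<subseteq> UNIV" "UNIV \<subseteq> closure D"
    using separable by blast
  then have D: "countable D" "closure D = UNIV" by auto
  have AEp: "AE s in lborel. s \<in> {t0..T} \<longrightarrow> 0 \<le> support_value G U p (x s) - p \<bullet> g s" for p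
  proof (rule AE_nonneg_if_interval_integrals_nonneg[OF t0T])
    have i1: "set_integrable lborel {a..b} (\<lambda>s. support_value G U p (x s))" for a b
      using supx[of p] by (intro borel_integrable_atLeastAtMost') (auto intro: continuous_on_subset)
    have i2: "set_integrable lborel {a..b} (\<lambda>s. p \<bullet> g s)"
      and e2: "(LINT s:{a..b}|lborel. p \<bullet> g s) = p \<bullet> (y b - y a)" if "a \<le> b" for a b
    proof -
      have eq: "indicator {a..b} s *\<^sub>R (p \<bullet> g s) = p \<bullet> (indicator {a..b} s *\<^sub>R g s)" for s by simp
      show "set_integrable lborel {a..b} (\<lambda>s. p \<bullet> g s)"
        using gi[OF that] unfolding set_integrable_def eq by (rule integrable_inner_right)
      show "(LINT s:{a..b}|lborel. p \<bullet> g s) = p \<bullet> (y b - y a)"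
        using gi[OF that] gy[OF that] unfolding set_lebesgue_integral_def set_integrable_def eq
        by (subst integral_inner_right) auto
    qed
    show "set_integrable lborel {t0..T} (\<lambda>s. support_value G U p (x s) - p \<bullet> g s)"
      by (intro set_integral_diff(1) i1 i2 t0T)
    show "0 \<le> (LINT s:{a..b}|lborel. support_value G U p (x s) - p \<bullet> g s)"
      if "t0 \<le> a" "a \<le> b" "b \<le> T" for a b
      using ineq[OF that, of p] by (simp add: set_integral_diff(2)[OF i1 i2[OF that(2)]] e2 that)
  qed
  define Gd where "Gd = {s. \<forall>p\<in>D. 0 \<le> support_value G U p (x s) - p \<bullet> g s}"
  have [measurable]: "Gd \<in> sets borel" unfolding Gd_def using D(1) by measurable
  have AEGd: "AE s in lborel. s \<in> {t0..T} \<longrightarrow> s \<in> Gd"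
  proof -
    have "AE s in lborel. \<forall>p\<in>D. s \<in> {t0..T} \<longrightarrow> 0 \<le> support_value G U p (x s) - p \<bullet> g s"
      using AEp D(1) by (subst AE_ball_countable) auto
    then show ?thesis by eventually_elim (auto simp: Gd_def)
  qed
  from U(2) obtain u0 where u0: "u0 \<in> U" by auto
  have Gx: "(\<lambda>s. G (x s) u) \<in> borel_measurable borel" if "u \<in> U" for u
  proof -
    have "continuous_on UNIV (\<lambda>z. G z u)"
    proof (rule lipschitz_on_continuous_on)
      show "L0-lipschitz_on UNIV (\<lambda>z. G z u)"
        using lipU[OF that] L0' by (auto intro!: lipschitz_onI simp: dist_norm)
    qed
    from continuous_on_compose2[OF this x] show ?thesis by (intro borel_measurable_continuous_onI) auto
  qed
  \<comment> \<open>Outside the good set an arbitrary attainable velocity makes the hull condition hold at all times.\<close>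
  define g' where "g' = (\<lambda>s. if s \<in> Gd then g s else G (x s) u0)"
  have g'm[measurable]: "g' \<in> borel_measurable borel" unfolding g'_def using Gx[OF u0] by measurable
  obtain \<omega> where \<omega>: "\<omega> \<in> borel \<rightarrow>\<^sub>M prob_algebra (restrict_space borel U)"
    "\<And>s. (LINT u|\<omega> s. G (x s) u) = g' s"
  proof (rule measurable_relaxed_control_selection[OF card U(1), of "\<lambda>s. G (x s)" borel g'])
    show "(\<lambda>s. G (x s) u) \<in> borel_measurable borel" if "u \<in> U" for u by (rule Gx[OF that])
    show "continuous_on U (G (x s))" for s by (rule cont)
    show "g' \<in> borel_measurable borel" by (rule g'm)
    show "g' s \<in> convex hull (G (x s) ` U)" for s
    proof (cases "s \<in> Gd")
      case True
      have "g s \<in> convex hull (G (x s) ` U)"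
      proof (rule in_convex_hull_if_support_le[OF _ _ D(2)])
        show "compact (G (x s) ` U)"
          by (rule compact_continuous_image[OF cont U(1)])
        show "p \<bullet> g s \<le> (SUP c\<in>G (x s) ` U. p \<bullet> c)" if "p \<in> D" for p
          using True that by (auto simp: Gd_def support_value_def image_image)
      qed (use U in auto)
      then show ?thesis using True by (simp add: g'_def)
    qed (use u0 in \<open>auto simp: g'_def intro: hull_inc\<close>)
  qed auto
  show ?thesis
  proof (rule that[OF \<omega>(1)])
    show "(\<lambda>s. LINT u|\<omega> s. G (x s) u) \<in> borel_measurable borel" by (simp add: \<omega>(2))
    show "set_integrable lborel {a..b} (\<lambda>s. LINT u|\<omega> s. G (x s) u) \<and>
       (LINT s:{a..b}|lborel. LINT u|\<omega> s. G (x s) u) = y b - y a"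
      if "t0 \<le> a" "a \<le> b" "b \<le> T" for a b
    proof -
      have AEg: "AE s\<in>{a..b} in lborel. g' s = g s"
        using AEGd by eventually_elim (use that in \<open>auto simp: g'_def\<close>)
      have "(LINT s:{a..b}|lborel. g' s) = (LINT s:{a..b}|lborel. g s)"
        by (rule set_lebesgue_integral_cong_AE) (use AEg in auto)
      moreover have "set_integrable lborel {a..b} g' = set_integrable lborel {a..b} g"
        by (rule set_integrable_cong_AE) (use AEg in auto)
      ultimately show ?thesis using gy[OF that(2)] gi[OF that(2)] by (simp add: \<omega>(2))
    qed
  qed
qed

section \<open>Limits of Euler polygons\<close>

primrec euler :: "('x \<Rightarrow> 'b \<Rightarrow> 'x::real_vector) \<Rightarrow> real \<Rightarrow> 'x \<Rightarrow> (nat \<Rightarrow> 'b) \<Rightarrow> nat \<Rightarrow> 'x" where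
  euler_0: "euler F \<tau> x u 0 = x"
| euler_Suc: "euler F \<tau> x u (Suc n) = euler F \<tau> x u n + \<tau> *\<^sub>R F (euler F \<tau> x u n) (u n)"

text \<open>
  The index of the interval of a grid with origin \<open>t0\<close> and step \<open>\<tau>\<close> that contains \<open>s\<close>.
\<close>

definition cell :: "real \<Rightarrow> real \<Rightarrow> real \<Rightarrow> nat" where
  "cell t0 \<tau> s = nat \<lfloor>(s - t0) / \<tau>\<rfloor>"

lemma cell_eqI:
  assumes "\<tau> > 0" "t0 + real n * \<tau> \<le> s" "s < t0 + real (Suc n) * \<tau>"
  shows "cell t0 \<tau> s = n"
proof -
  have "\<lfloor>(s - t0) / \<tau>\<rfloor> = int n"
    using assms by (intro floor_unique) (auto simp: field_simps)
  then show ?thesis by (simp add: cell_def)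
qed

lemma cell_bounds:
  assumes "\<tau> > 0" "t0 \<le> s"
  shows "t0 + real (cell t0 \<tau> s) * \<tau> \<le> s" "s \<le> t0 + real (cell t0 \<tau> s) * \<tau> + \<tau>"
proof -
  have n: "real (cell t0 \<tau> s) = of_int \<lfloor>(s - t0) / \<tau>\<rfloor>"
    using assms by (simp add: cell_def)
  show "t0 + real (cell t0 \<tau> s) * \<tau> \<le> s"
    using mult_right_mono[OF of_int_floor_le[of "(s - t0) / \<tau>"], of \<tau>] assms(1) unfolding n by simp
  have "(s - t0) / \<tau> \<le> of_int \<lfloor>(s - t0) / \<tau>\<rfloor> + 1" by linarith
  then show "s \<le> t0 + real (cell t0 \<tau> s) * \<tau> + \<tau>"
    using assms(1) unfolding n by (simp add: pos_divide_le_eq algebra_simps)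
qed

lemma measurable_cell: "(\<lambda>s. a (cell t0 \<tau> s)) \<in> borel_measurable borel" for a :: "nat \<Rightarrow> 'a::topological_space"
proof -
  have "cell t0 \<tau> \<in> borel \<rightarrow>\<^sub>M count_space UNIV" unfolding cell_def by measurable
  then show ?thesis by (rule measurable_compose) simp
qed

lemma integral_step_function:
  fixes a :: "nat \<Rightarrow> 'a::euclidean_space"
  assumes \<tau>: "\<tau> > 0" and bd: "\<And>i. norm (a i) \<le> B"
  shows "(LINT s:{t0..t0 + real n * \<tau>}|lborel. a (cell t0 \<tau> s)) = \<tau> *\<^sub>R (\<Sum>i<n. a i)"
proof (induction n)
  case 0
  show ?case using norm_set_integral_Icc_le[of "\<lambda>s. a (cell t0 \<tau> s)" B t0 t0, OF measurable_cell bd] by simp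
next
  case (Suc n)
  let ?b = "t0 + real n * \<tau>" and ?c = "t0 + real (Suc n) * \<tau>"
  let ?g = "\<lambda>s. a (cell t0 \<tau> s)"
  have bc: "?b \<le> ?c" "t0 \<le> ?b" using \<tau> by (auto simp: algebra_simps)
  have "(LINT s:{?b..?c}|lborel. ?g s) = (LINT s:{?b..?c}|lborel. a n)"
  proof (rule set_lebesgue_integral_cong_AE)
    show "AE s\<in>{?b..?c} in lborel. ?g s = a n"
      using AE_lborel_singleton[of ?c] by eventually_elim (auto intro!: arg_cong[of _ _ a] cell_eqI \<tau>)
  qed (auto intro: measurable_cell)
  also have "\<dots> = \<tau> *\<^sub>R a n" using bc \<tau> by (simp add: set_integral_const algebra_simps)
  finally have 1: "(LINT s:{?b..?c}|lborel. ?g s) = \<tau> *\<^sub>R a n" .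
  show ?case
    using set_integral_Icc_combine[of t0 ?c ?g ?b, OF set_integrable_bounded_Icc[OF measurable_cell bd]] bc 1 Suc
    by (simp add: scaleR_add_right)
qed

lemma euler_eq_sum: "euler F \<tau> x u n = x + \<tau> *\<^sub>R (\<Sum>i<n. F (euler F \<tau> x u i) (u i))"
  by (induction n) (auto simp: scaleR_add_right)

text \<open>
  Compactness of relaxed trajectories.  State and accumulated cost are treated as one curve, so that
  the same relaxed control produces the limits of both.  The interpolated curves are equi-Lipschitz;
  their velocities are attainable at grid points that are close to the limit curve, so the integrated support
  inequality passes to the limit.
\<close>

lemma euler_relaxed_limit:
  fixes F :: "'x::euclidean_space \<Rightarrow> 'b::euclidean_space \<Rightarrow> 'x" and c :: "'x \<Rightarrow> 'b \<Rightarrow> real"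
    and k :: "'k::finite itself"
  assumes card: "DIM('x) + 2 \<le> CARD('k)"
    and U: "compact U" "U \<noteq> {}"
    and contF: "\<And>z. continuous_on U (F z)" and contc: "\<And>z. continuous_on U (c z)"
    and bdF: "\<And>z u. u \<in> U \<Longrightarrow> norm (F z u) \<le> B" and bdc: "\<And>z u. u \<in> U \<Longrightarrow> \<bar>c z u\<bar> \<le> B"
    and lipF: "\<And>z z' u. u \<in> U \<Longrightarrow> norm (F z u - F z' u) \<le> L * norm (z - z')"
    and lipc: "\<And>z z' u. u \<in> U \<Longrightarrow> \<bar>c z u - c z' u\<bar> \<le> L * norm (z - z')"
    and L: "0 \<le> L"
    and t0T: "t0 \<le> T"
    and \<tau>: "\<And>n. 0 < \<tau> n" "\<tau> \<longlonglongrightarrow> 0"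
    and v: "\<And>n i. v n i \<in> U"
    and N: "(\<lambda>n. real (N n) * \<tau> n) \<longlonglongrightarrow> T - t0"
  obtains r :: "nat \<Rightarrow> nat" and x :: "real \<Rightarrow> 'x" and \<omega>
  where "strict_mono r" "continuous_on UNIV x"
    "\<omega> \<in> borel \<rightarrow>\<^sub>M prob_algebra (restrict_space borel U)"
    "\<And>t. t \<in> {t0..T} \<Longrightarrow> x t = x0 + (LINT s:{t0..t}|lborel. LINT u|\<omega> s. F (x s) u)"
    "(\<lambda>n. \<tau> (r n) * (\<Sum>i<N (r n). c (euler F (\<tau> (r n)) x0 (v (r n)) i) (v (r n) i)))
       \<longlonglongrightarrow> (LINT s:{t0..T}|lborel. LINT u|\<omega> s. c (x s) u)"
    "\<And>t. t \<in> {t0..T} \<Longrightarrow> (\<lambda>n. euler F (\<tau> (r n)) x0 (v (r n)) (cell t0 (\<tau> (r n)) t)) \<longlonglongrightarrow> x t"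
    "(\<lambda>n. euler F (\<tau> (r n)) x0 (v (r n)) (N (r n))) \<longlonglongrightarrow> x T"
proof -
  define G where "G = (\<lambda>z u. (F z u, c z u))"
  define X where "X = (\<lambda>n. euler F (\<tau> n) x0 (v n))"
  define g where "g = (\<lambda>n i. G (X n i) (v n i))"
  define M where "M = B + B"
  have G_bd: "norm (G z u) \<le> M" if "u \<in> U" for z u
    using norm_Pair_le[of "F z u" "c z u"] bdF[OF that, of z] bdc[OF that, of z] by (simp add: G_def M_def)
  have G_lip: "norm (G z u - G z' u) \<le> (L + L) * norm (z - z')" if "u \<in> U" for z z' u
    using norm_Pair_le[of "F z u - F z' u" "c z u - c z' u"] lipF[OF that, of z z'] lipc[OF that, of z z']
    by (simp add: G_def algebra_simps)
  have g_bd: "norm (g n i) \<le> M" for n i using G_bd v by (simp add: g_def)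
  then have M: "0 \<le> M" using norm_ge_zero order_trans by blast
  let ?gc = "\<lambda>n s. g n (cell t0 (\<tau> n) s)"
  have gm: "?gc n \<in> borel_measurable borel" for n by (rule measurable_cell)
  have gi: "set_integrable lborel {a..b} (?gc n)" for a b n
    by (rule set_integrable_bounded_Icc[OF gm g_bd])
  define Y where "Y = (\<lambda>n t. (x0, 0) + (LINT s:{t0..t}|lborel. ?gc n s))"
  have Y_diff: "Y n b - Y n a = (LINT s:{a..b}|lborel. ?gc n s)" if "t0 \<le> a" "a \<le> b" for n a b
    using set_integral_Icc_combine[OF gi that, of n] by (simp add: Y_def algebra_simps)
  have Y_lip': "norm (Y n b - Y n a) \<le> M * (b - a)" if "t0 \<le> a" "a \<le> b" for n a b
    unfolding Y_diff[OF that] by (rule norm_set_integral_Icc_le[OF gm g_bd that(2)])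
  have Y_lip: "norm (Y n b - Y n a) \<le> M * \<bar>b - a\<bar>" if "t0 \<le> a" "t0 \<le> b" for n a b
    using Y_lip'[of a b n] Y_lip'[of b a n] that by (cases "a \<le> b") (auto simp: norm_minus_commute)
  have node: "Y n (t0 + real i * \<tau> n) = (X n i, \<tau> n * (\<Sum>j<i. c (X n j) (v n j)))" for n i
    unfolding Y_def integral_step_function[of "\<tau> n" "g n" M t0 i, OF \<tau>(1) g_bd]
    by (auto simp: prod_eq_iff fst_sum snd_sum g_def G_def X_def euler_eq_sum[of F _ _ _ i])
  obtain y :: "real \<Rightarrow> 'x \<times> real" and r where r: "strict_mono (r :: nat \<Rightarrow> nat)"
    and ycont: "continuous_on {t0..T} y"
    and unif: "\<And>e. 0 < e \<Longrightarrow> \<exists>K. \<forall>n t. n \<ge> K \<and> t \<in> {t0..T} \<longrightarrow> norm (Y (r n) t - y t) < e"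
  proof (rule Arzela_Ascoli[of "{t0..T}" Y "norm x0 + M * (T - t0)"])
    show "norm (Y n t) \<le> norm x0 + M * (T - t0)" if "t \<in> {t0..T}" for n t
    proof -
      have "norm (Y n t) \<le> norm x0 + norm (Y n t - Y n t0)"
        using norm_triangle_ineq[of "Y n t0" "Y n t - Y n t0"] node[of n 0] by (simp add: X_def)
      also have "norm (Y n t - Y n t0) \<le> M * (t - t0)" using that by (intro Y_lip') auto
      also have "\<dots> \<le> M * (T - t0)" using M that by (intro mult_left_mono) auto
      finally show ?thesis by simp
    qed
    show "\<exists>d. 0 < d \<and> (\<forall>n t'. t' \<in> {t0..T} \<and> norm (t - t') < d \<longrightarrow> norm (Y n t - Y n t') < e)"
      if "t \<in> {t0..T}" "0 < e" for t e
    proof (intro exI[of _ "e / (M + 1)"] conjI allI impI)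
      show "0 < e / (M + 1)" using that M by simp
      fix n t' assume t': "t' \<in> {t0..T} \<and> norm (t - t') < e / (M + 1)"
      have "norm (Y n t - Y n t') \<le> M * \<bar>t - t'\<bar>" using that t' by (intro Y_lip) auto
      also have "\<dots> \<le> (M + 1) * \<bar>t - t'\<bar>" by (simp add: mult_right_mono)
      also have "\<dots> < e" using t' M by (simp add: field_simps)
      finally show "norm (Y n t - Y n t') < e" .
    qed
  qed auto
  have Ylim: "(\<lambda>n. Y (r n) t) \<longlonglongrightarrow> y t" if "t \<in> {t0..T}" for t
    unfolding LIMSEQ_iff using unif that by blast
  have \<tau>r: "(\<lambda>n. \<tau> (r n)) \<longlonglongrightarrow> 0" using LIMSEQ_subseq_LIMSEQ[OF \<tau>(2) r] by (simp add: o_def)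
  have y_lip: "norm (y b - y a) \<le> M * \<bar>b - a\<bar>" if "a \<in> {t0..T}" "b \<in> {t0..T}" for a b
    by (rule tendsto_upperbound[OF tendsto_norm[OF tendsto_diff[OF Ylim[OF that(2)] Ylim[OF that(1)]]]])
      (use Y_lip that in auto)
  define cl where "cl = (\<lambda>t. max t0 (min T t))"
  have cl: "cl t \<in> {t0..T}" for t using t0T by (auto simp: cl_def)
  have cl_id: "cl t = t" if "t \<in> {t0..T}" for t using that by (auto simp: cl_def)
  define y' where "y' = (\<lambda>t. y (cl t))"
  have y'_lip: "M-lipschitz_on UNIV y'"
  proof (rule lipschitz_onI[OF _ M])
    fix s t
    have "norm (y' s - y' t) \<le> M * \<bar>cl s - cl t\<bar>" unfolding y'_def by (rule y_lip[OF cl cl])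
    also have "\<dots> \<le> M * \<bar>s - t\<bar>" using M by (intro mult_left_mono) (auto simp: cl_def)
    finally show "dist (y' s) (y' t) \<le> M * dist s t" by (simp add: dist_norm)
  qed
  define x where "x = (\<lambda>t. fst (y' t))"
  have x_cont: "continuous_on UNIV x" unfolding x_def
    using lipschitz_on_continuous_on[OF y'_lip] by (intro continuous_intros)
  have close: "norm (X n (cell t0 (\<tau> n) s) - fst (Y n s)) \<le> M * \<tau> n" if "s \<in> {t0..T}" for n s
  proof -
    let ?i = "cell t0 (\<tau> n) s"
    note cb = cell_bounds[OF \<tau>(1), of t0 s n]
    have "norm (X n ?i - fst (Y n s)) = norm (fst (Y n (t0 + real ?i * \<tau> n) - Y n s))"
      by (simp add: node)
    also have "\<dots> \<le> norm (Y n (t0 + real ?i * \<tau> n) - Y n s)" by (metis norm_fst_le prod.collapse)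
    also have "\<dots> \<le> M * \<bar>(t0 + real ?i * \<tau> n) - s\<bar>" using that \<tau>(1)[of n] by (intro Y_lip) auto
    also have "\<dots> \<le> M * \<tau> n" using cb that M by (intro mult_left_mono) auto
    finally show ?thesis .
  qed
  \<comment> \<open>For large \<open>n\<close> the polygon is within \<open>e\<close> of its limit and each grid point is within \<open>e\<close> of the polygon;
    hence the factor 2 in \<open>C\<close>.\<close>
  have support: "p \<bullet> (y' b - y' a) \<le> (LINT s:{a..b}|lborel. support_value G U p (x s))"
    if ab: "t0 \<le> a" "a \<le> b" "b \<le> T" for p a b
  proof -
    define I where "I = (LINT s:{a..b}|lborel. support_value G U p (x s))"
    define C where "C = norm p * ((L + L) * 2) * (b - a)"
    have C: "0 \<le> C" using L ab by (simp add: C_def)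
    have sup1: "q \<bullet> G z u \<le> support_value G U q z" if "u \<in> U" for q z u
      by (rule support_value_lipschitz(1)[OF U(2), of G M "L + L"]) (use G_bd G_lip that in auto)
    have sup2: "support_value G U q z \<le> support_value G U q z' + norm q * ((L + L) * norm (z - z'))" for q z z'
      by (rule support_value_lipschitz(2)[OF U(2), of G M "L + L"]) (use G_bd G_lip in auto)
    have sup_cont: "continuous_on UNIV (support_value G U p)"
    proof (rule lipschitz_on_continuous_on)
      show "(norm p * (L + L))-lipschitz_on UNIV (support_value G U p)"
      proof (rule lipschitz_onI)
        show "dist (support_value G U p z) (support_value G U p z') \<le> norm p * (L + L) * dist z z'" for z z'
          using sup2[of p z z'] sup2[of p z' z] by (auto simp: dist_norm abs_le_iff norm_minus_commute mult.assoc)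
      qed (use L in auto)
    qed
    have sup_int: "set_integrable lborel {a..b} (\<lambda>s. support_value G U p (x s))"
      by (intro borel_integrable_atLeastAtMost' continuous_on_compose2[OF sup_cont])
        (auto intro: continuous_on_subset[OF x_cont])
    have main: "p \<bullet> (y' b - y' a) \<le> I + C * e" if e: "0 < e" for e
    proof (rule tendsto_upperbound)
      show "(\<lambda>n. p \<bullet> (Y (r n) b - Y (r n) a)) \<longlonglongrightarrow> p \<bullet> (y' b - y' a)"
        unfolding y'_def using ab by (intro tendsto_intros) (auto simp: cl_id intro!: Ylim)
      obtain K where K: "\<And>n t. n \<ge> K \<Longrightarrow> t \<in> {t0..T} \<Longrightarrow> norm (Y (r n) t - y t) < e"
        using unif[OF e] by blast
      have "eventually (\<lambda>n. M * \<tau> (r n) < e) sequentially"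
        using tendsto_mult_right_zero[OF \<tau>r, of M] e by (auto dest: order_tendstoD(2))
      then show "\<forall>\<^sub>F n in sequentially. p \<bullet> (Y (r n) b - Y (r n) a) \<le> I + C * e"
        using eventually_ge_at_top[of K]
      proof eventually_elim
        case (elim n)
        let ?m = "r n"
        have pg: "set_integrable lborel {a..b} (\<lambda>s. p \<bullet> ?gc ?m s)"
          and pe: "(LINT s:{a..b}|lborel. p \<bullet> ?gc ?m s) = p \<bullet> (Y ?m b - Y ?m a)"
        proof -
          have eq: "indicator {a..b} s *\<^sub>R (p \<bullet> ?gc ?m s) = p \<bullet> (indicator {a..b} s *\<^sub>R ?gc ?m s)" for s by simp
          show "set_integrable lborel {a..b} (\<lambda>s. p \<bullet> ?gc ?m s)"
            using gi[of a b ?m] unfolding set_integrable_def eq by (rule integrable_inner_right)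
          show "(LINT s:{a..b}|lborel. p \<bullet> ?gc ?m s) = p \<bullet> (Y ?m b - Y ?m a)"
            using gi[of a b ?m] unfolding Y_diff[OF ab(1,2)] set_lebesgue_integral_def set_integrable_def eq
            by (subst integral_inner_right) auto
        qed
        have const: "set_integrable lborel {a..b} (\<lambda>s. norm p * ((L + L) * (2 * e)))"
          by (intro borel_integrable_atLeastAtMost') auto
        have "(LINT s:{a..b}|lborel. p \<bullet> ?gc ?m s) \<le>
          (LINT s:{a..b}|lborel. support_value G U p (x s) + norm p * ((L + L) * (2 * e)))"
        proof (rule set_integral_mono[OF pg set_integral_add(1)[OF sup_int const]])
          fix s assume "s \<in> {a..b}"
          then have s: "s \<in> {t0..T}" using ab by auto
          let ?i = "cell t0 (\<tau> ?m) s"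
          have "norm (X ?m ?i - x s) \<le> norm (X ?m ?i - fst (Y ?m s)) + norm (fst (Y ?m s) - x s)"
            using norm_triangle_ineq[of "X ?m ?i - fst (Y ?m s)" "fst (Y ?m s) - x s"] by simp
          also have "norm (fst (Y ?m s) - x s) \<le> norm (Y ?m s - y s)"
            unfolding x_def y'_def cl_id[OF s] fst_diff[symmetric] by (metis norm_fst_le prod.collapse)
          also have "norm (X ?m ?i - fst (Y ?m s)) + norm (Y ?m s - y s) \<le> 2 * e"
            using close[OF s, of ?m] K[OF elim(2) s] elim(1) by linarith
          finally have *: "norm (X ?m ?i - x s) \<le> 2 * e" by simp
          have "p \<bullet> ?gc ?m s \<le> support_value G U p (X ?m ?i)"
            unfolding g_def by (rule sup1[OF v])
          also have "\<dots> \<le> support_value G U p (x s) + norm p * ((L + L) * norm (X ?m ?i - x s))"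
            by (rule sup2)
          also have "\<dots> \<le> support_value G U p (x s) + norm p * ((L + L) * (2 * e))"
            using * L by (intro add_left_mono mult_left_mono) auto
          finally show "p \<bullet> ?gc ?m s \<le> support_value G U p (x s) + norm p * ((L + L) * (2 * e))" .
        qed
        also have "\<dots> = I + C * e"
          using ab by (subst set_integral_add(2)[OF sup_int const])
            (simp add: I_def C_def set_integral_const algebra_simps)
        finally show ?case unfolding pe .
      qed
    qed simp
    have "p \<bullet> (y' b - y' a) \<le> I"
    proof (rule field_le_epsilon)
      fix e :: real assume "0 < e"
      then have "p \<bullet> (y' b - y' a) \<le> I + C * (e / (C + 1))" using C by (intro main) auto
      also have "C * (e / (C + 1)) \<le> e" using C \<open>0 < e\<close> by (simp add: field_simps)
      finally show "p \<bullet> (y' b - y' a) \<le> I + e" by simp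
    qed
    then show ?thesis by (simp add: I_def)
  qed
  have "DIM('x \<times> real) + 1 \<le> CARD('k)" using card by simp
  moreover have "continuous_on U (G z)" for z unfolding G_def by (intro continuous_on_Pair contF contc)
  ultimately obtain \<omega> where \<omega>: "\<omega> \<in> borel \<rightarrow>\<^sub>M prob_algebra (restrict_space borel U)"
    and \<omega>i: "\<And>a b. t0 \<le> a \<Longrightarrow> a \<le> b \<Longrightarrow> b \<le> T \<Longrightarrow>
       set_integrable lborel {a..b} (\<lambda>s. LINT u|\<omega> s. G (x s) u) \<and>
       (LINT s:{a..b}|lborel. LINT u|\<omega> s. G (x s) u) = y' b - y' a"
    using relaxed_control_of_support_inequality[where G=G and U=U and x=x and y=y' and B=M and ?L0.0="L+L" and M=M and ?t0.0=t0 and T=T and 'k='k]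
      U G_bd G_lip L x_cont y'_lip t0T support by (smt (verit, ccfv_SIG) add_nonneg_nonneg)
  have inner: "(LINT u|\<omega> s. G (x s) u) = (LINT u|\<omega> s. F (x s) u, LINT u|\<omega> s. c (x s) u)" for s
  proof -
    have ws: "\<omega> s \<in> space (prob_algebra (restrict_space borel U))" using measurable_space[OF \<omega>, of s] by simp
    have "continuous_on U (G (x s))" unfolding G_def by (intro continuous_on_Pair contF contc)
    then have Gint: "integrable (\<omega> s) (G (x s))" by (rule integrable_continuous_prob_compact[OF ws U(1)])
    show ?thesis
      using integral_bounded_linear[OF bounded_linear_fst Gint] integral_bounded_linear[OF bounded_linear_snd Gint]
      by (auto simp: prod_eq_iff G_def)
  qed
  have parts: "(LINT s:{a..b}|lborel. LINT u|\<omega> s. F (x s) u) = fst (y' b - y' a)"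
    "(LINT s:{a..b}|lborel. LINT u|\<omega> s. c (x s) u) = snd (y' b - y' a)"
    if ab: "t0 \<le> a" "a \<le> b" "b \<le> T" for a b
  proof -
    have i: "integrable lborel (\<lambda>s. indicator {a..b} s *\<^sub>R (LINT u|\<omega> s. F (x s) u, LINT u|\<omega> s. c (x s) u))"
      and e: "integral\<^sup>L lborel (\<lambda>s. indicator {a..b} s *\<^sub>R (LINT u|\<omega> s. F (x s) u, LINT u|\<omega> s. c (x s) u)) = y' b - y' a"
      using \<omega>i[OF ab] unfolding inner set_integrable_def set_lebesgue_integral_def by auto
    show "(LINT s:{a..b}|lborel. LINT u|\<omega> s. F (x s) u) = fst (y' b - y' a)"
      using integral_bounded_linear[OF bounded_linear_fst i] unfolding e by (simp add: set_lebesgue_integral_def)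
    show "(LINT s:{a..b}|lborel. LINT u|\<omega> s. c (x s) u) = snd (y' b - y' a)"
      using integral_bounded_linear[OF bounded_linear_snd i] unfolding e by (simp add: set_lebesgue_integral_def)
  qed
  have y'0: "y' t0 = (x0, 0)"
  proof -
    have t0: "t0 \<in> {t0..T}" using t0T by simp
    have "Y n t0 = (x0, 0)" for n using node[of n 0] by (simp add: X_def)
    then show ?thesis using Ylim[OF t0] by (simp add: y'_def cl_id[OF t0] LIMSEQ_const_iff)
  qed
  have endpoint: "(\<lambda>n. Y (r n) (t0 + real (N (r n)) * \<tau> (r n))) \<longlonglongrightarrow> y' T"
  proof -
    have TT: "T \<in> {t0..T}" using t0T by simp
    have Nr: "(\<lambda>n. real (N (r n)) * \<tau> (r n)) \<longlonglongrightarrow> T - t0"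
      using LIMSEQ_subseq_LIMSEQ[OF N r] by (simp add: o_def)
    have "(\<lambda>n. Y (r n) (t0 + real (N (r n)) * \<tau> (r n)) - Y (r n) T) \<longlonglongrightarrow> 0"
    proof (rule Lim_null_comparison)
      show "\<forall>\<^sub>F n in sequentially. norm (Y (r n) (t0 + real (N (r n)) * \<tau> (r n)) - Y (r n) T)
          \<le> M * \<bar>t0 + real (N (r n)) * \<tau> (r n) - T\<bar>"
        using t0T \<tau>(1) by (intro always_eventually allI Y_lip) (auto simp: less_imp_le)
      have "(\<lambda>n. M * \<bar>t0 + real (N (r n)) * \<tau> (r n) - T\<bar>) \<longlonglongrightarrow> M * \<bar>t0 + (T - t0) - T\<bar>"
        by (intro tendsto_intros Nr)
      then show "(\<lambda>n. M * \<bar>t0 + real (N (r n)) * \<tau> (r n) - T\<bar>) \<longlonglongrightarrow> 0" by simp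
    qed
    from tendsto_add[OF this Ylim[OF TT]] show ?thesis by (simp add: y'_def cl_id[OF TT])
  qed
  show ?thesis
  proof (rule that[OF r x_cont \<omega>])
    show "x t = x0 + (LINT s:{t0..t}|lborel. LINT u|\<omega> s. F (x s) u)" if "t \<in> {t0..T}" for t
      using that by (subst parts) (auto simp: x_def y'0)
    show "(\<lambda>n. \<tau> (r n) * (\<Sum>i<N (r n). c (euler F (\<tau> (r n)) x0 (v (r n)) i) (v (r n) i)))
       \<longlonglongrightarrow> (LINT s:{t0..T}|lborel. LINT u|\<omega> s. c (x s) u)"
      using tendsto_snd[OF endpoint] t0T by (subst parts) (auto simp: node y'0 X_def)
    show "(\<lambda>n. euler F (\<tau> (r n)) x0 (v (r n)) (N (r n))) \<longlonglongrightarrow> x T"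
      using tendsto_fst[OF endpoint] by (simp add: node x_def X_def)
    show "(\<lambda>n. euler F (\<tau> (r n)) x0 (v (r n)) (cell t0 (\<tau> (r n)) t)) \<longlonglongrightarrow> x t" if t: "t \<in> {t0..T}" for t
    proof -
      have "(\<lambda>n. X (r n) (cell t0 (\<tau> (r n)) t) - fst (Y (r n) t)) \<longlonglongrightarrow> 0"
        by (rule Lim_null_comparison[OF _ tendsto_mult_right_zero[OF \<tau>r, of M]])
          (use close[OF t] in auto)
      from tendsto_add[OF this tendsto_fst[OF Ylim[OF t]]] show ?thesis
        by (simp add: x_def y'_def cl_id[OF t] X_def)
    qed
  qed
qed

section \<open>Mollification of bounded functions\<close>

text \<open>
  A kernel with support in the unit ball.  The square makes its derivative Lipschitz, which gives
  second order Taylor estimates for mollified functions.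
\<close>

definition bump :: "'a::real_inner \<Rightarrow> real" where
  "bump w = (max 0 (1 - w \<bullet> w))\<^sup>2"

lemma positive_part_square_taylor:
  fixes a b :: real
  shows "\<bar>(max 0 b)\<^sup>2 - (max 0 a)\<^sup>2 - 2 * max 0 a * (b - a)\<bar> \<le> (b - a)\<^sup>2"
proof -
  consider "0 \<le> a" "0 \<le> b" | "0 \<le> a" "b < 0" | "a < 0" "0 \<le> b" | "a < 0" "b < 0" by linarith
  then show ?thesis
  proof cases
    case 1
    have "b\<^sup>2 - a\<^sup>2 - 2 * a * (b - a) = (b - a)\<^sup>2" by (simp add: power2_eq_square algebra_simps)
    then show ?thesis using 1 by simp
  next
    case 2
    have "a * b \<le> 0" using 2 by (simp add: mult_nonneg_nonpos)
    then have "0 \<le> a\<^sup>2 - 2 * (a * b)" using zero_le_power2[of a] by linarith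
    moreover have "0 - a\<^sup>2 - 2 * a * (b - a) = a\<^sup>2 - 2 * (a * b)" by (simp add: power2_eq_square algebra_simps)
    ultimately show ?thesis using 2 zero_le_power2[of b] by (simp add: power2_diff)
  next
    case 3
    have "a * b \<le> 0" using 3 by (simp add: mult_nonpos_nonneg)
    then show ?thesis using 3 by (auto simp: power2_eq_square algebra_simps abs_le_iff)
  qed auto
qed

text \<open>
  The constant 27 is 25 from the square of the increment of \<open>1 - w \<bullet> w\<close>, which is at most 5 times the
  norm of \<open>h\<close> on the ball of radius 2, plus 2 from the quadratic term of this increment.
\<close>

lemma bump_taylor:
  fixes w h :: "'a::real_inner"
  assumes h: "norm h \<le> 1"
  shows "\<bar>bump (w + h) - bump w + 4 * max 0 (1 - w \<bullet> w) * (w \<bullet> h)\<bar> \<le> 27 * (norm h)\<^sup>2 * indicator (cball 0 2) w"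
proof (cases "norm w \<le> 2")
  case True
  define a where "a = 1 - w \<bullet> w"
  define b where "b = 1 - (w + h) \<bullet> (w + h)"
  have ba: "b - a = - 2 * (w \<bullet> h) - h \<bullet> h"
    by (simp add: a_def b_def inner_add_left inner_add_right inner_commute)
  have "\<bar>w \<bullet> h\<bar> \<le> 2 * norm h"
    using Cauchy_Schwarz_ineq2[of w h] mult_right_mono[OF True, of "norm h"] by simp
  moreover have hh: "h \<bullet> h = (norm h)\<^sup>2" by (simp add: power2_norm_eq_inner)
  moreover have "(norm h)\<^sup>2 \<le> norm h" using h by (simp add: power2_eq_square mult_left_le)
  moreover have "0 \<le> (norm h)\<^sup>2" "0 \<le> norm h" by simp_all
  ultimately have "\<bar>b - a\<bar> \<le> 5 * norm h" unfolding ba by linarith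
  then have "(b - a)\<^sup>2 \<le> (5 * norm h)\<^sup>2" by (metis abs_ge_zero power2_abs power_mono)
  then have 1: "\<bar>(max 0 b)\<^sup>2 - (max 0 a)\<^sup>2 - 2 * max 0 a * (b - a)\<bar> \<le> 25 * (norm h)\<^sup>2"
    using positive_part_square_taylor[of b a] by (simp add: power_mult_distrib)
  have a1: "0 \<le> max 0 a" "max 0 a \<le> 1" by (auto simp: a_def)
  have "2 * max 0 a * (h \<bullet> h) \<le> 2 * 1 * (norm h)\<^sup>2"
    unfolding hh using a1 by (intro mult_right_mono) auto
  moreover have "0 \<le> 2 * max 0 a * (h \<bullet> h)" using a1 by simp
  moreover have "bump (w + h) - bump w + 4 * max 0 (1 - w \<bullet> w) * (w \<bullet> h) =
      ((max 0 b)\<^sup>2 - (max 0 a)\<^sup>2 - 2 * max 0 a * (b - a)) - 2 * max 0 a * (h \<bullet> h)"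
    unfolding ba by (simp add: bump_def a_def b_def algebra_simps)
  ultimately have "\<bar>bump (w + h) - bump w + 4 * max 0 (1 - w \<bullet> w) * (w \<bullet> h)\<bar> \<le> 27 * (norm h)\<^sup>2"
    using 1 by linarith
  then show ?thesis using True by simp
next
  case False
  have nw: "1 - v \<bullet> v \<le> 0" if "1 \<le> norm v" for v :: 'a
    using that power_mono[of 1 "norm v" 2] by (simp add: power2_norm_eq_inner)
  have "1 \<le> norm (w + h)" using norm_triangle_ineq4[of "w + h" h] False h by simp
  then show ?thesis using False nw[of w] nw[of "w + h"] by (simp add: bump_def)
qed

lemma bump_bounds: "0 \<le> bump w" "bump w \<le> indicator (cball 0 1) w"
proof -
  show "0 \<le> bump w" by (simp add: bump_def)
  show "bump w \<le> indicator (cball 0 1) w"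
  proof (cases "norm w \<le> 1")
    case True
    have "w \<bullet> w \<le> 1" using True power_mono[of "norm w" 1 2] by (simp add: power2_norm_eq_inner)
    then have "max 0 (1 - w \<bullet> w) \<le> 1" "0 \<le> max 0 (1 - w \<bullet> w)" by auto
    then have "bump w \<le> 1" unfolding bump_def by (rule power_le_one[rotated])
    then show ?thesis using True by simp
  next
    case False
    then have "1 - w \<bullet> w \<le> 0" using power_mono[of 1 "norm w" 2] by (simp add: power2_norm_eq_inner)
    then show ?thesis by (simp add: bump_def)
  qed
qed

lemma bump_abs: "\<bar>bump w\<bar> \<le> indicator (cball 0 1) w"
  using bump_bounds[of w] by simp

lemma bump_continuous: "continuous_on A bump"
  unfolding bump_def by (intro continuous_intros)

lemma bump_measurable[measurable]: "(bump :: 'a::euclidean_space \<Rightarrow> real) \<in> borel_measurable borel"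
  by (intro borel_measurable_continuous_onI bump_continuous)

lemma integrable_bounded_on_cball:
  fixes h :: "'a::euclidean_space \<Rightarrow> 'b::euclidean_space"
  assumes [measurable]: "h \<in> borel_measurable borel" and bd: "\<And>w. norm (h w) \<le> C * indicator (cball 0 R) w"
  shows "integrable lborel h" "norm (integral\<^sup>L lborel h) \<le> C * measure lborel (cball (0::'a) R)"
proof -
  have i: "integrable lborel (\<lambda>w. C * indicator (cball (0::'a) R) w)"
    using emeasure_bounded_finite[OF bounded_cball, of "0::'a" R]
    by (intro integrable_mult_right integrable_real_indicator) auto
  show h: "integrable lborel h"
    by (rule Bochner_Integration.integrable_bound[OF i]) (use bd order_trans[OF bd abs_ge_self] in auto)
  have "norm (integral\<^sup>L lborel h) \<le> (\<integral>w. norm (h w) \<partial>lborel)" by (rule integral_norm_bound)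
  also have "\<dots> \<le> (\<integral>w. C * indicator (cball (0::'a) R) w \<partial>lborel)"
    using h i bd by (intro integral_mono) auto
  finally show "norm (integral\<^sup>L lborel h) \<le> C * measure lborel (cball (0::'a) R)" by simp
qed

definition bump_mass :: "'a::euclidean_space itself \<Rightarrow> real" where
  "bump_mass _ = (\<integral>w. bump (w::'a) \<partial>lborel)"

lemma bump_mass_pos: "0 < bump_mass TYPE('a::euclidean_space)"
proof -
  have i: "integrable lborel (bump :: 'a \<Rightarrow> real)"
    by (rule integrable_bounded_on_cball(1)[of _ 1 1]) (use bump_abs in auto)
  have le: "1/4 * indicator (ball 0 (1/2)) w \<le> bump w" for w :: 'a
  proof (cases "norm w < 1/2")
    case True
    have "w \<bullet> w \<le> 1/4" using True power_mono[of "norm w" "1/2" 2] by (simp add: power2_norm_eq_inner power_divide)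
    then have "(1/2)\<^sup>2 \<le> (max 0 (1 - w \<bullet> w))\<^sup>2" by (intro power_mono) auto
    then show ?thesis using True by (simp add: bump_def power2_eq_square)
  qed (simp add: bump_bounds)
  have i': "integrable lborel (\<lambda>w::'a. 1/4 * indicator (ball 0 (1/2)) w :: real)"
    using emeasure_bounded_finite[OF bounded_ball, of "0::'a" "1/2"]
    by (intro integrable_mult_right integrable_real_indicator) auto
  have "0 < 1/4 * measure lborel (ball (0::'a) (1/2))" by (simp add: content_ball_pos)
  also have "\<dots> = (\<integral>w. 1/4 * indicator (ball (0::'a) (1/2)) w \<partial>lborel)" by simp
  also have "\<dots> \<le> bump_mass TYPE('a)" unfolding bump_mass_def using le by (intro integral_mono i i') auto
  finally show ?thesis .
qed

definition mollify :: "real \<Rightarrow> ('a::euclidean_space \<Rightarrow> real) \<Rightarrow> 'a \<Rightarrow> real" where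
  "mollify \<delta> W z = (\<integral>w. W (z + \<delta> *\<^sub>R w) * bump w \<partial>lborel) / bump_mass TYPE('a)"

lemma mollify_integrable:
  fixes W :: "'a::euclidean_space \<Rightarrow> real"
  assumes [measurable]: "W \<in> borel_measurable borel" and bd: "\<And>z. \<bar>W z\<bar> \<le> B"
  shows "integrable lborel (\<lambda>w. W (z + \<delta> *\<^sub>R w) * bump w)"
proof (rule integrable_bounded_on_cball(1)[of _ B 1])
  have "\<bar>W (z + \<delta> *\<^sub>R w)\<bar> * \<bar>bump w\<bar> \<le> B * indicator (cball 0 1) w" for w
    using bd bump_abs order_trans[OF abs_ge_zero bd] by (intro mult_mono) auto
  then show "norm (W (z + \<delta> *\<^sub>R w) * bump w) \<le> B * indicator (cball 0 1) w" for w
    by (simp add: abs_mult)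
qed measurable

lemma mollify_const: "mollify \<delta> (\<lambda>_. a) (z::'a::euclidean_space) = a"
proof -
  have "(\<integral>w. a * bump (w::'a) \<partial>lborel) = a * bump_mass TYPE('a)" unfolding bump_mass_def by (rule integral_mult_right_zero)
  then show ?thesis using bump_mass_pos[where 'a='a] unfolding mollify_def by (simp only:) simp
qed

text \<open>
  Inequalities between values at correspondingly shifted points are averaged.  Bounds, approximation
  by the mollified function and the dynamic programming inequality are all transferred in this way.
\<close>

lemma mollify_le:
  fixes P Q :: "'a::euclidean_space \<Rightarrow> real"
  assumes P: "P \<in> borel_measurable borel" "\<And>z. \<bar>P z\<bar> \<le> B"
    and Q: "Q \<in> borel_measurable borel" "\<And>z. \<bar>Q z\<bar> \<le> B'"
    and le: "\<And>w. norm w \<le> 1 \<Longrightarrow> P (z + \<delta> *\<^sub>R w) \<le> a + Q (z' + \<delta> *\<^sub>R w)"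
  shows "mollify \<delta> P z \<le> a + mollify \<delta> Q z'"
proof -
  have ib: "integrable lborel (bump :: 'a \<Rightarrow> real)"
    by (rule integrable_bounded_on_cball(1)[of _ 1 1]) (use bump_abs in auto)
  have "(\<integral>w. P (z + \<delta> *\<^sub>R w) * bump w \<partial>lborel) \<le> (\<integral>w. a * bump w + Q (z' + \<delta> *\<^sub>R w) * bump w \<partial>lborel)"
  proof (rule integral_mono)
    show "P (z + \<delta> *\<^sub>R w) * bump w \<le> a * bump w + Q (z' + \<delta> *\<^sub>R w) * bump w" for w
    proof (cases "norm w \<le> 1")
      case True
      then show ?thesis using mult_right_mono[OF le[OF True] bump_bounds(1)[of w]] by (simp add: algebra_simps)
    next
      case False
      then have "bump w = 0" using bump_bounds[of w] by simp
      then show ?thesis by simp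
    qed
  qed (intro Bochner_Integration.integrable_add integrable_mult_right ib mollify_integrable[OF P] mollify_integrable[OF Q])+
  also have "\<dots> = a * bump_mass TYPE('a) + (\<integral>w. Q (z' + \<delta> *\<^sub>R w) * bump w \<partial>lborel)"
    using ib mollify_integrable[OF Q] by (simp add: bump_mass_def)
  finally have "(\<integral>w. P (z + \<delta> *\<^sub>R w) * bump w \<partial>lborel) / bump_mass TYPE('a) \<le>
    (a * bump_mass TYPE('a) + (\<integral>w. Q (z' + \<delta> *\<^sub>R w) * bump w \<partial>lborel)) / bump_mass TYPE('a)"
    using bump_mass_pos[where 'a='a] by (intro divide_right_mono) auto
  then show ?thesis using bump_mass_pos[where 'a='a] by (simp add: mollify_def add_divide_distrib)
qed

text \<open>
  After a translation of the integration variable only the kernel depends on the increment \<open>h\<close>, so the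
  estimate comes from \<open>bump_taylor\<close> alone.  The constant \<open>C\<close> is the same for all \<open>W\<close>, so for a fixed scale the
  estimate is uniform in the time step of the discrete problem.
\<close>

lemma mollify_taylor:
  fixes dummy :: "'a::euclidean_space itself"
  obtains C where "0 \<le> C"
    "\<And>\<delta> B (W :: 'a \<Rightarrow> real). 0 < \<delta> \<Longrightarrow> W \<in> borel_measurable borel \<Longrightarrow> (\<And>z. \<bar>W z\<bar> \<le> B) \<Longrightarrow>
      \<exists>D. \<forall>z h. norm h \<le> \<delta> \<longrightarrow>
        \<bar>mollify \<delta> W (z + h) - mollify \<delta> W z - D z \<bullet> h\<bar> \<le> C * B / \<delta>\<^sup>2 * (norm h)\<^sup>2"
proof -
  define m where "m = bump_mass TYPE('a)"
  define C where "C = 27 * measure lborel (cball (0::'a) 2) / m"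
  have m: "0 < m" unfolding m_def by (rule bump_mass_pos)
  have C: "0 \<le> C" using m by (simp add: C_def)
  have "\<exists>D. \<forall>z h. norm h \<le> \<delta> \<longrightarrow>
        \<bar>mollify \<delta> W (z + h) - mollify \<delta> W z - D z \<bullet> h\<bar> \<le> C * B / \<delta>\<^sup>2 * (norm h)\<^sup>2"
    if \<delta>: "0 < \<delta>" and W[measurable]: "W \<in> borel_measurable borel" and bd: "\<And>z. \<bar>W z\<bar> \<le> B" for \<delta> B and W :: "'a \<Rightarrow> real"
  proof (intro exI allI impI)
    fix z h :: 'a assume h: "norm h \<le> \<delta>"
    define k where "k = (1 / \<delta>) *\<^sub>R h"
    have k: "norm k \<le> 1" "h = \<delta> *\<^sub>R k" using h \<delta> by (auto simp: k_def)
    have B: "0 \<le> B" using bd order_trans[OF abs_ge_zero] by blast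
    let ?q = "\<lambda>w::'a. max 0 (1 - w \<bullet> w)"
    let ?d = "\<lambda>w. (W (z + \<delta> *\<^sub>R w) * ?q w) *\<^sub>R w"
    define D where "D = (\<lambda>z. (4 / (\<delta> * m)) *\<^sub>R (\<integral>w. (W (z + \<delta> *\<^sub>R w) * ?q w) *\<^sub>R w \<partial>lborel))"
    have id: "integrable lborel ?d"
    proof (rule integrable_bounded_on_cball(1)[of _ B 1])
      show "norm (?d w) \<le> B * indicator (cball 0 1) w" for w
      proof (cases "norm w \<le> 1")
        case True
        have "\<bar>W (z + \<delta> *\<^sub>R w)\<bar> * \<bar>?q w\<bar> * norm w \<le> B * 1 * 1"
          using bd True B by (intro mult_mono) auto
        then show ?thesis using True by (simp add: abs_mult)
      next
        case False
        then have "?q w = 0" using power_mono[of 1 "norm w" 2] by (simp add: power2_norm_eq_inner)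
        then show ?thesis using False by simp
      qed
    qed measurable
    have shift: "(\<integral>w. W (z + h + \<delta> *\<^sub>R w) * bump w \<partial>lborel) = (\<integral>w. W (z + \<delta> *\<^sub>R w) * bump (w - k) \<partial>lborel)"
    proof -
      have "(\<integral>w. W (z + \<delta> *\<^sub>R w) * bump (w - k) \<partial>lborel) = (\<integral>w. W (z + \<delta> *\<^sub>R w) * bump (w - k) \<partial>distr lborel borel ((+) k))"
        by (simp only: lborel_distr_plus)
      also have "\<dots> = (\<integral>w. W (z + \<delta> *\<^sub>R (k + w)) * bump (k + w - k) \<partial>lborel)"
        by (subst integral_distr) auto
      finally show ?thesis using k by (simp add: algebra_simps)
    qed
    have i2: "integrable lborel (\<lambda>w. W (z + \<delta> *\<^sub>R w) * bump (w - k))"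
    proof (rule integrable_bounded_on_cball(1)[of _ B 2])
      show "norm (W (z + \<delta> *\<^sub>R w) * bump (w - k)) \<le> B * indicator (cball 0 2) w" for w
      proof -
        have "bump (w - k) \<le> indicator (cball 0 2) w"
          using bump_bounds(2)[of "w - k"] k(1) norm_triangle_ineq2[of w k] bump_bounds(1)[of "w - k"]
          by (cases "norm (w - k) \<le> 1") (auto simp: indicator_def)
        then have "\<bar>W (z + \<delta> *\<^sub>R w)\<bar> * \<bar>bump (w - k)\<bar> \<le> B * indicator (cball 0 2) w"
          using bd B bump_bounds(1)[of "w - k"] by (intro mult_mono) auto
        then show ?thesis by (simp add: abs_mult)
      qed
    qed measurable
    note i1 = mollify_integrable[OF W bd, of z \<delta>]
    let ?r = "\<lambda>w. W (z + \<delta> *\<^sub>R w) * (bump (w - k) - bump w - 4 * ?q w * (w \<bullet> k))"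
    have eq: "m * (mollify \<delta> W (z + h) - mollify \<delta> W z - D z \<bullet> h) = (\<integral>w. ?r w \<partial>lborel)"
    proof -
      have "D z \<bullet> h = (4 / m) * ((\<integral>w. ?d w \<partial>lborel) \<bullet> k)"
        using \<delta> by (simp add: D_def k(2))
      also have "\<dots> = (4 / m) * (\<integral>w. ?d w \<bullet> k \<partial>lborel)" by (subst integral_inner_left[OF id]) simp
      finally have D: "D z \<bullet> h = (4 / m) * (\<integral>w. ?d w \<bullet> k \<partial>lborel)" .
      have four: "(\<integral>w. 4 * (?d w \<bullet> k) \<partial>lborel) = 4 * (\<integral>w. ?d w \<bullet> k \<partial>lborel)"
        by (rule integral_mult_right_zero)
      have alg: "m * (p / m - q / m - (4 / m) * s) = p - q - 4 * s" for p q s :: real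
        using m by (simp add: field_simps)
      have "m * (mollify \<delta> W (z + h) - mollify \<delta> W z - D z \<bullet> h) =
         (\<integral>w. W (z + \<delta> *\<^sub>R w) * bump (w - k) \<partial>lborel) - (\<integral>w. W (z + \<delta> *\<^sub>R w) * bump w \<partial>lborel)
          - (\<integral>w. 4 * (?d w \<bullet> k) \<partial>lborel)"
        unfolding mollify_def m_def[symmetric] shift D four by (rule alg)
      also have "\<dots> = (\<integral>w. W (z + \<delta> *\<^sub>R w) * bump (w - k) - W (z + \<delta> *\<^sub>R w) * bump w - 4 * (?d w \<bullet> k) \<partial>lborel)"
      proof -
        have i3: "integrable lborel (\<lambda>w. 4 * (?d w \<bullet> k))"
          by (rule integrable_mult_right, rule integrable_inner_left, rule id)
        show ?thesis
          unfolding Bochner_Integration.integral_diff[OF Bochner_Integration.integrable_diff[OF i2 i1] i3]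
            Bochner_Integration.integral_diff[OF i2 i1] ..
      qed
      also have "\<dots> = (\<integral>w. ?r w \<partial>lborel)"
        by (intro Bochner_Integration.integral_cong) (auto simp: algebra_simps)
      finally show ?thesis .
    qed
    have "norm (\<integral>w. ?r w \<partial>lborel) \<le> (B * (27 * (norm k)\<^sup>2)) * measure lborel (cball (0::'a) 2)"
    proof (rule integrable_bounded_on_cball(2))
      fix w
      have "\<bar>W (z + \<delta> *\<^sub>R w)\<bar> * \<bar>bump (w - k) - bump w - 4 * ?q w * (w \<bullet> k)\<bar> \<le> B * (27 * (norm k)\<^sup>2 * indicator (cball 0 2) w)"
        using bd B bump_taylor[of "- k" w] k(1) by (intro mult_mono) auto
      then show "norm (?r w) \<le> B * (27 * (norm k)\<^sup>2) * indicator (cball 0 2) w"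
        by (simp add: abs_mult mult.assoc)
    qed measurable
    moreover have "norm (\<integral>w. ?r w \<partial>lborel) = m * \<bar>mollify \<delta> W (z + h) - mollify \<delta> W z - D z \<bullet> h\<bar>"
      unfolding eq[symmetric] using m by (simp add: abs_mult)
    moreover have "(B * (27 * (norm k)\<^sup>2)) * measure lborel (cball (0::'a) 2) = m * (C * B / \<delta>\<^sup>2 * (norm h)\<^sup>2)"
      using m \<delta> by (simp add: C_def k(2) power_mult_distrib field_simps)
    ultimately have "m * \<bar>mollify \<delta> W (z + h) - mollify \<delta> W z - D z \<bullet> h\<bar> \<le> m * (C * B / \<delta>\<^sup>2 * (norm h)\<^sup>2)"
      by linarith
    then show "\<bar>mollify \<delta> W (z + h) - mollify \<delta> W z
        - (\<lambda>z. (4 / (\<delta> * m)) *\<^sub>R (\<integral>w. (W (z + \<delta> *\<^sub>R w) * ?q w) *\<^sub>R w \<partial>lborel)) z \<bullet> h\<bar> \<le> C * B / \<delta>\<^sup>2 * (norm h)\<^sup>2"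
      unfolding mult_le_cancel_left_pos[OF m] by (simp only: D_def)
  qed
  with C that show ?thesis by blast
qed

text \<open>
  A uniform quadratic remainder forces the gradient to be Lipschitz: expand the value at \<open>z + k + h\<close> from \<open>z\<close>
  and from \<open>z + k\<close>, with \<open>h\<close> of the length of \<open>k\<close> in the direction of the change of the gradient.
\<close>

lemma C1_of_quadratic_remainder:
  fixes v :: "'a::euclidean_space \<Rightarrow> real"
  assumes C: "0 \<le> C" and r: "0 < r"
    and q: "\<And>z h. norm h \<le> r \<Longrightarrow> \<bar>v (z + h) - v z - D z \<bullet> h\<bar> \<le> C * (norm h)\<^sup>2"
  shows "(v has_derivative (\<lambda>h. D z \<bullet> h)) (at z)" "continuous_on UNIV D"
proof -
  show "(v has_derivative (\<lambda>h. D z \<bullet> h)) (at z)"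
    unfolding has_derivative_at_alt
  proof (intro conjI allI impI)
    show "bounded_linear ((\<bullet>) (D z))" by (rule bounded_linear_inner_right)
    fix e :: real assume e: "0 < e"
    show "\<exists>d>0. \<forall>y. norm (y - z) < d \<longrightarrow> norm (v y - v z - D z \<bullet> (y - z)) \<le> e * norm (y - z)"
    proof (intro exI[of _ "min r (e / (C + 1))"] conjI allI impI)
      show "0 < min r (e / (C + 1))" using r e C by simp
      fix y assume y: "norm (y - z) < min r (e / (C + 1))"
      have "C * norm (y - z) \<le> (C + 1) * norm (y - z)" by (simp add: mult_right_mono)
      also have "\<dots> \<le> e" using y C by (simp add: field_simps)
      finally have "C * norm (y - z) * norm (y - z) \<le> e * norm (y - z)" by (rule mult_right_mono) simp
      then show "norm (v y - v z - D z \<bullet> (y - z)) \<le> e * norm (y - z)"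
        using q[of "y - z" z] y by (simp add: power2_eq_square mult.assoc)
    qed
  qed
  have lip: "norm (D (z + k) - D z) \<le> 6 * C * norm k" if k: "norm k \<le> r / 2" for z k
  proof (cases "D (z + k) = D z")
    case False
    define n where "n = norm (D (z + k) - D z)"
    define h where "h = (norm k / n) *\<^sub>R (D (z + k) - D z)"
    have n: "0 < n" using False by (simp add: n_def)
    have nh: "norm h = norm k" using n by (simp add: h_def n_def)
    have kh: "norm (k + h) \<le> 2 * norm k" using norm_triangle_ineq[of k h] nh by simp
    have kh2: "(norm (k + h))\<^sup>2 \<le> 4 * (norm k)\<^sup>2"
      using power_mono[OF kh, of 2] by (simp add: power_mult_distrib)
    have e1: "\<bar>v (z + (k + h)) - v z - D z \<bullet> (k + h)\<bar> \<le> 4 * (C * (norm k)\<^sup>2)"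
      using q[of "k + h" z] kh k mult_left_mono[OF kh2 C] by simp
    have e2: "\<bar>v (z + k + h) - v (z + k) - D (z + k) \<bullet> h\<bar> \<le> C * (norm k)\<^sup>2"
      using q[of h "z + k"] nh k r by simp
    have e3: "\<bar>v (z + k) - v z - D z \<bullet> k\<bar> \<le> C * (norm k)\<^sup>2"
      using q[of k z] k r by simp
    have "(D (z + k) - D z) \<bullet> h \<le> 6 * (C * (norm k)\<^sup>2)"
      using e1 e2 e3 by (simp add: inner_add_right inner_diff_left add.assoc abs_le_iff)
    moreover have "(D (z + k) - D z) \<bullet> h = norm k * n"
      using n by (simp add: h_def n_def power2_norm_eq_inner[symmetric] power2_eq_square)
    ultimately have "norm k * n \<le> norm k * (6 * C * norm k)" by (simp add: power2_eq_square algebra_simps)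
    moreover have "norm k \<noteq> 0" using False by auto
    ultimately show ?thesis by (simp add: n_def)
  qed (use C in simp)
  show "continuous_on UNIV D"
    unfolding continuous_on_iff
  proof (intro ballI allI impI)
    fix z and e :: real assume e: "0 < e"
    show "\<exists>d>0. \<forall>z'\<in>UNIV. dist z' z < d \<longrightarrow> dist (D z') (D z) < e"
    proof (intro exI[of _ "min (r / 2) (e / (6 * C + 1))"] conjI ballI impI)
      show "0 < min (r / 2) (e / (6 * C + 1))" using r e C by simp
      fix z' assume z': "dist z' z < min (r / 2) (e / (6 * C + 1))"
      have "dist (D z') (D z) \<le> 6 * C * dist z' z"
        using lip[of "z' - z" z] z' by (simp add: dist_norm)
      also have "\<dots> \<le> (6 * C + 1) * dist z' z" by (simp add: mult_right_mono)
      also have "\<dots> < e" using z' C by (simp add: field_simps)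
      finally show "dist (D z') (D z) < e" .
    qed
  qed
qed

section \<open>Discrete dynamic programming and smooth subsolutions\<close>

text \<open>
  The optimal cost with \<open>n\<close> Euler steps to go, by backward dynamic programming.
\<close>

primrec dp_value :: "('x \<Rightarrow> 'b \<Rightarrow> 'x::real_normed_vector) \<Rightarrow> ('x \<Rightarrow> 'b \<Rightarrow> real) \<Rightarrow> ('x \<Rightarrow> real) \<Rightarrow> 'b set \<Rightarrow> real \<Rightarrow> nat \<Rightarrow> 'x \<Rightarrow> real" where
  "dp_value F c \<phi> U \<tau> 0 = \<phi>"
| "dp_value F c \<phi> U \<tau> (Suc n) = (\<lambda>x. INF u\<in>U. \<tau> * c x u + dp_value F c \<phi> U \<tau> n (x + \<tau> *\<^sub>R F x u))"

lemma euler_shift: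
  "euler F \<tau> x (case_nat u v) (Suc n) = euler F \<tau> (x + \<tau> *\<^sub>R F x u) v n"
  by (induction n) auto

locale unconstrained_problem =
  fixes F :: "'x::euclidean_space \<Rightarrow> 'b \<Rightarrow> 'x" and c :: "'x \<Rightarrow> 'b \<Rightarrow> real" and \<phi> :: "'x \<Rightarrow> real"
    and U :: "'b set" and B L :: real
  assumes U: "U \<noteq> {}"
    and bdF: "u \<in> U \<Longrightarrow> norm (F x u) \<le> B" and bdc: "u \<in> U \<Longrightarrow> \<bar>c x u\<bar> \<le> B" and bd\<phi>: "\<bar>\<phi> x\<bar> \<le> B"
    and lipF: "u \<in> U \<Longrightarrow> norm (F x u - F y u) \<le> L * norm (x - y)"
    and lipc: "u \<in> U \<Longrightarrow> \<bar>c x u - c y u\<bar> \<le> L * norm (x - y)"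
    and lip\<phi>: "\<bar>\<phi> x - \<phi> y\<bar> \<le> L * norm (x - y)"
    and L: "0 \<le> L"
begin

abbreviation "V \<equiv> dp_value F c \<phi> U"

lemma B: "0 \<le> B" using bd\<phi> abs_ge_zero order_trans by blast

lemma V_bound_and_bdd:
  assumes \<tau>: "0 < \<tau>"
  shows "\<bar>V \<tau> n x\<bar> \<le> B + real n * \<tau> * B"
    and "bdd_below ((\<lambda>u. \<tau> * c x u + V \<tau> n (x + \<tau> *\<^sub>R F x u)) ` U)"
proof -
  have lower: "\<bar>\<tau> * c x u + V \<tau> n (x + \<tau> *\<^sub>R F x u)\<bar> \<le> \<tau> * B + (B + real n * \<tau> * B)"
    if "\<And>x. \<bar>V \<tau> n x\<bar> \<le> B + real n * \<tau> * B" "u \<in> U" for n x u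
  proof -
    have "\<bar>\<tau> * c x u\<bar> \<le> \<tau> * B" using bdc[OF that(2), of x] \<tau> by (simp add: abs_mult)
    then show ?thesis using that(1)[of "x + \<tau> *\<^sub>R F x u"] by linarith
  qed
  have bound: "\<bar>V \<tau> n x\<bar> \<le> B + real n * \<tau> * B" for n x
  proof (induction n arbitrary: x)
    case 0
    show ?case using bd\<phi> by simp
  next
    case (Suc n)
    have l: "- (\<tau> * B + (B + real n * \<tau> * B)) \<le> \<tau> * c x u + V \<tau> n (x + \<tau> *\<^sub>R F x u)"
      and u: "\<tau> * c x u + V \<tau> n (x + \<tau> *\<^sub>R F x u) \<le> \<tau> * B + (B + real n * \<tau> * B)" if "u \<in> U" for u
      using lower[OF Suc that, of x] by (auto simp: abs_le_iff)
    obtain u0 where u0: "u0 \<in> U" using U by auto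
    have "- (\<tau> * B + (B + real n * \<tau> * B)) \<le> V \<tau> (Suc n) x"
      using l U by (simp add: cINF_greatest)
    moreover have "V \<tau> (Suc n) x \<le> \<tau> * B + (B + real n * \<tau> * B)"
      using u[OF u0] l u0 unfolding dp_value.simps by (intro cINF_lower2[where x=u0]) (auto intro!: bdd_belowI2)
    moreover have "\<tau> * B + (B + real n * \<tau> * B) = B + real (Suc n) * \<tau> * B" by (simp add: algebra_simps)
    ultimately show ?case by (intro abs_leI) linarith+
  qed
  show "\<bar>V \<tau> n x\<bar> \<le> B + real n * \<tau> * B" by (rule bound)
  show "bdd_below ((\<lambda>u. \<tau> * c x u + V \<tau> n (x + \<tau> *\<^sub>R F x u)) ` U)"
  proof (rule bdd_belowI2)
    show "- (\<tau> * B + (B + real n * \<tau> * B)) \<le> \<tau> * c x u + V \<tau> n (x + \<tau> *\<^sub>R F x u)" if "u \<in> U" for u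
      using lower[OF bound that, where n=n and x=x] by (simp add: abs_le_iff)
  qed
qed

lemma V_step:
  assumes "0 < \<tau>" "u \<in> U"
  shows "V \<tau> (Suc n) x \<le> \<tau> * c x u + V \<tau> n (x + \<tau> *\<^sub>R F x u)"
  using cINF_lower[OF V_bound_and_bdd(2)[OF assms(1)] assms(2)] by simp

lemma V_greatest:
  assumes "\<And>u. u \<in> U \<Longrightarrow> m \<le> \<tau> * c x u + V \<tau> n (x + \<tau> *\<^sub>R F x u)"
  shows "m \<le> V \<tau> (Suc n) x"
  using assms U by (simp add: cINF_greatest)

text \<open>
  If \<open>\<Lambda> n\<close> is a Lipschitz constant with \<open>n\<close> steps to go, then \<open>\<tau> * L + (1 + \<tau> * L) * \<Lambda> n\<close> is one for the next step.
  Thus \<open>\<Lambda> n + 1\<close> grows by the factor \<open>1 + \<tau> * L\<close>.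
\<close>

lemma V_lipschitz_power:
  assumes \<tau>: "0 < \<tau>"
  shows "\<bar>V \<tau> n x - V \<tau> n y\<bar> \<le> ((L + 1) * (1 + \<tau> * L) ^ n - 1) * norm (x - y)"
proof (induction n arbitrary: x y)
  case 0
  show ?case using lip\<phi>[of x y] by (simp add: algebra_simps)
next
  case (Suc n)
  define \<Lambda> where "\<Lambda> = (L + 1) * (1 + \<tau> * L) ^ n - 1"
  have "1 \<le> (1 + \<tau> * L) ^ n" using \<tau> L by (intro one_le_power) simp
  then have "1 * 1 \<le> (L + 1) * (1 + \<tau> * L) ^ n" using L by (intro mult_mono) auto
  then have \<Lambda>: "0 \<le> \<Lambda>" by (simp add: \<Lambda>_def)
  have one: "V \<tau> (Suc n) x \<le> V \<tau> (Suc n) y + (\<tau> * L + (1 + \<tau> * L) * \<Lambda>) * norm (x - y)" for x y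
  proof -
    have "V \<tau> (Suc n) x - (\<tau> * L + (1 + \<tau> * L) * \<Lambda>) * norm (x - y) \<le> V \<tau> (Suc n) y"
    proof (rule V_greatest)
      fix u assume u: "u \<in> U"
      have "(x + \<tau> *\<^sub>R F x u) - (y + \<tau> *\<^sub>R F y u) = (x - y) + \<tau> *\<^sub>R (F x u - F y u)"
        by (simp add: algebra_simps)
      note eq = this
      have "norm ((x + \<tau> *\<^sub>R F x u) - (y + \<tau> *\<^sub>R F y u)) \<le> norm (x - y) + \<tau> * norm (F x u - F y u)"
        using norm_triangle_ineq[of "x - y" "\<tau> *\<^sub>R (F x u - F y u)"] \<tau> unfolding eq by simp
      also have "\<dots> \<le> norm (x - y) + \<tau> * (L * norm (x - y))"
        using \<tau> by (intro add_left_mono mult_left_mono lipF u) auto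
      finally have "\<Lambda> * norm ((x + \<tau> *\<^sub>R F x u) - (y + \<tau> *\<^sub>R F y u)) \<le> \<Lambda> * ((1 + \<tau> * L) * norm (x - y))"
        using \<Lambda> by (intro mult_left_mono) (auto simp: algebra_simps)
      then have 1: "V \<tau> n (x + \<tau> *\<^sub>R F x u) \<le> V \<tau> n (y + \<tau> *\<^sub>R F y u) + \<Lambda> * ((1 + \<tau> * L) * norm (x - y))"
        using Suc[of "x + \<tau> *\<^sub>R F x u" "y + \<tau> *\<^sub>R F y u"] unfolding \<Lambda>_def[symmetric] by linarith
      have "\<tau> * (c x u - c y u) \<le> \<tau> * (L * norm (x - y))"
        using lipc[OF u, of x y] \<tau> by (intro mult_left_mono) auto
      then show "V \<tau> (Suc n) x - (\<tau> * L + (1 + \<tau> * L) * \<Lambda>) * norm (x - y) \<le> \<tau> * c y u + V \<tau> n (y + \<tau> *\<^sub>R F y u)"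
        using V_step[OF \<tau> u, of n x] 1 by (simp add: algebra_simps del: dp_value.simps)
    qed
    then show ?thesis by linarith
  qed
  have eq: "\<tau> * L + (1 + \<tau> * L) * \<Lambda> = (L + 1) * (1 + \<tau> * L) ^ Suc n - 1"
    by (simp add: \<Lambda>_def algebra_simps)
  show ?case using one[of x y] one[of y x] unfolding norm_minus_commute[of y x] eq by (intro abs_leI) linarith+
qed

lemma V_lipschitz:
  assumes \<tau>: "0 < \<tau>" and S: "real n * \<tau> \<le> S"
  shows "\<bar>V \<tau> n x - V \<tau> n y\<bar> \<le> (L + 1) * exp (S * L) * norm (x - y)"
proof -
  have "(1 + \<tau> * L) ^ n \<le> exp (\<tau> * L) ^ n" using \<tau> L by (intro power_mono) auto
  also have "\<dots> = exp (real n * \<tau> * L)" by (simp add: exp_of_nat_mult[symmetric] mult.assoc)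
  also have "\<dots> \<le> exp (S * L)" using S L by (simp add: mult_right_mono)
  finally have "(L + 1) * (1 + \<tau> * L) ^ n \<le> (L + 1) * exp (S * L)" using L by (intro mult_left_mono) auto
  then have "((L + 1) * (1 + \<tau> * L) ^ n - 1) * norm (x - y) \<le> (L + 1) * exp (S * L) * norm (x - y)"
    by (intro mult_right_mono) auto
  with V_lipschitz_power[OF \<tau>, of n x y] show ?thesis by linarith
qed

text \<open>
  The backward step is monotone and commutes with the addition of constants, so the
  bound on the first difference of consecutive values persists.
\<close>

lemma V_time_step:
  assumes \<tau>: "0 < \<tau>"
  shows "\<bar>V \<tau> (Suc n) x - V \<tau> n x\<bar> \<le> (B + L * B) * \<tau>"
proof (induction n arbitrary: x)
  case 0
  have b: "\<bar>(\<tau> * c x u + \<phi> (x + \<tau> *\<^sub>R F x u)) - \<phi> x\<bar> \<le> (B + L * B) * \<tau>" if u: "u \<in> U" for u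
  proof -
    have "\<bar>\<phi> (x + \<tau> *\<^sub>R F x u) - \<phi> x\<bar> \<le> L * (\<tau> * norm (F x u))"
      using lip\<phi>[of "x + \<tau> *\<^sub>R F x u" x] \<tau> by simp
    also have "\<dots> \<le> L * (\<tau> * B)" using L \<tau> bdF[OF u] by (intro mult_left_mono) auto
    finally have 1: "\<bar>\<phi> (x + \<tau> *\<^sub>R F x u) - \<phi> x\<bar> \<le> L * (\<tau> * B)" .
    have "\<bar>\<tau> * c x u\<bar> \<le> \<tau> * B" using bdc[OF u, of x] \<tau> by (simp add: abs_mult)
    with 1 have "\<bar>(\<tau> * c x u + \<phi> (x + \<tau> *\<^sub>R F x u)) - \<phi> x\<bar> \<le> \<tau> * B + L * (\<tau> * B)" by linarith
    then show ?thesis by (simp add: algebra_simps)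
  qed
  obtain u0 where u0: "u0 \<in> U" using U by auto
  have "\<phi> x - (B + L * B) * \<tau> \<le> V \<tau> (Suc 0) x"
  proof (rule V_greatest)
    show "\<phi> x - (B + L * B) * \<tau> \<le> \<tau> * c x u + V \<tau> 0 (x + \<tau> *\<^sub>R F x u)" if "u \<in> U" for u
      using b[OF that] by (simp add: abs_le_iff)
  qed
  moreover have "V \<tau> (Suc 0) x \<le> \<tau> * c x u0 + \<phi> (x + \<tau> *\<^sub>R F x u0)" using V_step[OF \<tau> u0, of 0 x] by simp
  ultimately show ?case using b[OF u0] unfolding dp_value.simps(1) by (intro abs_leI) linarith+
next
  case (Suc n)
  let ?C = "(B + L * B) * \<tau>"
  have "V \<tau> (Suc n) x - ?C \<le> V \<tau> (Suc (Suc n)) x"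
  proof (rule V_greatest)
    show "V \<tau> (Suc n) x - ?C \<le> \<tau> * c x u + V \<tau> (Suc n) (x + \<tau> *\<^sub>R F x u)" if "u \<in> U" for u
      using V_step[OF \<tau> that, of n x] Suc[of "x + \<tau> *\<^sub>R F x u"] by linarith
  qed
  moreover have "V \<tau> (Suc (Suc n)) x - ?C \<le> V \<tau> (Suc n) x"
  proof (rule V_greatest)
    show "V \<tau> (Suc (Suc n)) x - ?C \<le> \<tau> * c x u + V \<tau> n (x + \<tau> *\<^sub>R F x u)" if "u \<in> U" for u
      using V_step[OF \<tau> that, of "Suc n" x] Suc[of "x + \<tau> *\<^sub>R F x u"] by linarith
  qed
  ultimately show ?case by linarith
qed

lemma V_time:
  assumes \<tau>: "0 < \<tau>"
  shows "\<bar>V \<tau> m x - V \<tau> n x\<bar> \<le> (B + L * B) * \<bar>real m * \<tau> - real n * \<tau>\<bar>"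
proof -
  have le: "\<bar>V \<tau> (n + j) x - V \<tau> n x\<bar> \<le> (B + L * B) * (real j * \<tau>)" for n j
  proof (induction j)
    case (Suc j)
    have "(B + L * B) * (real (Suc j) * \<tau>) = (B + L * B) * (real j * \<tau>) + (B + L * B) * \<tau>"
      by (simp add: algebra_simps)
    then show ?case using Suc V_time_step[OF \<tau>, of "n + j" x] by (simp del: dp_value.simps)
  qed simp
  show ?thesis
  proof (cases "n \<le> m")
    case True
    then obtain j where m: "m = n + j" using le_Suc_ex by blast
    have "real m * \<tau> - real n * \<tau> = real j * \<tau>" by (simp add: m algebra_simps)
    then show ?thesis using le[of n j] \<tau> by (simp add: m)
  next
    case False
    then obtain j where n: "n = m + j" using le_Suc_ex nat_le_linear by blast
    have "real n * \<tau> - real m * \<tau> = real j * \<tau>" by (simp add: n algebra_simps)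
    then show ?thesis using le[of m j] \<tau> by (simp add: n abs_minus_commute[of "V \<tau> m x"] abs_minus_commute[of "real m * \<tau>"])
  qed
qed

lemma V_less_imp_euler:
  assumes \<tau>: "0 < \<tau>" and less: "V \<tau> n x < r"
  obtains v where "\<And>i. v i \<in> U"
    "\<tau> * (\<Sum>i<n. c (euler F \<tau> x v i) (v i)) + \<phi> (euler F \<tau> x v n) < r"
proof -
  have "\<exists>v. (\<forall>i. v i \<in> U) \<and> \<tau> * (\<Sum>i<n. c (euler F \<tau> x v i) (v i)) + \<phi> (euler F \<tau> x v n) < r"
    using less
  proof (induction n arbitrary: x r)
    case 0
    then show ?case using U by (auto intro!: exI[of _ "\<lambda>_. SOME u. u \<in> U"] simp: some_in_eq)
  next
    case (Suc n)
    obtain u where u: "u \<in> U" "\<tau> * c x u + V \<tau> n (x + \<tau> *\<^sub>R F x u) < r"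
      using V_greatest[of r \<tau> x n] Suc(2) by (meson not_less)
    then have "V \<tau> n (x + \<tau> *\<^sub>R F x u) < r - \<tau> * c x u" by linarith
    from Suc(1)[OF this] obtain v where v: "\<And>i. v i \<in> U"
      "\<tau> * (\<Sum>i<n. c (euler F \<tau> (x + \<tau> *\<^sub>R F x u) v i) (v i)) + \<phi> (euler F \<tau> (x + \<tau> *\<^sub>R F x u) v n) < r - \<tau> * c x u" by blast
    have "(\<Sum>i<Suc n. c (euler F \<tau> x (case_nat u v) i) (case_nat u v i)) =
      c x u + (\<Sum>i<n. c (euler F \<tau> (x + \<tau> *\<^sub>R F x u) v i) (v i))"
      by (subst sum.lessThan_Suc_shift) (simp only: euler_shift euler_0 nat.case)
    then show ?case
      using v u by (intro exI[of _ "case_nat u v"])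
        (auto simp: distrib_left euler_shift simp del: euler_Suc sum.lessThan_Suc split: nat.split)
  qed
  then show ?thesis using that by blast
qed

text \<open>
  Extend \<open>V\<close> to real times by counting the full steps up to \<open>T + 2 * \<delta>\<close>, mollify at scale \<open>\<delta>\<close>, and apply
  the Taylor estimate to the step \<open>\<tau> * (1, F x u)\<close> in the averaged dynamic programming inequality.  After
  division by \<open>\<tau>\<close> the error is of order \<open>\<delta>\<close> from the Lipschitz bounds plus \<open>Q * \<tau>\<close> with \<open>Q\<close> of order
  \<open>1 / \<delta>\<^sup>2\<close> from the remainder.  The term \<open>\<eta> * (t - T)\<close> compensates this and \<open>\<kappa>\<close> the error at the terminal
  time.
\<close>

lemma smooth_subsolution_near_V:
  fixes T t0 \<epsilon> :: real and x0 :: 'x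
  assumes t0T: "t0 \<le> T" and \<epsilon>: "0 < \<epsilon>"
  obtains \<tau> N v D where "0 < \<tau>" "\<tau> < \<epsilon>" "T - t0 \<le> real N * \<tau>" "real N * \<tau> \<le> T - t0 + \<tau>"
    "\<And>z. (v has_derivative (\<lambda>h. D z \<bullet> h)) (at z)" "continuous_on UNIV D"
    "\<And>t x u. t \<in> {t0..T} \<Longrightarrow> u \<in> U \<Longrightarrow> 0 \<le> c x u + D (t, x) \<bullet> (1, F x u)"
    "\<And>x. v (T, x) \<le> \<phi> x"
    "V \<tau> N x0 - \<epsilon> \<le> v (t0, x0)"
proof -
  obtain C0 where C0: "0 \<le> C0"
    and taylor: "\<And>\<delta> B (W :: real \<times> 'x \<Rightarrow> real). 0 < \<delta> \<Longrightarrow> W \<in> borel_measurable borel \<Longrightarrow> (\<And>z. \<bar>W z\<bar> \<le> B) \<Longrightarrow>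
      \<exists>D. \<forall>z h. norm h \<le> \<delta> \<longrightarrow>
        \<bar>mollify \<delta> W (z + h) - mollify \<delta> W z - D z \<bullet> h\<bar> \<le> C0 * B / \<delta>\<^sup>2 * (norm h)\<^sup>2"
    using mollify_taylor[where 'a="real \<times> 'x"] by blast
  define S where "S = T - t0 + 4"
  define \<Lambda> where "\<Lambda> = (L + 1) * exp (S * L)"
  define C where "C = B + L * B"
  define B' where "B' = B + S * B"
  have nn: "0 \<le> \<Lambda>" "0 \<le> C" "0 \<le> B'" using L B t0T by (auto simp: \<Lambda>_def C_def B'_def S_def)
  \<comment> \<open>\<open>a * \<delta>\<close> and \<open>q * \<tau>\<close> collect the losses at \<open>(t0, x0)\<close> of the two orders; each is made at most \<open>\<epsilon> / 2\<close>.\<close>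
  define a where "a = \<Lambda> + L + 7 * C + (L + \<Lambda> * L) * (T - t0)"
  have a: "0 \<le> a" using nn L t0T by (simp add: a_def)
  define \<delta> where "\<delta> = min 1 (\<epsilon> / (2 * (a + 1)))"
  have \<delta>: "0 < \<delta>" "\<delta> \<le> 1" using \<epsilon> a by (auto simp: \<delta>_def)
  have "a * \<delta> \<le> a * (\<epsilon> / (2 * (a + 1)))" using a by (intro mult_left_mono) (simp_all add: \<delta>_def)
  also have "\<dots> \<le> \<epsilon> / 2" using a \<epsilon> by (simp add: field_simps)
  finally have a\<delta>: "a * \<delta> \<le> \<epsilon> / 2" .
  define Q where "Q = C0 * B' / \<delta>\<^sup>2 * (1 + B)\<^sup>2"
  have Q: "0 \<le> Q" using C0 nn by (simp add: Q_def)
  define q where "q = Q * (T - t0)"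
  have q: "0 \<le> q" using Q t0T by (simp add: q_def)
  define \<tau> where "\<tau> = min (min (\<epsilon> / 2) (\<delta> / (2 * (1 + B)))) (\<epsilon> / (2 * (q + 1)))"
  have \<tau>: "0 < \<tau>" "\<tau> < \<epsilon>" using \<epsilon> \<delta> B q by (auto simp: \<tau>_def)
  have "\<tau> * (1 + B) \<le> \<delta> / (2 * (1 + B)) * (1 + B)" using B by (intro mult_right_mono) (auto simp: \<tau>_def)
  also have "\<dots> = \<delta> / 2" using B by (simp add: field_simps)
  finally have \<tau>B: "\<tau> * (1 + B) \<le> \<delta> / 2" .
  have "\<tau> * 1 \<le> \<tau> * (1 + B)" using B \<tau> by (intro mult_left_mono) auto
  then have \<tau>\<delta>: "\<tau> < \<delta>" using \<tau>B \<delta> by linarith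
  have "q * \<tau> \<le> q * (\<epsilon> / (2 * (q + 1)))" using q by (intro mult_left_mono) (auto simp: \<tau>_def)
  also have "\<dots> \<le> \<epsilon> / 2" using q \<epsilon> by (simp add: field_simps)
  finally have q\<tau>: "q * \<tau> \<le> \<epsilon> / 2" .
  have ceil: "y \<le> real (nat \<lceil>y / \<tau>\<rceil>) * \<tau>" "real (nat \<lceil>y / \<tau>\<rceil>) * \<tau> \<le> y + \<tau>" if "0 \<le> y" for y
  proof -
    have r: "real (nat \<lceil>y / \<tau>\<rceil>) = of_int \<lceil>y / \<tau>\<rceil>" using that \<tau> by simp
    have "y / \<tau> * \<tau> \<le> of_int \<lceil>y / \<tau>\<rceil> * \<tau>" using \<tau> by (intro mult_right_mono) auto
    then show "y \<le> real (nat \<lceil>y / \<tau>\<rceil>) * \<tau>" unfolding r using \<tau> by simp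
    have "of_int \<lceil>y / \<tau>\<rceil> \<le> y / \<tau> + 1" by linarith
    then have "of_int \<lceil>y / \<tau>\<rceil> * \<tau> \<le> (y / \<tau> + 1) * \<tau>" using \<tau> by (intro mult_right_mono) auto
    then show "real (nat \<lceil>y / \<tau>\<rceil>) * \<tau> \<le> y + \<tau>" unfolding r using \<tau> by (simp add: distrib_right)
  qed
  define N where "N = nat \<lceil>(T - t0) / \<tau>\<rceil>"
  have N: "T - t0 \<le> real N * \<tau>" "real N * \<tau> \<le> T - t0 + \<tau>" unfolding N_def using t0T by (intro ceil; simp)+
  define J where "J = nat \<lceil>(T - t0 + 3 * \<delta>) / \<tau>\<rceil>"
  have J: "T - t0 + 3 * \<delta> \<le> real J * \<tau>" "real J * \<tau> \<le> S"
  proof -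
    have y: "0 \<le> T - t0 + 3 * \<delta>" using t0T \<delta> by simp
    show "T - t0 + 3 * \<delta> \<le> real J * \<tau>" unfolding J_def by (rule ceil(1)[OF y])
    show "real J * \<tau> \<le> S" using ceil(2)[OF y] \<delta> \<tau>\<delta> unfolding J_def S_def by linarith
  qed
  \<comment> \<open>The horizon \<open>T + 2 * \<delta>\<close> leaves at least one step to go at all times up to \<open>T + \<delta>\<close> that the mollifier
    reaches; the cap \<open>J\<close> only keeps \<open>W\<close> bounded for times before \<open>t0 - \<delta>\<close>.\<close>
  define idx where "idx = (\<lambda>t. min J (nat \<lfloor>(T + 2 * \<delta> - t) / \<tau>\<rfloor>))"
  have idxS: "real (idx t) * \<tau> \<le> S" for t
  proof -
    have "real (idx t) * \<tau> \<le> real J * \<tau>" using \<tau> by (intro mult_right_mono) (auto simp: idx_def)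
    then show ?thesis using J by linarith
  qed
  have idx_val: "real (idx t) * \<tau> \<le> T + 2 * \<delta> - t" "T + 2 * \<delta> - t \<le> real (idx t) * \<tau> + \<tau>"
    if "t0 - \<delta> \<le> t" "t \<le> T + 2 * \<delta>" for t
  proof -
    let ?y = "(T + 2 * \<delta> - t) / \<tau>"
    have y0: "0 \<le> ?y" using that \<tau> by simp
    have "?y \<le> real J" using J that \<tau> by (simp add: pos_divide_le_eq)
    then have "nat \<lfloor>?y\<rfloor> \<le> J" using y0 by (simp add: nat_le_iff floor_le_iff)
    then have r: "real (idx t) = of_int \<lfloor>?y\<rfloor>" using y0 by (simp add: idx_def min_def)
    have "of_int \<lfloor>?y\<rfloor> * \<tau> \<le> ?y * \<tau>" using \<tau> by (intro mult_right_mono) auto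
    then show "real (idx t) * \<tau> \<le> T + 2 * \<delta> - t" unfolding r using \<tau> by simp
    have "?y \<le> of_int \<lfloor>?y\<rfloor> + 1" by linarith
    then have "?y * \<tau> \<le> (of_int \<lfloor>?y\<rfloor> + 1) * \<tau>" using \<tau> by (intro mult_right_mono) auto
    then show "T + 2 * \<delta> - t \<le> real (idx t) * \<tau> + \<tau>" unfolding r using \<tau> by (simp add: distrib_right)
  qed
  have idx_Suc: "idx t = Suc (idx (t + \<tau>))" if "t0 - \<delta> \<le> t" "t \<le> T + \<delta>" for t
  proof -
    let ?y = "(T + 2 * \<delta> - t) / \<tau>"
    have "1 \<le> ?y" using that \<tau> \<tau>\<delta> by simp
    then have f: "1 \<le> \<lfloor>?y\<rfloor>" by simp
    have "?y \<le> real J" using J that \<tau> by (simp add: pos_divide_le_eq)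
    then have fJ: "nat \<lfloor>?y\<rfloor> \<le> J" using f by (simp add: nat_le_iff floor_le_iff)
    have "(T + 2 * \<delta> - (t + \<tau>)) / \<tau> = ?y - 1" using \<tau> by (simp add: field_simps)
    then have "\<lfloor>(T + 2 * \<delta> - (t + \<tau>)) / \<tau>\<rfloor> = \<lfloor>?y\<rfloor> - 1" by simp
    then have "idx (t + \<tau>) = min J (nat (\<lfloor>?y\<rfloor> - 1))" by (simp only: idx_def)
    moreover have pred: "nat \<lfloor>?y\<rfloor> = Suc (nat (\<lfloor>?y\<rfloor> - 1))" using f by arith
    moreover have "idx t = min J (Suc (nat (\<lfloor>?y\<rfloor> - 1)))" unfolding idx_def pred[symmetric] ..
    moreover have "Suc (nat (\<lfloor>?y\<rfloor> - 1)) \<le> J" using fJ unfolding pred .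
    ultimately show ?thesis by (simp only: min_def) simp
  qed
  define W where "W = (\<lambda>z. V \<tau> (idx (fst z)) (snd z))"
  have V_lip: "\<bar>V \<tau> n x - V \<tau> n y\<bar> \<le> \<Lambda> * norm (x - y)" if "real n * \<tau> \<le> S" for n x y
    using V_lipschitz[OF \<tau>(1) that] by (simp add: \<Lambda>_def)
  have W_bd: "\<bar>W z\<bar> \<le> B'" for z
    using V_bound_and_bdd(1)[OF \<tau>(1), of "idx (fst z)" "snd z"] mult_right_mono[OF idxS[of "fst z"] B]
    by (simp add: W_def B'_def)
  have W_meas: "W \<in> borel_measurable borel"
    unfolding W_def
  proof (rule measurable_compose_countable)
    show "(\<lambda>z. V \<tau> n (snd z)) \<in> borel_measurable borel" for n
    proof (rule borel_measurable_continuous_onI)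
      have "continuous_on UNIV (V \<tau> n)"
      proof (rule lipschitz_on_continuous_on)
        show "((L + 1) * exp (real n * \<tau> * L))-lipschitz_on UNIV (V \<tau> n)"
          using V_lipschitz[OF \<tau>(1) order_refl] L by (intro lipschitz_onI) (auto simp: dist_norm)
      qed
      then show "continuous_on UNIV (\<lambda>z. V \<tau> n (snd z))"
        by (rule continuous_on_compose2) (auto intro: continuous_intros)
    qed
    have "(\<lambda>z::real \<times> 'x. fst z) \<in> borel_measurable borel"
      by (intro borel_measurable_continuous_onI continuous_intros)
    then show "(\<lambda>z::real \<times> 'x. idx (fst z)) \<in> borel \<rightarrow>\<^sub>M count_space UNIV"
      unfolding idx_def by measurable
  qed
  define m where "m = mollify \<delta> W"
  obtain D where D: "\<And>z h. norm h \<le> \<delta> \<Longrightarrow> \<bar>m (z + h) - m z - D z \<bullet> h\<bar> \<le> C0 * B' / \<delta>\<^sup>2 * (norm h)\<^sup>2"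
    using taylor[OF \<delta>(1) W_meas W_bd] unfolding m_def by blast
  have Cpos: "0 \<le> C0 * B' / \<delta>\<^sup>2" using C0 nn by simp
  note m_C1 = C1_of_quadratic_remainder[OF Cpos \<delta>(1) D]
  have unit: "\<bar>fst w\<bar> \<le> 1" "norm (snd w) \<le> 1" if "norm w \<le> 1" for w :: "real \<times> 'x"
    using that norm_fst_le[of "fst w" "snd w"] norm_snd_le[of "snd w" "fst w"] by auto
  have \<delta>unit: "\<bar>\<delta> * fst w\<bar> \<le> \<delta>" "norm (\<delta> *\<^sub>R snd w) \<le> \<delta>" if "norm w \<le> 1" for w :: "real \<times> 'x"
    using unit[OF that] \<delta> by (auto simp: abs_mult mult_left_le)
  define \<eta> where "\<eta> = (L + \<Lambda> * L) * \<delta> + Q * \<tau>"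
  define \<kappa> where "\<kappa> = (3 * C + L) * \<delta>"
  have dynamic: "0 \<le> c x u + D (t, x) \<bullet> (1, F x u) + \<eta>" if t: "t \<in> {t0..T}" and u: "u \<in> U" for t x u
  proof -
    define h where "h = \<tau> *\<^sub>R (1 :: real, F x u)"
    have "m (t, x) \<le> \<tau> * (c x u + (L + \<Lambda> * L) * \<delta>) + m ((t, x) + h)"
      unfolding m_def
    proof (rule mollify_le[OF W_meas W_bd W_meas W_bd])
      fix w :: "real \<times> 'x" assume w: "norm w \<le> 1"
      define s where "s = t + \<delta> * fst w"
      define y where "y = x + \<delta> *\<^sub>R snd w"
      have s: "t0 - \<delta> \<le> s" "s \<le> T + \<delta>" using \<delta>unit(1)[OF w] t by (auto simp: s_def abs_le_iff)
      have yx: "norm (y - x) \<le> \<delta>" using \<delta>unit(2)[OF w] by (simp add: y_def)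
      have "W ((t, x) + \<delta> *\<^sub>R w) = V \<tau> (Suc (idx (s + \<tau>))) y"
        by (simp only: W_def idx_Suc[OF s, symmetric]) (simp add: s_def y_def)
      also have "\<dots> \<le> \<tau> * c y u + V \<tau> (idx (s + \<tau>)) (y + \<tau> *\<^sub>R F y u)"
        by (rule V_step[OF \<tau>(1) u])
      also have "\<tau> * c y u \<le> \<tau> * (c x u + L * \<delta>)"
        using lipc[OF u, of y x] mult_left_mono[OF yx L] \<tau> by (intro mult_left_mono) (auto simp: abs_le_iff)
      also have "V \<tau> (idx (s + \<tau>)) (y + \<tau> *\<^sub>R F y u) \<le> V \<tau> (idx (s + \<tau>)) (y + \<tau> *\<^sub>R F x u) + \<Lambda> * (\<tau> * (L * \<delta>))"
      proof -
        have "norm ((y + \<tau> *\<^sub>R F y u) - (y + \<tau> *\<^sub>R F x u)) = \<tau> * norm (F y u - F x u)"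
          using \<tau> by (simp add: scaleR_diff_right[symmetric])
        also have "\<dots> \<le> \<tau> * (L * \<delta>)"
          using lipF[OF u, of y x] mult_left_mono[OF yx L] \<tau> by (intro mult_left_mono) auto
        finally have "\<Lambda> * norm ((y + \<tau> *\<^sub>R F y u) - (y + \<tau> *\<^sub>R F x u)) \<le> \<Lambda> * (\<tau> * (L * \<delta>))"
          using nn by (intro mult_left_mono)
        then show ?thesis using V_lip[OF idxS[of "s + \<tau>"], of "y + \<tau> *\<^sub>R F y u" "y + \<tau> *\<^sub>R F x u"] by linarith
      qed
      also have "V \<tau> (idx (s + \<tau>)) (y + \<tau> *\<^sub>R F x u) = W ((t, x) + h + \<delta> *\<^sub>R w)"
        by (simp add: W_def h_def s_def y_def ac_simps)
      finally show "W ((t, x) + \<delta> *\<^sub>R w) \<le> \<tau> * (c x u + (L + \<Lambda> * L) * \<delta>) + W ((t, x) + h + \<delta> *\<^sub>R w)"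
        by (simp add: algebra_simps)
    qed
    moreover have nh: "norm h \<le> \<tau> * (1 + B)"
    proof -
      have "norm (1 :: real, F x u) \<le> 1 + B"
        using norm_Pair_le[of "1 :: real" "F x u"] bdF[OF u, of x] by simp
      then have "\<bar>\<tau>\<bar> * norm (1 :: real, F x u) \<le> \<tau> * (1 + B)"
        using \<tau> by simp
      then show ?thesis unfolding h_def norm_scaleR .
    qed
    have "norm h \<le> \<delta>" using nh \<tau>B \<delta> by linarith
    from D[OF this, of "(t, x)"] have "m ((t, x) + h) \<le> m (t, x) + D (t, x) \<bullet> h + C0 * B' / \<delta>\<^sup>2 * (norm h)\<^sup>2"
      by (simp add: abs_le_iff)
    moreover have "C0 * B' / \<delta>\<^sup>2 * (norm h)\<^sup>2 \<le> C0 * B' / \<delta>\<^sup>2 * (\<tau> * (1 + B))\<^sup>2"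
      using nh by (intro mult_left_mono[OF _ Cpos] power_mono) auto
    moreover have "C0 * B' / \<delta>\<^sup>2 * (\<tau> * (1 + B))\<^sup>2 = \<tau> * (Q * \<tau>)"
      by (simp add: Q_def power_mult_distrib power2_eq_square)
    moreover have "D (t, x) \<bullet> h = \<tau> * (D (t, x) \<bullet> (1, F x u))" unfolding h_def by (rule inner_scaleR_right)
    ultimately have "0 \<le> \<tau> * (c x u + D (t, x) \<bullet> (1, F x u) + \<eta>)"
      by (simp add: \<eta>_def algebra_simps)
    then show ?thesis using \<tau> by (simp add: zero_le_mult_iff)
  qed
  have terminal: "m (T, x) \<le> \<phi> x + \<kappa>" for x
  proof -
    have "m (T, x) \<le> (\<phi> x + \<kappa>) + mollify \<delta> (\<lambda>_. 0) (T, x)"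
      unfolding m_def
    proof (rule mollify_le[OF W_meas W_bd])
      show "\<bar>0 :: real\<bar> \<le> 0" by simp
      fix w :: "real \<times> 'x" assume w: "norm w \<le> 1"
      define s where "s = T + \<delta> * fst w"
      define y where "y = x + \<delta> *\<^sub>R snd w"
      have s: "t0 - \<delta> \<le> s" "s \<le> T + 2 * \<delta>" "T - \<delta> \<le> s" using \<delta>unit(1)[OF w] t0T \<delta> unfolding s_def abs_le_iff by linarith+
      have yx: "norm (y - x) \<le> \<delta>" using \<delta>unit(2)[OF w] by (simp add: y_def)
      have "real (idx s) * \<tau> \<le> 3 * \<delta>" using idx_val(1)[OF s(1,2)] s by linarith
      then have "C * \<bar>real (idx s) * \<tau> - real 0 * \<tau>\<bar> \<le> C * (3 * \<delta>)"
        using nn \<tau> by (intro mult_left_mono) auto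
      then have "V \<tau> (idx s) y \<le> \<phi> y + C * (3 * \<delta>)"
        using V_time[OF \<tau>(1), of "idx s" y 0] unfolding C_def dp_value.simps(1) abs_le_iff by linarith
      also have "\<phi> y \<le> \<phi> x + L * \<delta>"
        using lip\<phi>[of y x] mult_left_mono[OF yx L] by (simp add: abs_le_iff)
      finally show "W ((T, x) + \<delta> *\<^sub>R w) \<le> \<phi> x + \<kappa> + 0"
        by (simp add: W_def s_def y_def \<kappa>_def algebra_simps)
    qed simp
    then show ?thesis by (simp add: mollify_const)
  qed
  have initial: "V \<tau> N x0 \<le> (\<Lambda> + 4 * C) * \<delta> + m (t0, x0)"
  proof -
    have "mollify \<delta> (\<lambda>_. V \<tau> N x0) (t0, x0) \<le> (\<Lambda> + 4 * C) * \<delta> + m (t0, x0)"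
      unfolding m_def
    proof (rule mollify_le[OF _ _ W_meas W_bd])
      show "\<bar>V \<tau> N x0\<bar> \<le> \<bar>V \<tau> N x0\<bar>" by simp
      fix w :: "real \<times> 'x" assume w: "norm w \<le> 1"
      define s where "s = t0 + \<delta> * fst w"
      define y where "y = x0 + \<delta> *\<^sub>R snd w"
      have s: "t0 - \<delta> \<le> s" "s \<le> T + 2 * \<delta>" "s \<le> t0 + \<delta>" using \<delta>unit(1)[OF w] t0T \<delta> unfolding s_def abs_le_iff by linarith+
      have yx: "norm (x0 - y) \<le> \<delta>" using \<delta>unit(2)[OF w] by (simp add: y_def)
      have "\<bar>real N * \<tau> - real (idx s) * \<tau>\<bar> \<le> 4 * \<delta>"
        using idx_val[OF s(1,2)] s N \<tau>\<delta> by (intro abs_leI) linarith+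
      then have "C * \<bar>real N * \<tau> - real (idx s) * \<tau>\<bar> \<le> C * (4 * \<delta>)"
        using nn by (intro mult_left_mono)
      then have "V \<tau> N y \<le> V \<tau> (idx s) y + C * (4 * \<delta>)"
        using V_time[OF \<tau>(1), of N y "idx s"] unfolding C_def abs_le_iff by linarith
      moreover have "real N * \<tau> \<le> S" using N \<tau>\<delta> \<delta> by (simp add: S_def)
      from V_lip[OF this, of x0 y] have "V \<tau> N x0 \<le> V \<tau> N y + \<Lambda> * \<delta>"
        using mult_left_mono[OF yx nn(1)] by (simp add: abs_le_iff)
      ultimately show "V \<tau> N x0 \<le> (\<Lambda> + 4 * C) * \<delta> + W ((t0, x0) + \<delta> *\<^sub>R w)"
        by (simp add: W_def s_def y_def algebra_simps)
    qed simp
    then show ?thesis by (simp add: mollify_const)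
  qed
  define v where "v = (\<lambda>z. m z + \<eta> * (fst z - T) - \<kappa>)"
  define D' where "D' = (\<lambda>z. D z + (\<eta>, 0))"
  show ?thesis
  proof (rule that[of \<tau> N v D'])
    show "(v has_derivative (\<lambda>h. D' z \<bullet> h)) (at z)" for z
      unfolding v_def D'_def inner_add_left
      by (auto intro!: derivative_eq_intros m_C1(1) simp: inner_prod_def)
    show "continuous_on UNIV D'" unfolding D'_def by (intro continuous_intros m_C1(2))
    show "0 \<le> c x u + D' (t, x) \<bullet> (1, F x u)" if "t \<in> {t0..T}" "u \<in> U" for t x u
      using dynamic[OF that, of x] by (simp add: D'_def inner_add_left inner_prod_def algebra_simps)
    show "v (T, x) \<le> \<phi> x" for x using terminal[of x] by (simp add: v_def)
    show "V \<tau> N x0 - \<epsilon> \<le> v (t0, x0)"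
    proof -
      have "(\<Lambda> + 4 * C) * \<delta> + \<eta> * (T - t0) + \<kappa> = a * \<delta> + q * \<tau>"
        by (simp add: \<eta>_def \<kappa>_def a_def q_def algebra_simps)
      then have "(\<Lambda> + 4 * C) * \<delta> + \<eta> * (T - t0) + \<kappa> \<le> \<epsilon>" using a\<delta> q\<tau> by linarith
      then show ?thesis using initial by (simp add: v_def algebra_simps)
    qed
  qed (use \<tau> N in auto)
qed

end

section \<open>Derivatives along integral curves and averages over relaxed controls\<close>

text \<open>
  Gradients take values in a Euclidean space, where measurability and integrals of products with
  velocities are available.
\<close>

lemma C1_near_iff_gradient:
  fixes v :: "'a::euclidean_space \<Rightarrow> real"
  shows "v \<in> C1_near S \<longleftrightarrow> (\<exists>N D. open N \<and> S \<subseteq> N \<and> (\<forall>z\<in>N. (v has_derivative (\<lambda>h. D z \<bullet> h)) (at z)) \<and> continuous_on N D)"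
proof
  assume "v \<in> C1_near S"
  then obtain N v' where N: "open N" "S \<subseteq> N" "\<forall>z\<in>N. (v has_derivative blinfun_apply (v' z)) (at z)" "continuous_on N v'"
    unfolding C1_near_def by blast
  define D where "D = (\<lambda>z. \<Sum>i\<in>Basis. blinfun_apply (v' z) i *\<^sub>R i)"
  have Dh: "blinfun_apply (v' z) h = D z \<bullet> h" for z h
  proof -
    have "blinfun_apply (v' z) h = blinfun_apply (v' z) (\<Sum>i\<in>Basis. (h \<bullet> i) *\<^sub>R i)"
      by (simp only: euclidean_representation)
    also have "\<dots> = (\<Sum>i\<in>Basis. (h \<bullet> i) * blinfun_apply (v' z) i)"
      by (simp add: blinfun.sum_right blinfun.scaleR_right)
    finally have "blinfun_apply (v' z) h = (\<Sum>i\<in>Basis. (h \<bullet> i) * blinfun_apply (v' z) i)" .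
    moreover have "D z \<bullet> h = (\<Sum>i\<in>Basis. blinfun_apply (v' z) i * (i \<bullet> h))"
      by (simp add: D_def inner_sum_left)
    ultimately show ?thesis by (simp add: inner_commute[of h] mult.commute)
  qed
  have "continuous_on N D" unfolding D_def by (intro continuous_intros N(4))
  moreover have "blinfun_apply (v' z) = (\<lambda>h. D z \<bullet> h)" for z using Dh by blast
  ultimately show "\<exists>N D. open N \<and> S \<subseteq> N \<and> (\<forall>z\<in>N. (v has_derivative (\<lambda>h. D z \<bullet> h)) (at z)) \<and> continuous_on N D"
    using N by auto
next
  assume "\<exists>N D. open N \<and> S \<subseteq> N \<and> (\<forall>z\<in>N. (v has_derivative (\<lambda>h. D z \<bullet> h)) (at z)) \<and> continuous_on N D"
  then obtain N D where N: "open N" "S \<subseteq> N" "\<forall>z\<in>N. (v has_derivative (\<lambda>h. D z \<bullet> h)) (at z)" "continuous_on N D"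
    by blast
  have "blinfun_apply (blinfun_inner_right (D z)) = (\<lambda>h. D z \<bullet> h)" for z by auto
  moreover have "continuous_on N (\<lambda>z. blinfun_inner_right (D z))"
    by (rule bounded_linear.continuous_on[OF bounded_linear_blinfun_inner_right N(4)])
  ultimately show "v \<in> C1_near S" using N unfolding C1_near_def by (intro CollectI exI[of _ N] exI[of _ "\<lambda>z. blinfun_inner_right (D z)"] conjI) auto
qed

lemma partial_derivatives_eq_gradient:
  fixes v :: "real \<times> 'x::euclidean_space \<Rightarrow> real"
  assumes v: "(v has_derivative (\<lambda>h. D \<bullet> h)) (at (t, x))"
  shows "deriv (\<lambda>s. v (s, x)) t + grad (\<lambda>y. v (t, y)) x \<bullet> w = D \<bullet> (1, w)"
proof -
  have "((\<lambda>s. v (s, x)) has_derivative (\<lambda>h. D \<bullet> (h, 0))) (at t)"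
    by (rule has_derivative_compose[of "\<lambda>s. (s, x)" "\<lambda>h. (h, 0)", OF _ v]) (auto intro!: derivative_eq_intros)
  moreover have "(\<lambda>h. D \<bullet> (h, 0)) = (*) (fst D)" by (auto simp: inner_prod_def)
  ultimately have "((\<lambda>s. v (s, x)) has_field_derivative fst D) (at t)" by (simp add: has_field_derivative_def)
  then have 1: "deriv (\<lambda>s. v (s, x)) t = fst D" by (rule DERIV_imp_deriv)
  have d2: "((\<lambda>y. v (t, y)) has_derivative (\<lambda>h. D \<bullet> (0, h))) (at x)"
    by (rule has_derivative_compose[of "\<lambda>y. (t, y)" "\<lambda>h. (0, h)", OF _ v]) (auto intro!: derivative_eq_intros)
  have 2: "grad (\<lambda>y. v (t, y)) x = snd D"
    unfolding grad_def gderiv_def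
  proof (rule the_equality)
    show "((\<lambda>y. v (t, y)) has_derivative (\<lambda>h. h \<bullet> snd D)) (at x)"
      using d2 by (simp add: inner_prod_def inner_commute)
    fix E assume "((\<lambda>y. v (t, y)) has_derivative (\<lambda>h. h \<bullet> E)) (at x)"
    from fun_cong[OF has_derivative_unique[OF this d2]] have "h \<bullet> E = h \<bullet> snd D" for h
      by (simp add: inner_prod_def inner_commute[of "snd D"])
    then have "(E - snd D) \<bullet> (E - snd D) = 0" by (simp add: inner_diff_right)
    then show "E = snd D" by simp
  qed
  show ?thesis unfolding 1 2 by (simp add: inner_prod_def)
qed

text \<open>
  The chain rule for a curve that is merely an integral of a bounded measurable velocity.  The velocity
  need not be the derivative of the curve at each time.  The difference of the two sides, as a function of the
  upper limit, nevertheless has derivative 0 at every time: on a short interval around \<open>t\<close> both sides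
  differ by little from the increment of the curve, paired with the gradient frozen at time \<open>t\<close>.
\<close>

lemma gradient_along_integral_curve:
  fixes v :: "real \<times> 'x::euclidean_space \<Rightarrow> real" and F :: "real \<Rightarrow> 'x"
  assumes ab: "a \<le> b"
    and F: "F \<in> borel_measurable (lebesgue_on {a..b})" and bd: "\<And>s. s \<in> {a..b} \<Longrightarrow> norm (F s) \<le> B"
    and x: "\<And>t. t \<in> {a..b} \<Longrightarrow> x t = xa + (LINT s:{a..t}|lebesgue. F s)"
    and v: "\<And>s. s \<in> {a..b} \<Longrightarrow> (v has_derivative (\<lambda>h. D (s, x s) \<bullet> h)) (at (s, x s))"
    and D: "continuous_on N D" "\<And>s. s \<in> {a..b} \<Longrightarrow> (s, x s) \<in> N"
  shows "set_integrable lebesgue {a..b} (\<lambda>s. D (s, x s) \<bullet> (1, F s))"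
    and "v (b, x b) - v (a, x a) = (LINT s:{a..b}|lebesgue. D (s, x s) \<bullet> (1, F s))"
proof -
  have "0 \<le> B" using bd[of a] ab norm_ge_zero[of "F a"] by (meson atLeastAtMost_iff order_refl order_trans)
  note B = this
  have Fi: "set_integrable lebesgue {c..d} F" if "{c..d} \<subseteq> {a..b}" for c d
    by (rule set_integrable_lebesgue_bounded_Icc[OF F bd that])
  have x_diff: "x d - x c = (LINT s:{c..d}|lebesgue. F s)" if "a \<le> c" "c \<le> d" "d \<le> b" for c d
    using set_integral_lebesgue_Icc_combine[OF Fi that(1,2)] x[of c] x[of d] that by (auto simp: algebra_simps)
  have x_lip: "norm (x d - x c) \<le> B * (d - c)" if "a \<le> c" "c \<le> d" "d \<le> b" for c d
    unfolding x_diff[OF that] using that B bd by (intro norm_set_integral_lebesgue_Icc_le Fi) auto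
  have x_lip': "norm (x d - x c) \<le> B * \<bar>d - c\<bar>" if "c \<in> {a..b}" "d \<in> {a..b}" for c d
    using x_lip[of c d] x_lip[of d c] that by (cases "c \<le> d") (auto simp: norm_minus_commute)
  have x_cont: "continuous_on {a..b} x"
    using x_lip' B by (intro lipschitz_on_continuous_on[of B] lipschitz_onI) (auto simp: dist_norm)
  define E where "E = (\<lambda>s. D (s, x s))"
  have E_cont: "continuous_on {a..b} E"
    unfolding E_def using D(2) by (intro continuous_on_compose2[OF D(1)] continuous_intros x_cont) auto
  define k where "k = (\<lambda>s. E s \<bullet> (1, F s))"
  obtain BE where "\<forall>e\<in>E ` {a..b}. norm e \<le> BE"
    using compact_imp_bounded[OF compact_continuous_image[OF E_cont compact_Icc]] unfolding bounded_iff by blast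
  then have BE: "norm (E s) \<le> BE" if "s \<in> {a..b}" for s using that by blast
  have nF: "norm (1 :: real, F s) \<le> 1 + B" if "s \<in> {a..b}" for s
    using norm_Pair_le[of "1 :: real" "F s"] bd[OF that] by simp
  have k_meas: "k \<in> borel_measurable (lebesgue_on {a..b})"
  proof -
    have [measurable]: "E \<in> borel_measurable (lebesgue_on {a..b})"
      by (rule continuous_imp_measurable_on_sets_lebesgue[OF E_cont]) auto
    note [measurable] = F
    show ?thesis unfolding k_def by measurable
  qed
  have k_bd: "norm (k s) \<le> BE * (1 + B)" if "s \<in> {a..b}" for s
  proof -
    have "\<bar>k s\<bar> \<le> norm (E s) * norm (1 :: real, F s)" unfolding k_def by (rule Cauchy_Schwarz_ineq2)
    also have "\<dots> \<le> BE * (1 + B)"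
      using BE[OF that] nF[OF that] order_trans[OF norm_ge_zero BE[OF that]] by (intro mult_mono) auto
    finally show ?thesis by simp
  qed
  have ki: "set_integrable lebesgue {c..d} k" if "{c..d} \<subseteq> {a..b}" for c d
    by (rule set_integrable_lebesgue_bounded_Icc[OF k_meas k_bd that])
  show "set_integrable lebesgue {a..b} (\<lambda>s. D (s, x s) \<bullet> (1, F s))"
    using ki[OF order_refl] by (simp add: k_def E_def)
  define \<Phi> where "\<Phi> = (\<lambda>t. v (t, x t) - (LINT s:{a..t}|lebesgue. k s))"
  have \<Phi>_diff: "\<Phi> d - \<Phi> c = v (d, x d) - v (c, x c) - (LINT s:{c..d}|lebesgue. k s)" if "a \<le> c" "c \<le> d" "d \<le> b" for c d
    using set_integral_lebesgue_Icc_combine[OF ki that(1,2)] that by (auto simp: \<Phi>_def)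
  have der0: "(\<Phi> has_field_derivative 0) (at t within {a..b})" if t: "t \<in> {a..b}" for t
    unfolding has_field_derivative_def has_derivative_within_alt
  proof (intro conjI allI impI)
    show "bounded_linear ((*) (0 :: real))" by (rule bounded_linear_mult_right)
    fix e :: real assume e: "0 < e"
    define e1 where "e1 = e / (2 * (1 + B))"
    have e1: "0 < e1" using e B by (simp add: e1_def)
    obtain d1 where d1: "0 < d1" "\<And>z. norm (z - (t, x t)) < d1 \<Longrightarrow>
        norm (v z - v (t, x t) - E t \<bullet> (z - (t, x t))) \<le> e1 * norm (z - (t, x t))"
      using v[OF t] e1 unfolding has_derivative_at_alt E_def by blast
    obtain d2 where d2: "0 < d2" "\<And>s. s \<in> {a..b} \<Longrightarrow> \<bar>s - t\<bar> < d2 \<Longrightarrow> norm (E s - E t) < e1"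
      using E_cont t e1 unfolding continuous_on_iff dist_norm real_norm_def by meson
    show "\<exists>d>0. \<forall>s\<in>{a..b}. norm (s - t) < d \<longrightarrow> norm (\<Phi> s - \<Phi> t - 0 * (s - t)) \<le> e * norm (s - t)"
    proof (intro exI[of _ "min (d1 / (1 + B)) d2"] conjI ballI impI)
      show "0 < min (d1 / (1 + B)) d2" using d1 d2 B by simp
      fix s assume s: "s \<in> {a..b}" and st: "norm (s - t) < min (d1 / (1 + B)) d2"
      define c where "c = min s t"
      define d where "d = max s t"
      have cd: "a \<le> c" "c \<le> d" "d \<le> b" "d - c = \<bar>s - t\<bar>" using s t by (auto simp: c_def d_def)
      have nz: "norm ((s, x s) - (t, x t)) \<le> (1 + B) * \<bar>s - t\<bar>"
        using norm_Pair_le[of "s - t" "x s - x t"] x_lip'[OF t s] by (simp add: algebra_simps)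
      also have "\<dots> < d1" using st B by (simp add: field_simps)
      finally have "norm (v (s, x s) - v (t, x t) - E t \<bullet> ((s, x s) - (t, x t))) \<le> e1 * norm ((s, x s) - (t, x t))"
        by (rule d1(2))
      also have "\<dots> \<le> e1 * ((1 + B) * \<bar>s - t\<bar>)" using nz e1 by (intro mult_left_mono) auto
      finally have 1: "\<bar>v (s, x s) - v (t, x t) - E t \<bullet> (s - t, x s - x t)\<bar> \<le> e1 * ((1 + B) * \<bar>s - t\<bar>)" by simp
      have sub: "{c..d} \<subseteq> {a..b}" using cd by auto
      have Gi: "set_integrable lebesgue {c..d} (\<lambda>r. E t \<bullet> (1, F r))"
        and Ge: "(LINT r:{c..d}|lebesgue. E t \<bullet> (1, F r)) = E t \<bullet> (d - c, x d - x c)"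
      proof -
        have one: "set_integrable lebesgue {c..d} (\<lambda>r. fst (E t))"
          by (rule set_integrable_lebesgue_bounded_Icc[OF _ _ order_refl, of _ c d "norm (fst (E t))"]) auto
        have two: "set_integrable lebesgue {c..d} (\<lambda>r. snd (E t) \<bullet> F r)"
          using Fi[OF sub] unfolding set_integrable_def by (simp flip: inner_scaleR_right)
        have eq: "E t \<bullet> (1, F r) = fst (E t) + snd (E t) \<bullet> F r" for r by (simp add: inner_prod_def)
        show "set_integrable lebesgue {c..d} (\<lambda>r. E t \<bullet> (1, F r))"
          unfolding eq by (rule set_integral_add(1)[OF one two])
        have "(LINT r:{c..d}|lebesgue. snd (E t) \<bullet> F r) = snd (E t) \<bullet> (LINT r:{c..d}|lebesgue. F r)"
          using Fi[OF sub] unfolding set_integrable_def set_lebesgue_integral_def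
          by (simp flip: inner_scaleR_right)
        then show "(LINT r:{c..d}|lebesgue. E t \<bullet> (1, F r)) = E t \<bullet> (d - c, x d - x c)"
          unfolding eq set_integral_add(2)[OF one two] x_diff[OF cd(1-3)]
          using cd by (simp add: inner_prod_def set_integral_const mult.commute)
      qed
      have "\<bar>(LINT r:{c..d}|lebesgue. E t \<bullet> (1, F r) - k r)\<bar> \<le> e1 * (1 + B) * (d - c)"
      proof (subst real_norm_def[symmetric], rule norm_set_integral_lebesgue_Icc_le[OF set_integral_diff(1)[OF Gi ki[OF sub]]])
        fix r assume r: "r \<in> {c..d}"
        then have rab: "r \<in> {a..b}" and rt: "\<bar>r - t\<bar> < d2" using sub st by (auto simp: c_def d_def)
        have "\<bar>(E t - E r) \<bullet> (1, F r)\<bar> \<le> norm (E t - E r) * norm (1 :: real, F r)" by (rule Cauchy_Schwarz_ineq2)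
        also have "\<dots> \<le> e1 * (1 + B)"
          using d2(2)[OF rab rt] nF[OF rab] e1 by (intro mult_mono) (auto simp: norm_minus_commute)
        finally show "norm (E t \<bullet> (1, F r) - k r) \<le> e1 * (1 + B)" by (simp add: k_def inner_diff_left)
      qed (use e1 B cd in auto)
      then have 2: "\<bar>E t \<bullet> (d - c, x d - x c) - (LINT r:{c..d}|lebesgue. k r)\<bar> \<le> e1 * (1 + B) * \<bar>s - t\<bar>"
        unfolding set_integral_diff(2)[OF Gi ki[OF sub]] Ge cd(4) .
      have 3: "\<Phi> d - \<Phi> c = v (d, x d) - v (c, x c) - (LINT s:{c..d}|lebesgue. k s)" by (rule \<Phi>_diff[OF cd(1-3)])
      have 4: "E t \<bullet> (t - s, x t - x s) = - (E t \<bullet> (s - t, x s - x t))"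
        by (simp add: inner_prod_def inner_diff_right algebra_simps)
      have "\<bar>\<Phi> s - \<Phi> t\<bar> \<le> 2 * (e1 * (1 + B) * \<bar>s - t\<bar>)"
      proof (cases "s \<le> t")
        case True
        then have "c = s" "d = t" by (auto simp: c_def d_def)
        then show ?thesis using 1 2 3 4 by (simp add: abs_le_iff) 
      next
        case False
        then have "c = t" "d = s" by (auto simp: c_def d_def)
        then show ?thesis using 1 2 3 by (simp add: abs_le_iff)
      qed
      also have "\<dots> = e * \<bar>s - t\<bar>" using B by (simp add: e1_def field_simps)
      finally show "norm (\<Phi> s - \<Phi> t - 0 * (s - t)) \<le> e * norm (s - t)" by simp
    qed
  qed
  obtain C where "\<And>t. t \<in> {a..b} \<Longrightarrow> \<Phi> t = C"
    using has_field_derivative_zero_constant[of "{a..b}" \<Phi>, OF _ der0] by auto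
  then have "\<Phi> b - \<Phi> a = 0" using ab by simp
  then show "v (b, x b) - v (a, x a) = (LINT s:{a..b}|lebesgue. D (s, x s) \<bullet> (1, F s))"
    using \<Phi>_diff[of a b] ab by (simp add: k_def E_def)
qed

text \<open>
  Measurability in the parameter of integrals against kernels is first obtained for nonnegative
  integrands, so each coordinate is shifted by the bound \<open>B\<close>.
\<close>

lemma measurable_relaxed_average:
  fixes h :: "'x::euclidean_space \<times> 'b::euclidean_space \<Rightarrow> 'a::euclidean_space"
  assumes x: "x \<in> borel_measurable M" and xX: "\<And>s. s \<in> space M \<Longrightarrow> x s \<in> X"
    and \<omega>: "\<omega> \<in> M \<rightarrow>\<^sub>M prob_algebra (restrict_space borel U)"
    and X: "compact X" and U: "compact U" and h: "continuous_on UNIV h"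
  obtains B where "(\<lambda>s. LINT u|\<omega> s. h (x s, u)) \<in> borel_measurable M"
    "\<And>s. s \<in> space M \<Longrightarrow> norm (LINT u|\<omega> s. h (x s, u)) \<le> B"
    "\<And>s. s \<in> space M \<Longrightarrow> integrable (\<omega> s) (\<lambda>u. h (x s, u))" "0 \<le> B"
proof -
  have hXU: "continuous_on (X \<times> U) h" using h by (rule continuous_on_subset) simp
  obtain B0 where "\<forall>e\<in>h ` (X \<times> U). norm e \<le> B0"
    using compact_imp_bounded[OF compact_continuous_image[OF hXU compact_Times[OF X U]]] unfolding bounded_iff by blast
  then have B0: "norm (h z) \<le> B0" if "z \<in> X \<times> U" for z using that by blast
  define B where "B = \<bar>B0\<bar>"
  have B: "norm (h (x s, u)) \<le> B" if "s \<in> space M" "u \<in> U" for s u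
    using B0[of "(x s, u)"] xX that by (auto simp: B_def)
  have ws: "\<omega> s \<in> space (prob_algebra (restrict_space borel U))" if "s \<in> space M" for s
    using measurable_space[OF \<omega> that] .
  have ps: "prob_space (\<omega> s)" and sp: "space (\<omega> s) = U" if "s \<in> space M" for s
    using ws[OF that] sets_eq_imp_space_eq[of "\<omega> s" "restrict_space borel U"] by (auto simp: space_prob_algebra space_restrict_space)
  have int: "integrable (\<omega> s) (\<lambda>u. h (x s, u))" if "s \<in> space M" for s
    by (rule integrable_continuous_prob_compact[OF ws[OF that] U])
      (rule continuous_on_compose2[OF h], auto intro!: continuous_intros)
  have nb: "norm (LINT u|\<omega> s. h (x s, u)) \<le> B" if s: "s \<in> space M" for s
  proof -
    interpret prob_space "\<omega> s" by (rule ps[OF s])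
    have "norm (LINT u|\<omega> s. h (x s, u)) \<le> (LINT u|\<omega> s. norm (h (x s, u)))" by (rule integral_norm_bound)
    also have "\<dots> \<le> (LINT u|\<omega> s. B)"
      using int[OF s] B[OF s] by (intro integral_mono) (auto simp: sp[OF s])
    finally show ?thesis by (simp add: prob_space)
  qed
  have "(\<lambda>s. (LINT u|\<omega> s. h (x s, u)) \<bullet> i) \<in> borel_measurable M" if i: "i \<in> Basis" for i
  proof -
    have jm: "(\<lambda>(s, u). ennreal (h (x s, u) \<bullet> i + B)) \<in> borel_measurable (M \<Otimes>\<^sub>M restrict_space borel U)"
    proof -
      have [measurable]: "h \<in> borel_measurable borel" by (rule borel_measurable_continuous_onI[OF h])
      have [measurable]: "(\<lambda>p. x (fst p)) \<in> borel_measurable (M \<Otimes>\<^sub>M restrict_space borel U)"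
        using x by measurable
      have "snd \<in> M \<Otimes>\<^sub>M restrict_space borel U \<rightarrow>\<^sub>M restrict_space borel U" by measurable
      then have [measurable]: "snd \<in> borel_measurable (M \<Otimes>\<^sub>M restrict_space (borel :: 'b measure) U)"
        by (simp add: measurable_restrict_space2_iff)
      show ?thesis unfolding case_prod_beta by measurable
    qed
    have nm: "(\<lambda>s. \<integral>\<^sup>+u. ennreal (h (x s, u) \<bullet> i + B) \<partial>\<omega> s) \<in> borel_measurable M"
      by (rule nn_integral_measurable_subprob_algebra2[OF jm measurable_prob_algebraD[OF \<omega>]])
    have "(LINT u|\<omega> s. h (x s, u)) \<bullet> i = enn2real (\<integral>\<^sup>+u. ennreal (h (x s, u) \<bullet> i + B) \<partial>\<omega> s) - B"
      if s: "s \<in> space M" for s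
    proof -
      interpret prob_space "\<omega> s" by (rule ps[OF s])
      have ii: "integrable (\<omega> s) (\<lambda>u. h (x s, u) \<bullet> i)" using int[OF s] by simp
      have "(LINT u|\<omega> s. h (x s, u)) \<bullet> i + B = (LINT u|\<omega> s. h (x s, u) \<bullet> i + B)"
        using int[OF s] ii by (simp add: prob_space)
      also have "\<dots> = enn2real (\<integral>\<^sup>+u. ennreal (h (x s, u) \<bullet> i + B) \<partial>\<omega> s)"
      proof (rule integral_eq_nn_integral)
        show "(\<lambda>u. h (x s, u) \<bullet> i + B) \<in> borel_measurable (\<omega> s)" using ii by measurable
        show "AE u in \<omega> s. 0 \<le> h (x s, u) \<bullet> i + B"
        proof (rule AE_I2)
          fix u assume "u \<in> space (\<omega> s)"
          then show "0 \<le> h (x s, u) \<bullet> i + B"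
            using B[OF s, of u] Basis_le_norm[OF i, of "h (x s, u)"] by (simp add: sp[OF s] abs_le_iff)
        qed
      qed
      finally show ?thesis by simp
    qed
    note eq = this
    have m2: "(\<lambda>s. enn2real (\<integral>\<^sup>+u. ennreal (h (x s, u) \<bullet> i + B) \<partial>\<omega> s) - B) \<in> borel_measurable M"
      by (intro borel_measurable_diff borel_measurable_enn2real nm borel_measurable_const)
    show ?thesis by (rule iffD2[OF measurable_cong m2]) (rule eq)
  qed
  then have "(\<lambda>s. LINT u|\<omega> s. h (x s, u)) \<in> borel_measurable M"
    by (rule iffD2[OF borel_measurable_euclidean_space, OF ballI])
  moreover have "0 \<le> B" by (simp add: B_def)
  ultimately show ?thesis using nb int that by blast
qed

section \<open>Relaxed trajectories and weak duality\<close>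

locale polynomial_control_problem =
  fixes l :: "(real^'n) \<times> (real^'m) \<Rightarrow> real" and lT :: "real^'n \<Rightarrow> real"
    and f :: "(real^'n) \<times> (real^'m) \<Rightarrow> real^'n"
    and X XT :: "(real^'n) set" and U :: "(real^'m) set" and T :: real
  assumes l: "real_polynomial_function l" and lT: "real_polynomial_function lT" and f: "polynomial_function f"
    and X: "compact X" and U: "compact U" and XT: "compact XT" "XT \<subseteq> X"
begin

lemma cont_l: "continuous_on A l" and cont_lT: "continuous_on B lT" and cont_f: "continuous_on C f"
  using l lT f by (simp_all add: real_polynomial_function_eq continuous_on_polymonial_function)

abbreviation "radm \<equiv> relaxed_admissible f X U XT T"

lemma relaxed_average_bounded:
  fixes h :: "(real^'n) \<times> (real^'m) \<Rightarrow> 'a::euclidean_space"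
  assumes r: "radm a xa x \<omega>" and h: "continuous_on UNIV h"
  shows "(\<lambda>s. LINT u|\<omega> s. h (x s, u)) \<in> borel_measurable (lebesgue_on {a..T})"
    "s \<in> {a..T} \<Longrightarrow> integrable (\<omega> s) (\<lambda>u. h (x s, u))"
    "\<exists>B. \<forall>s\<in>{a..T}. norm (LINT u|\<omega> s. h (x s, u)) \<le> B"
proof -
  have sp: "space (lebesgue_on {a..T}) = {a..T}" by (simp add: space_lebesgue_on)
  have r': "x \<in> borel_measurable (lebesgue_on {a..T})"
    "\<omega> \<in> lebesgue_on {a..T} \<rightarrow>\<^sub>M prob_algebra (restrict_space borel U)"
    "\<And>s. s \<in> space (lebesgue_on {a..T}) \<Longrightarrow> x s \<in> X"
    using r unfolding relaxed_admissible_def sp by blast+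
  obtain B where B: "(\<lambda>s. LINT u|\<omega> s. h (x s, u)) \<in> borel_measurable (lebesgue_on {a..T})"
    "\<And>s. s \<in> space (lebesgue_on {a..T}) \<Longrightarrow> norm (LINT u|\<omega> s. h (x s, u)) \<le> B"
    "\<And>s. s \<in> space (lebesgue_on {a..T}) \<Longrightarrow> integrable (\<omega> s) (\<lambda>u. h (x s, u))"
    by (rule measurable_relaxed_average[OF r'(1,3,2) X U h], assumption) (rule that)
  show "(\<lambda>s. LINT u|\<omega> s. h (x s, u)) \<in> borel_measurable (lebesgue_on {a..T})" by (rule B(1))
  show "s \<in> {a..T} \<Longrightarrow> integrable (\<omega> s) (\<lambda>u. h (x s, u))" using B(3) unfolding sp .
  show "\<exists>B. \<forall>s\<in>{a..T}. norm (LINT u|\<omega> s. h (x s, u)) \<le> B" using B(2) unfolding sp by (intro exI ballI)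
qed

lemma relaxed_average_set_integrable:
  fixes h :: "(real^'n) \<times> (real^'m) \<Rightarrow> 'a::euclidean_space"
  assumes r: "radm a xa x \<omega>" and h: "continuous_on UNIV h" and sub: "{c..d} \<subseteq> {a..T}"
  shows "set_integrable lebesgue {c..d} (\<lambda>s. LINT u|\<omega> s. h (x s, u))"
proof -
  obtain B where B: "\<forall>s\<in>{a..T}. norm (LINT u|\<omega> s. h (x s, u)) \<le> B"
    using relaxed_average_bounded(3)[OF r h] by (elim exE)
  show ?thesis
    by (rule set_integrable_lebesgue_bounded_Icc[OF relaxed_average_bounded(1)[OF r h] _ sub]) (rule bspec[OF B])
qed

lemma relaxed_initial:
  assumes r: "radm a xa x \<omega>" and aT: "a \<le> T"
  shows "x a = xa"
proof -
  have "x a = xa + (LINT s:{a..a}|lebesgue. LINT u|\<omega> s. f (x s, u))"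
    using r aT by (auto simp: relaxed_admissible_def)
  moreover have "(LINT s:{a..a}|lebesgue. LINT u|\<omega> s. f (x s, u)) = 0"
    using set_integral_lebesgue_Icc_combine[of a a "\<lambda>s. LINT u|\<omega> s. f (x s, u)" a]
      relaxed_average_set_integrable[OF r cont_f, of a a] aT by simp
  ultimately show ?thesis by simp
qed

lemma relaxed_admissible_tail:
  assumes r: "radm a xa x \<omega>" and c: "c \<in> {a..T}"
  shows "radm c (x c) x \<omega>"
  unfolding relaxed_admissible_def
proof (intro conjI ballI)
  have sub: "{c..T} \<subseteq> {a..T}" using c by auto
  show "x \<in> borel_measurable (lebesgue_on {c..T})"
    using r sub unfolding relaxed_admissible_def by (blast intro: measurable_restrict_mono)
  show "\<omega> \<in> lebesgue_on {c..T} \<rightarrow>\<^sub>M prob_algebra (restrict_space borel U)"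
    using r sub unfolding relaxed_admissible_def by (blast intro: measurable_restrict_mono)
  show "x t \<in> X" if "t \<in> {c..T}" for t using r that c unfolding relaxed_admissible_def by auto
  show "x T \<in> XT" using r unfolding relaxed_admissible_def by auto
  show "x t = x c + (LINT s:{c..t}|lebesgue. LINT u|\<omega> s. f (x s, u))" if t: "t \<in> {c..T}" for t
  proof -
    have "x t = xa + (LINT s:{a..t}|lebesgue. LINT u|\<omega> s. f (x s, u))"
      "x c = xa + (LINT s:{a..c}|lebesgue. LINT u|\<omega> s. f (x s, u))"
      using r t c unfolding relaxed_admissible_def by auto
    moreover have "(LINT s:{a..c}|lebesgue. LINT u|\<omega> s. f (x s, u)) + (LINT s:{c..t}|lebesgue. LINT u|\<omega> s. f (x s, u))
        = (LINT s:{a..t}|lebesgue. LINT u|\<omega> s. f (x s, u))"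
      using t c by (intro set_integral_lebesgue_Icc_combine relaxed_average_set_integrable[OF r cont_f]) auto
    ultimately show ?thesis by (simp add: add.assoc)
  qed
qed

lemma hamiltonian_nonneg:
  assumes v: "dual_admissible l lT f X U XT T t0 v"
  obtains N D where "\<And>t x. t \<in> {t0..T} \<Longrightarrow> x \<in> X \<Longrightarrow> (t, x) \<in> N" "continuous_on N D"
    "\<And>z. z \<in> N \<Longrightarrow> (v has_derivative (\<lambda>h. D z \<bullet> h)) (at z)"
    "\<And>t x u. t \<in> {t0..T} \<Longrightarrow> x \<in> X \<Longrightarrow> u \<in> U \<Longrightarrow> 0 \<le> l (x, u) + D (t, x) \<bullet> (1, f (x, u))"
proof -
  obtain N D where N: "open N" "{t0..T} \<times> X \<subseteq> N" and der: "\<And>z. z \<in> N \<Longrightarrow> (v has_derivative (\<lambda>h. D z \<bullet> h)) (at z)"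
    and D: "continuous_on N D"
    using v unfolding dual_admissible_def C1_near_iff_gradient by blast
  have "0 \<le> l (x, u) + D (t, x) \<bullet> (1, f (x, u))" if "t \<in> {t0..T}" "x \<in> X" "u \<in> U" for t x u
  proof -
    have "(t, x) \<in> N" using N that by auto
    from partial_derivatives_eq_gradient[OF der[OF this]]
    have "deriv (\<lambda>s. v (s, x)) t + grad (\<lambda>y. v (t, y)) x \<bullet> f (x, u) = D (t, x) \<bullet> (1, f (x, u))" .
    moreover have "0 \<le> l (x, u) + deriv (\<lambda>s. v (s, x)) t + grad (\<lambda>y. v (t, y)) x \<bullet> f (x, u)"
      using v that unfolding dual_admissible_def nonneg_continuous_def by auto
    ultimately show ?thesis by linarith
  qed
  with that[of N D] N der D show ?thesis by blast
qed

text \<open>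
  The dual constraint holds for each control value; averaged over the relaxed control it bounds from
  below the derivative of \<open>v\<close> along the trajectory.
\<close>

lemma dual_increment_le_running_cost:
  assumes v: "dual_admissible l lT f X U XT T t0 v" and r: "radm a xa x \<omega>"
    and a: "t0 \<le> a" "a \<le> d" "d \<le> T"
  shows "v (a, x a) \<le> v (d, x d) + (LINT s:{a..d}|lebesgue. LINT u|\<omega> s. l (x s, u))"
proof -
  obtain N D where N: "\<And>t x. t \<in> {t0..T} \<Longrightarrow> x \<in> X \<Longrightarrow> (t, x) \<in> N" "continuous_on N D"
    and der: "\<And>z. z \<in> N \<Longrightarrow> (v has_derivative (\<lambda>h. D z \<bullet> h)) (at z)"
    and ham: "\<And>t x u. t \<in> {t0..T} \<Longrightarrow> x \<in> X \<Longrightarrow> u \<in> U \<Longrightarrow> 0 \<le> l (x, u) + D (t, x) \<bullet> (1, f (x, u))"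
    using hamiltonian_nonneg[OF v] by blast
  have xX: "x s \<in> X" if "s \<in> {a..T}" for s using r that unfolding relaxed_admissible_def by auto
  let ?F = "\<lambda>s. LINT u|\<omega> s. f (x s, u)" and ?l = "\<lambda>s. LINT u|\<omega> s. l (x s, u)"
  note F = relaxed_average_bounded(1)[OF r cont_f]
  obtain B where B: "\<forall>s\<in>{a..T}. norm (?F s) \<le> B"
    using relaxed_average_bounded(3)[OF r cont_f] by (elim exE)
  note fi = relaxed_average_bounded(2)[OF r cont_f] and li = relaxed_average_bounded(2)[OF r cont_l]
  have ad: "{a..d} \<subseteq> {a..T}" using a by auto
  have c1: "set_integrable lebesgue {a..d} (\<lambda>s. D (s, x s) \<bullet> (1, ?F s))"
    and c2: "v (d, x d) - v (a, x a) = (LINT s:{a..d}|lebesgue. D (s, x s) \<bullet> (1, ?F s))"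
  proof -
    have x': "x t = xa + (LINT s:{a..t}|lebesgue. ?F s)" if "t \<in> {a..d}" for t
      using r that ad unfolding relaxed_admissible_def by blast
    have B': "norm (?F s) \<le> B" if "s \<in> {a..d}" for s using B that ad by blast
    have xN: "(s, x s) \<in> N" if "s \<in> {a..d}" for s using that a ad by (intro N(1) xX) auto
    note curve = gradient_along_integral_curve[OF a(2) measurable_restrict_mono[OF F ad] B' x' der[OF xN] N(2) xN]
    show "set_integrable lebesgue {a..d} (\<lambda>s. D (s, x s) \<bullet> (1, ?F s))" by (rule curve(1))
    show "v (d, x d) - v (a, x a) = (LINT s:{a..d}|lebesgue. D (s, x s) \<bullet> (1, ?F s))" by (rule curve(2))
  qed
  have ll: "set_integrable lebesgue {a..d} ?l" by (rule relaxed_average_set_integrable[OF r cont_l ad])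
  have "- (LINT s:{a..d}|lebesgue. ?l s) = (LINT s:{a..d}|lebesgue. - ?l s)"
    by (rule set_integral_uminus[OF ll, symmetric])
  also have "\<dots> \<le> (LINT s:{a..d}|lebesgue. D (s, x s) \<bullet> (1, ?F s))"
  proof (rule set_integral_mono[OF _ c1])
    show "set_integrable lebesgue {a..d} (\<lambda>s. - ?l s)"
      using ll unfolding set_integrable_def by simp
    fix s assume "s \<in> {a..d}"
    then have s: "s \<in> {a..T}" using a by auto
    have "\<omega> s \<in> space (prob_algebra (restrict_space borel U))"
      using r s unfolding relaxed_admissible_def by (auto dest: measurable_space simp: space_lebesgue_on)
    then have "prob_space (\<omega> s)" and sp: "space (\<omega> s) = U"
      using sets_eq_imp_space_eq[of "\<omega> s" "restrict_space borel U"] by (auto simp: space_prob_algebra space_restrict_space)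
    then interpret prob_space "\<omega> s" by simp
    have eq: "D (s, x s) \<bullet> (1, w) = fst (D (s, x s)) + snd (D (s, x s)) \<bullet> w" for w by (simp add: inner_prod_def)
    have i: "integrable (\<omega> s) (\<lambda>u. snd (D (s, x s)) \<bullet> f (x s, u))" using fi[OF s] by simp
    have "0 \<le> (LINT u|\<omega> s. l (x s, u) + (fst (D (s, x s)) + snd (D (s, x s)) \<bullet> f (x s, u)))"
      using ham[of s "x s"] s a xX[OF s] by (intro integral_nonneg_AE AE_I2) (auto simp: sp eq)
    also have "\<dots> = ?l s + D (s, x s) \<bullet> (1, ?F s)"
      using fi[OF s] li[OF s] i by (simp add: eq prob_space)
    finally show "- ?l s \<le> D (s, x s) \<bullet> (1, ?F s)" by simp
  qed
  finally show ?thesis using c2 by linarith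
qed

text \<open>
  Ordinary controls are relaxed controls with values in Dirac measures.
\<close>

lemma admissible_imp_relaxed:
  assumes adm: "admissible f X U XT T a xa x u"
  shows "radm a xa x (\<lambda>s. return (restrict_space borel U) (u s))"
    and "relaxed_cost l lT T a x (\<lambda>s. return (restrict_space borel U) (u s)) = cost l lT T a x u"
    and "\<And>(h :: (real^'n) \<times> (real^'m) \<Rightarrow> 'a::euclidean_space) s. continuous_on UNIV h \<Longrightarrow> s \<in> {a..T} \<Longrightarrow>
      (LINT v|return (restrict_space borel U) (u s). h (x s, v)) = h (x s, u s)"
proof -
  let ?N = "restrict_space (borel :: (real^'m) measure) U"
  have uU: "u s \<in> U" if "s \<in> {a..T}" for s using adm that by (auto simp: admissible_def)
  have dirac: "(LINT v|return ?N (u s). h (x s, v)) = h (x s, u s)" if h: "continuous_on UNIV h" and s: "s \<in> {a..T}"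
    for h :: "(real^'n) \<times> (real^'m) \<Rightarrow> 'b::euclidean_space" and s
  proof (rule integral_return)
    show "u s \<in> space ?N" using uU[OF s] by (simp add: space_restrict_space)
    show "(\<lambda>v. h (x s, v)) \<in> borel_measurable ?N"
      by (intro borel_measurable_continuous_on_restrict continuous_on_compose2[OF h]) (auto intro!: continuous_intros)
  qed
  show "\<And>(h :: (real^'n) \<times> (real^'m) \<Rightarrow> 'a::euclidean_space) s. continuous_on UNIV h \<Longrightarrow> s \<in> {a..T} \<Longrightarrow>
      (LINT v|return ?N (u s). h (x s, v)) = h (x s, u s)" by (rule dirac)
  have eq: "(LINT s:{a..t}|lebesgue. LINT v|return ?N (u s). h (x s, v)) = (LINT s:{a..t}|lebesgue. h (x s, u s))"
    if "continuous_on UNIV h" "t \<le> T" for h :: "(real^'n) \<times> (real^'m) \<Rightarrow> 'b::euclidean_space" and t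
    using dirac[OF that(1)] that(2) by (intro set_lebesgue_integral_cong) auto
  show "radm a xa x (\<lambda>s. return ?N (u s))"
    unfolding relaxed_admissible_def
  proof (intro conjI ballI)
    have "u \<in> lebesgue_on {a..T} \<rightarrow>\<^sub>M ?N"
      using adm uU by (auto simp: admissible_def measurable_restrict_space2_iff space_lebesgue_on)
    then show "(\<lambda>s. return ?N (u s)) \<in> lebesgue_on {a..T} \<rightarrow>\<^sub>M prob_algebra ?N"
      by (rule measurable_compose[OF _ measurable_return_prob_space])
    show "x t = xa + (LINT s:{a..t}|lebesgue. LINT v|return ?N (u s). f (x s, v))" if "t \<in> {a..T}" for t
      using that adm by (subst eq) (auto simp: admissible_def cont_f)
  qed (use adm in \<open>auto simp: admissible_def\<close>)
  show "relaxed_cost l lT T a x (\<lambda>s. return ?N (u s)) = cost l lT T a x u"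
    unfolding relaxed_cost_def cost_def by (subst eq) (auto simp: cont_l)
qed

lemma relaxed_value_le_value: "relaxed_value l lT f X U XT T (a, xa) \<le> value_fun l lT f X U XT T (a, xa)"
  unfolding value_fun_def prod.case
proof (rule INF_greatest, clarify)
  fix x u assume adm: "admissible f X U XT T a xa x u"
  have "relaxed_value l lT f X U XT T (a, xa) \<le> ereal (relaxed_cost l lT T a x (\<lambda>s. return (restrict_space borel U) (u s)))"
    unfolding relaxed_value_def prod.case
    by (rule INF_lower2[of "(x, \<lambda>s. return (restrict_space borel U) (u s))"]) (use admissible_imp_relaxed(1)[OF adm] in auto)
  then show "relaxed_value l lT f X U XT T (a, xa) \<le> ereal (cost l lT T a x u)"
    by (simp add: admissible_imp_relaxed(2)[OF adm])
qed

lemma dual_le_relaxed_cost: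
  assumes v: "dual_admissible l lT f X U XT T t0 v" and r: "radm a xa x \<omega>" and a: "t0 \<le> a" "a \<le> T"
  shows "v (a, xa) \<le> relaxed_cost l lT T a x \<omega>"
proof -
  have "v (T, x T) \<le> lT (x T)"
    using v r unfolding dual_admissible_def nonneg_continuous_def relaxed_admissible_def by auto
  then show ?thesis
    using dual_increment_le_running_cost[OF v r a order_refl] relaxed_initial[OF r a(2)]
    by (simp add: relaxed_cost_def)
qed

lemma dual_le_value:
  assumes v: "dual_admissible l lT f X U XT T t0 v" and a: "t0 \<le> a" "a \<le> T"
  shows "ereal (v (a, xa)) \<le> value_fun l lT f X U XT T (a, xa)"
  unfolding value_fun_def prod.case
proof (rule INF_greatest, clarify)
  fix x u assume adm: "admissible f X U XT T a xa x u"
  from dual_le_relaxed_cost[OF v admissible_imp_relaxed(1)[OF adm] a]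
  show "ereal (v (a, xa)) \<le> ereal (cost l lT T a x u)"
    by (simp add: admissible_imp_relaxed(2)[OF adm])
qed

text \<open>
  The approximation of relaxed pairs concerns integrals only.  Applied to the components of the
  dynamics it also gives convergence of the endpoints, hence of the terminal costs.
\<close>

lemma value_le_relaxed_cost:
  assumes gap: "no_relaxation_gap f X U XT T" and r: "radm a xa x \<omega>" and a: "a \<in> {0..T}" and xa: "xa \<in> X"
  shows "value_fun l lT f X U XT T (a, xa) \<le> ereal (relaxed_cost l lT T a x \<omega>)"
proof -
  obtain xs us where adm: "\<And>k::nat. admissible f X U XT T a xa (xs k) (us k)"
    and lim: "\<And>v :: (real^'n) \<times> (real^'m) \<Rightarrow> real. continuous_on (X \<times> U) v \<Longrightarrow>
             (\<lambda>k. LINT t:{a..T}|lebesgue. v (xs k t, us k t))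
               \<longlonglongrightarrow> (LINT t:{a..T}|lebesgue. (LINT u|\<omega> t. v (x t, u)))"
    using gap r a xa unfolding no_relaxation_gap_def by meson
  have aT: "a \<le> T" using a by simp
  have comp: "y T \<bullet> i = xa \<bullet> i + (LINT s:{a..T}|lebesgue. LINT u|\<omega>' s. f (y s, u) \<bullet> i)"
    if r': "radm a xa y \<omega>'" for y \<omega>' i
  proof -
    have "y T = xa + (LINT s:{a..T}|lebesgue. LINT u|\<omega>' s. f (y s, u))"
      using r' aT by (auto simp: relaxed_admissible_def)
    moreover have "(LINT s:{a..T}|lebesgue. LINT u|\<omega>' s. f (y s, u)) \<bullet> i =
       (LINT s:{a..T}|lebesgue. (LINT u|\<omega>' s. f (y s, u)) \<bullet> i)"
      using relaxed_average_set_integrable[OF r' cont_f order_refl]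
      unfolding set_integrable_def set_lebesgue_integral_def by (simp flip: inner_scaleR_left)
    moreover have "(LINT s:{a..T}|lebesgue. (LINT u|\<omega>' s. f (y s, u)) \<bullet> i) =
       (LINT s:{a..T}|lebesgue. LINT u|\<omega>' s. f (y s, u) \<bullet> i)"
    proof -
      have "integrable (\<omega>' s) (\<lambda>u. f (y s, u))" if "s \<in> {a..T}" for s
        using relaxed_average_bounded(2)[OF r' cont_f that] .
      then show ?thesis by (intro set_lebesgue_integral_cong) auto
    qed
    ultimately show ?thesis by (simp add: inner_add_left)
  qed
  have cfi: "continuous_on A (\<lambda>z. f z \<bullet> i)" for A i by (intro continuous_intros cont_f)
  have endpoint: "(\<lambda>k. xs k T) \<longlonglongrightarrow> x T"
    unfolding tendsto_componentwise_iff[of _ "x T"]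
  proof
    fix i :: "real^'n"
    have "xs k T \<bullet> i = xa \<bullet> i + (LINT s:{a..T}|lebesgue. f (xs k s, us k s) \<bullet> i)" for k
      unfolding comp[OF admissible_imp_relaxed(1)[OF adm], of k i]
      by (intro arg_cong2[of _ _ _ _ "(+)"] refl set_lebesgue_integral_cong ballI allI impI)
        (auto simp: admissible_imp_relaxed(3)[OF adm cfi])
    then show "(\<lambda>k. xs k T \<bullet> i) \<longlonglongrightarrow> x T \<bullet> i"
      unfolding comp[OF r] by (simp only:) (intro tendsto_intros lim cfi)
  qed
  have "isCont lT (x T)" using cont_lT[of UNIV] by (auto simp: continuous_on_eq_continuous_at)
  then have "(\<lambda>k. lT (xs k T)) \<longlonglongrightarrow> lT (x T)" using endpoint by (rule isCont_tendsto_compose)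
  then have "(\<lambda>k. cost l lT T a (xs k) (us k)) \<longlonglongrightarrow> relaxed_cost l lT T a x \<omega>"
    unfolding cost_def relaxed_cost_def by (intro tendsto_intros lim cont_l)
  then have "(\<lambda>k. ereal (cost l lT T a (xs k) (us k))) \<longlonglongrightarrow> ereal (relaxed_cost l lT T a x \<omega>)" by simp
  moreover have "value_fun l lT f X U XT T (a, xa) \<le> ereal (cost l lT T a (xs k) (us k))" for k
    unfolding value_fun_def prod.case by (rule INF_lower2[of "(xs k, us k)"]) (use adm in auto)
  ultimately show ?thesis by (intro LIMSEQ_le_const[where X="\<lambda>k. ereal (cost l lT T a (xs k) (us k))"]) blast+
qed

lemma value_le_relaxed_value:
  assumes gap: "no_relaxation_gap f X U XT T" and a: "a \<in> {0..T}" and xa: "xa \<in> X"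
  shows "value_fun l lT f X U XT T (a, xa) \<le> relaxed_value l lT f X U XT T (a, xa)"
  unfolding relaxed_value_def prod.case
  by (rule INF_greatest) (use value_le_relaxed_cost[OF gap _ a xa] in auto)

end

section \<open>Strong duality\<close>

text \<open>
  Bounds and Lipschitz constants are established together, since the product rule for Lipschitz constants
  needs both.
\<close>

lemma real_polynomial_function_lipschitz_on_bounded:
  fixes p :: "'a::real_normed_vector \<Rightarrow> real"
  assumes p: "real_polynomial_function p" and S: "bounded S"
  shows "\<exists>L B. 0 \<le> L \<and> 0 \<le> B \<and> (\<forall>z\<in>S. \<bar>p z\<bar> \<le> B) \<and> (\<forall>z\<in>S. \<forall>w\<in>S. \<bar>p z - p w\<bar> \<le> L * norm (z - w))"
  using p
proof (induction p rule: real_polynomial_function.induct)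
  case (linear p)
  obtain K where K: "0 \<le> K" "\<And>z. norm (p z) \<le> norm z * K"
    using bounded_linear.nonneg_bounded[OF linear] by blast
  obtain r where r: "\<And>z. z \<in> S \<Longrightarrow> norm z \<le> r" using S unfolding bounded_iff by blast
  have "\<bar>p z\<bar> \<le> \<bar>r\<bar> * K" if "z \<in> S" for z
    using K(2)[of z] mult_right_mono[OF order_trans[OF r[OF that] abs_ge_self] K(1)] by simp
  moreover have "\<bar>p z - p w\<bar> \<le> K * norm (z - w)" for z w
    using K(2)[of "z - w"] by (simp add: linear_diff[OF bounded_linear.linear[OF linear]] mult.commute)
  ultimately show ?case using K(1) by (intro exI[of _ K] exI[of _ "\<bar>r\<bar> * K"]) auto
next
  case (const c)
  show ?case by (intro exI[of _ 0] exI[of _ "\<bar>c\<bar>"]) auto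
next
  case (add p q)
  then obtain L1 B1 L2 B2 where
    1: "0 \<le> L1" "0 \<le> B1" "\<And>z. z \<in> S \<Longrightarrow> \<bar>p z\<bar> \<le> B1" "\<And>z w. z \<in> S \<Longrightarrow> w \<in> S \<Longrightarrow> \<bar>p z - p w\<bar> \<le> L1 * norm (z - w)" and
    2: "0 \<le> L2" "0 \<le> B2" "\<And>z. z \<in> S \<Longrightarrow> \<bar>q z\<bar> \<le> B2" "\<And>z w. z \<in> S \<Longrightarrow> w \<in> S \<Longrightarrow> \<bar>q z - q w\<bar> \<le> L2 * norm (z - w)"
    by metis
  have "\<bar>p z + q z\<bar> \<le> B1 + B2" if "z \<in> S" for z using 1(3)[OF that] 2(3)[OF that] by linarith
  moreover have "\<bar>(p z + q z) - (p w + q w)\<bar> \<le> (L1 + L2) * norm (z - w)" if "z \<in> S" "w \<in> S" for z w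
    using 1(4)[OF that] 2(4)[OF that] unfolding distrib_right by linarith
  ultimately show ?case using 1(1,2) 2(1,2) by (intro exI[of _ "L1 + L2"] exI[of _ "B1 + B2"]) auto
next
  case (mult p q)
  then obtain L1 B1 L2 B2 where
    1: "0 \<le> L1" "0 \<le> B1" "\<And>z. z \<in> S \<Longrightarrow> \<bar>p z\<bar> \<le> B1" "\<And>z w. z \<in> S \<Longrightarrow> w \<in> S \<Longrightarrow> \<bar>p z - p w\<bar> \<le> L1 * norm (z - w)" and
    2: "0 \<le> L2" "0 \<le> B2" "\<And>z. z \<in> S \<Longrightarrow> \<bar>q z\<bar> \<le> B2" "\<And>z w. z \<in> S \<Longrightarrow> w \<in> S \<Longrightarrow> \<bar>q z - q w\<bar> \<le> L2 * norm (z - w)"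
    by metis
  have "\<bar>p z * q z\<bar> \<le> B1 * B2" if "z \<in> S" for z
    unfolding abs_mult using 1(2) 1(3)[OF that] 2(3)[OF that] by (intro mult_mono) auto
  moreover have "\<bar>p z * q z - p w * q w\<bar> \<le> (B1 * L2 + L1 * B2) * norm (z - w)" if zw: "z \<in> S" "w \<in> S" for z w
  proof -
    have "p z * q z - p w * q w = p z * (q z - q w) + (p z - p w) * q w" by (simp add: algebra_simps)
    also have "\<bar>\<dots>\<bar> \<le> \<bar>p z\<bar> * \<bar>q z - q w\<bar> + \<bar>p z - p w\<bar> * \<bar>q w\<bar>"
      using abs_triangle_ineq[of "p z * (q z - q w)" "(p z - p w) * q w"] by (simp only: abs_mult)
    also have "\<dots> \<le> B1 * (L2 * norm (z - w)) + (L1 * norm (z - w)) * B2"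
      using 1(1,2) 1(3)[OF zw(1)] 1(4)[OF zw] 2(3)[OF zw(2)] 2(4)[OF zw] by (intro add_mono mult_mono) auto
    finally show ?thesis by (simp add: algebra_simps)
  qed
  ultimately show ?case using 1(1,2) 2(1,2)
    by (intro exI[of _ "B1 * L2 + L1 * B2"] exI[of _ "B1 * B2"]) auto
qed

lemma polynomial_function_lipschitz_on_bounded:
  fixes p :: "'a::real_normed_vector \<Rightarrow> 'b::euclidean_space"
  assumes p: "polynomial_function p" and S: "bounded S"
  shows "\<exists>L B. 0 \<le> L \<and> 0 \<le> B \<and> (\<forall>z\<in>S. norm (p z) \<le> B) \<and> (\<forall>z\<in>S. \<forall>w\<in>S. norm (p z - p w) \<le> L * norm (z - w))"
proof -
  have "\<forall>i\<in>Basis. \<exists>L B. 0 \<le> L \<and> 0 \<le> B \<and> (\<forall>z\<in>S. \<bar>p z \<bullet> i\<bar> \<le> B) \<and> (\<forall>z\<in>S. \<forall>w\<in>S. \<bar>p z \<bullet> i - p w \<bullet> i\<bar> \<le> L * norm (z - w))"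
    by (intro ballI real_polynomial_function_lipschitz_on_bounded S)
      (rule bspec[OF iffD1[OF polynomial_function_iff_Basis_inner p]])
  then obtain L B where LB: "\<And>i. i \<in> Basis \<Longrightarrow> 0 \<le> L i" "\<And>i. i \<in> Basis \<Longrightarrow> 0 \<le> B i"
    "\<And>i z. i \<in> Basis \<Longrightarrow> z \<in> S \<Longrightarrow> \<bar>p z \<bullet> i\<bar> \<le> B i"
    "\<And>i z w. i \<in> Basis \<Longrightarrow> z \<in> S \<Longrightarrow> w \<in> S \<Longrightarrow> \<bar>p z \<bullet> i - p w \<bullet> i\<bar> \<le> L i * norm (z - w)"
    by metis
  have "norm (p z) \<le> sum B Basis" if "z \<in> S" for z
    using order_trans[OF norm_le_l1[of "p z"] sum_mono[of Basis "\<lambda>i. \<bar>p z \<bullet> i\<bar>" B]] LB(3)[OF _ that] by blast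
  moreover have "norm (p z - p w) \<le> sum L Basis * norm (z - w)" if "z \<in> S" "w \<in> S" for z w
  proof -
    have "norm (p z - p w) \<le> (\<Sum>i\<in>Basis. \<bar>(p z - p w) \<bullet> i\<bar>)" by (rule norm_le_l1)
    also have "\<dots> \<le> (\<Sum>i\<in>Basis. L i * norm (z - w))"
      using LB(4)[OF _ that] by (intro sum_mono) (simp add: inner_diff_left)
    finally show ?thesis by (simp add: sum_distrib_right)
  qed
  ultimately show ?thesis using LB(1,2) by (intro exI[of _ "sum L Basis"] exI[of _ "sum B Basis"]) (auto simp: sum_nonneg)
qed

text \<open>
  The penalty.  Clipping keeps the penalized data bounded on the whole space.
\<close>

definition clipped_dist :: "'a::metric_space set \<Rightarrow> 'a \<Rightarrow> real" where
  "clipped_dist S z = min 1 (infdist z S)"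

lemma clipped_dist_bounds: "0 \<le> clipped_dist S z" "clipped_dist S z \<le> 1"
  by (auto simp: clipped_dist_def infdist_nonneg)

lemma clipped_dist_lipschitz: "\<bar>clipped_dist S z - clipped_dist S w\<bar> \<le> dist z w"
  using infdist_triangle[of z S w] infdist_triangle[of w S z]
  by (auto simp: clipped_dist_def dist_commute)

lemma clipped_dist_eq_0_iff: "closed S \<Longrightarrow> S \<noteq> {} \<Longrightarrow> clipped_dist S z = 0 \<longleftrightarrow> z \<in> S"
  using in_closed_iff_infdist_zero[of S z] by (auto simp: clipped_dist_def min_def)

lemma continuous_clipped_dist: "continuous_on A (clipped_dist S)"
  unfolding clipped_dist_def by (intro continuous_intros)

context polynomial_control_problem begin

lemma smooth_function_dual_admissible:
  assumes der: "\<And>z. (v has_derivative (\<lambda>h. D z \<bullet> h)) (at z)" and D: "continuous_on UNIV D"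
    and ham: "\<And>t x u. t \<in> {t0..T} \<Longrightarrow> x \<in> X \<Longrightarrow> u \<in> U \<Longrightarrow> 0 \<le> l (x, u) + D (t, x) \<bullet> (1, f (x, u))"
    and terminal: "\<And>x. x \<in> XT \<Longrightarrow> v (T, x) \<le> lT x"
  shows "dual_admissible l lT f X U XT T t0 v"
  unfolding dual_admissible_def
proof (intro conjI)
  show "v \<in> C1_near ({t0..T} \<times> X)"
    unfolding C1_near_iff_gradient using der D by (intro exI[of _ UNIV] exI[of _ D]) auto
  have eq: "(\<lambda>(t, x, u). l (x, u) + deriv (\<lambda>s. v (s, x)) t + grad (\<lambda>y. v (t, y)) x \<bullet> f (x, u)) =
      (\<lambda>z. l (snd z) + D (fst z, fst (snd z)) \<bullet> (1, f (snd z)))"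
    using partial_derivatives_eq_gradient[OF der] by (auto simp: fun_eq_iff add.assoc)
  have "continuous_on A (\<lambda>z :: real \<times> (real^'n) \<times> (real^'m). l (snd z) + D (fst z, fst (snd z)) \<bullet> (1, f (snd z)))" for A
    by (intro continuous_intros continuous_on_compose2[OF cont_l[of UNIV]] continuous_on_compose2[OF cont_f[of UNIV]]
        continuous_on_compose2[OF D]) auto
  then show "(\<lambda>(t, x, u). l (x, u) + deriv (\<lambda>s. v (s, x)) t + grad (\<lambda>y. v (t, y)) x \<bullet> f (x, u))
       \<in> nonneg_continuous ({t0..T} \<times> X \<times> U)"
    unfolding eq nonneg_continuous_def using ham by auto
  have vc: "continuous_on UNIV v"
    by (intro continuous_at_imp_continuous_on ballI has_derivative_continuous[OF der])
  show "(\<lambda>x. lT x - v (T, x)) \<in> nonneg_continuous XT"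
    unfolding nonneg_continuous_def using terminal
    by (auto intro!: continuous_intros cont_lT continuous_on_compose2[OF vc])
qed

text \<open>
  Suppose that \<open>r1 < r2\<close> lie strictly between the two values.  For each penalty weight \<open>K n\<close> the smooth
  subsolutions are admissible for the dual program, so the discrete penalized values stay below \<open>r2\<close>.
  The corresponding Euler polygons converge to a relaxed trajectory of cost at most \<open>r2\<close>.
\<close>

lemma relaxed_value_le_dual_value:
  assumes t0T: "t0 \<le> T" and x0: "x0 \<in> X" and ne: "U \<noteq> {}" "XT \<noteq> {}"
  shows "relaxed_value l lT f X U XT T (t0, x0) \<le> dual_value l lT f X U XT T (t0, x0)"
proof (rule ccontr)
  assume "\<not> ?thesis"
  then have "dual_value l lT f X U XT T (t0, x0) < relaxed_value l lT f X U XT T (t0, x0)" by (simp only: not_le)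
  from ereal_dense2[OF this] obtain r1 where
    r1: "dual_value l lT f X U XT T (t0, x0) < ereal r1" "ereal r1 < relaxed_value l lT f X U XT T (t0, x0)"
    by (elim exE conjE)
  from ereal_dense2[OF r1(2)] obtain r2 where
    r2: "ereal r1 < ereal r2" "ereal r2 < relaxed_value l lT f X U XT T (t0, x0)"
    by (elim exE conjE)
  define \<epsilon>0 where "\<epsilon>0 = r2 - r1"
  have \<epsilon>0: "0 < \<epsilon>0" using r2 by (simp add: \<epsilon>0_def)
  obtain R where R: "0 < R" "X \<subseteq> ball 0 R" using bounded_subset_ballD[OF compact_imp_bounded[OF X], of 0] by (elim exE conjE)
  \<comment> \<open>Composition with the projection onto a ball makes the polynomial data bounded and globally Lipschitz
    without changing them on \<open>X\<close>.\<close>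
  define \<pi> where "\<pi> = closest_point (cball (0 :: real^'n) R)"
  have cb: "convex (cball (0 :: real^'n) R)" "closed (cball (0 :: real^'n) R)" "cball (0 :: real^'n) R \<noteq> {}" using R by auto
  have \<pi>_in: "\<pi> z \<in> cball 0 R" for z unfolding \<pi>_def by (rule closest_point_in_set[OF cb(2,3)])
  have \<pi>_id: "\<pi> z = z" if "z \<in> X" for z unfolding \<pi>_def by (rule closest_point_self) (use R that in auto)
  have \<pi>_lip: "norm (\<pi> z - \<pi> w) \<le> norm (z - w)" for z w
    using closest_point_lipschitz[OF cb, of z w] by (simp add: \<pi>_def dist_norm)
  have \<pi>_cont: "continuous_on UNIV \<pi>" unfolding \<pi>_def by (rule continuous_on_closest_point[OF cb])
  let ?S = "cball (0 :: real^'n) R \<times> U"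
  have S: "bounded ?S" by (intro bounded_Times bounded_cball compact_imp_bounded U)
  obtain Lf Bf where "0 \<le> Lf \<and> 0 \<le> Bf \<and> (\<forall>z\<in>?S. norm (f z) \<le> Bf) \<and> (\<forall>z\<in>?S. \<forall>w\<in>?S. norm (f z - f w) \<le> Lf * norm (z - w))"
    using polynomial_function_lipschitz_on_bounded[OF f S] by (elim exE)
  then have f': "0 \<le> Lf" "0 \<le> Bf" "\<And>z. z \<in> ?S \<Longrightarrow> norm (f z) \<le> Bf"
    "\<And>z w. z \<in> ?S \<Longrightarrow> w \<in> ?S \<Longrightarrow> norm (f z - f w) \<le> Lf * norm (z - w)" by blast+
  obtain Ll Bl where "0 \<le> Ll \<and> 0 \<le> Bl \<and> (\<forall>z\<in>?S. \<bar>l z\<bar> \<le> Bl) \<and> (\<forall>z\<in>?S. \<forall>w\<in>?S. \<bar>l z - l w\<bar> \<le> Ll * norm (z - w))"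
    using real_polynomial_function_lipschitz_on_bounded[OF l S] by (elim exE)
  then have l': "0 \<le> Ll" "0 \<le> Bl" "\<And>z. z \<in> ?S \<Longrightarrow> \<bar>l z\<bar> \<le> Bl"
    "\<And>z w. z \<in> ?S \<Longrightarrow> w \<in> ?S \<Longrightarrow> \<bar>l z - l w\<bar> \<le> Ll * norm (z - w)" by blast+
  let ?C = "cball (0 :: real^'n) R"
  obtain Lt Bt where "0 \<le> Lt \<and> 0 \<le> Bt \<and> (\<forall>z\<in>?C. \<bar>lT z\<bar> \<le> Bt) \<and> (\<forall>z\<in>?C. \<forall>w\<in>?C. \<bar>lT z - lT w\<bar> \<le> Lt * norm (z - w))"
    using real_polynomial_function_lipschitz_on_bounded[OF lT bounded_cball[of 0 R]] by (elim exE)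
  then have t': "0 \<le> Lt" "0 \<le> Bt" "\<And>z. z \<in> ?C \<Longrightarrow> \<bar>lT z\<bar> \<le> Bt"
    "\<And>z w. z \<in> ?C \<Longrightarrow> w \<in> ?C \<Longrightarrow> \<bar>lT z - lT w\<bar> \<le> Lt * norm (z - w)" by blast+
  define L where "L = Lf + Ll + Lt"
  define B where "B = Bf + Bl + Bt"
  have L: "0 \<le> L" using f' l' t' by (simp add: L_def)
  define F where "F = (\<lambda>z u. f (\<pi> z, u))"
  define c where "c = (\<lambda>z u. l (\<pi> z, u))"
  define \<phi> where "\<phi> = (\<lambda>z. lT (\<pi> z))"
  have lip: "k * norm (\<pi> z - \<pi> w) \<le> L * norm (z - w)" if "0 \<le> k" "k \<le> L" for k z w
    using mult_mono[OF that(2) \<pi>_lip L norm_ge_zero] .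
  have F_bd: "norm (F z u) \<le> B" and F_lip: "norm (F z u - F w u) \<le> L * norm (z - w)" if "u \<in> U" for z w u
  proof -
    show "norm (F z u) \<le> B" using f'(3)[of "(\<pi> z, u)"] \<pi>_in[of z] that l'(2) t'(2) by (simp add: F_def B_def)
    have "norm (F z u - F w u) \<le> Lf * norm (\<pi> z - \<pi> w)"
      using f'(4)[of "(\<pi> z, u)" "(\<pi> w, u)"] \<pi>_in[of z] \<pi>_in[of w] that by (simp add: F_def norm_Pair)
    also have "\<dots> \<le> L * norm (z - w)" by (rule lip) (use f'(1) l'(1) t'(1) in \<open>auto simp: L_def\<close>)
    finally show "norm (F z u - F w u) \<le> L * norm (z - w)" .
  qed
  have c_bd: "\<bar>c z u\<bar> \<le> B" and c_lip: "\<bar>c z u - c w u\<bar> \<le> L * norm (z - w)" if "u \<in> U" for z w u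
  proof -
    show "\<bar>c z u\<bar> \<le> B" using l'(3)[of "(\<pi> z, u)"] \<pi>_in[of z] that f'(2) t'(2) by (simp add: c_def B_def)
    have "\<bar>c z u - c w u\<bar> \<le> Ll * norm (\<pi> z - \<pi> w)"
      using l'(4)[of "(\<pi> z, u)" "(\<pi> w, u)"] \<pi>_in[of z] \<pi>_in[of w] that by (simp add: c_def norm_Pair)
    also have "\<dots> \<le> L * norm (z - w)" by (rule lip) (use f'(1) l'(1) t'(1) in \<open>auto simp: L_def\<close>)
    finally show "\<bar>c z u - c w u\<bar> \<le> L * norm (z - w)" .
  qed
  have \<phi>_bd: "\<bar>\<phi> z\<bar> \<le> B" and \<phi>_lip: "\<bar>\<phi> z - \<phi> w\<bar> \<le> L * norm (z - w)" for z w
  proof -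
    show "\<bar>\<phi> z\<bar> \<le> B" using t'(3)[OF \<pi>_in[of z]] f'(2) l'(2) by (simp add: \<phi>_def B_def)
    have "\<bar>\<phi> z - \<phi> w\<bar> \<le> Lt * norm (\<pi> z - \<pi> w)"
      unfolding \<phi>_def by (rule t'(4)[OF \<pi>_in \<pi>_in])
    also have "\<dots> \<le> L * norm (z - w)" by (rule lip) (use f'(1) l'(1) t'(1) in \<open>auto simp: L_def\<close>)
    finally show "\<bar>\<phi> z - \<phi> w\<bar> \<le> L * norm (z - w)" .
  qed
  have XTc: "closed XT" and Xc: "closed X" and Xne: "X \<noteq> {}" using X XT x0 by (auto simp: compact_imp_closed)
  define K where "K = (\<lambda>n. real n + 1)"
  \<comment> \<open>\<open>cheap n \<tau> N w\<close>: the Euler polygon with step \<open>\<tau>\<close> and controls \<open>w\<close> has penalized cost below \<open>r2\<close> after \<open>N\<close>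
    steps, which just cover the time interval.\<close>
  define cheap where "cheap = (\<lambda>n \<tau> N w. 0 < \<tau> \<and> \<tau> < 1 / K n \<and> T - t0 \<le> real N * \<tau> \<and> real N * \<tau> \<le> T - t0 + \<tau> \<and> (\<forall>i. w i \<in> U) \<and>
      \<tau> * (\<Sum>i<N. c (euler F \<tau> x0 w i) (w i) + K n * clipped_dist X (euler F \<tau> x0 w i))
        + (\<phi> (euler F \<tau> x0 w N) + K n * clipped_dist XT (euler F \<tau> x0 w N)) < r2)"
  have penalty: "\<exists>\<tau> N w. cheap n \<tau> N w" for n
  proof -
    define c' where "c' = (\<lambda>z u. c z u + K n * clipped_dist X z)"
    define \<phi>' where "\<phi>' = (\<lambda>z. \<phi> z + K n * clipped_dist XT z)"
    have K: "0 < K n" by (simp add: K_def)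
    have kd: "\<bar>K n * clipped_dist A z\<bar> \<le> K n" "\<bar>K n * clipped_dist A z - K n * clipped_dist A w\<bar> \<le> K n * norm (z - w)"
      for A and z w :: "real^'n"
    proof -
      show "\<bar>K n * clipped_dist A z\<bar> \<le> K n"
        using clipped_dist_bounds[of A z] K by (simp add: abs_mult)
      show "\<bar>K n * clipped_dist A z - K n * clipped_dist A w\<bar> \<le> K n * norm (z - w)"
        using clipped_dist_lipschitz[of A z w] K by (simp add: right_diff_distrib[symmetric] abs_mult dist_norm)
    qed
    interpret unconstrained_problem F c' \<phi>' U "B + K n" "L + K n"
    proof
      show "norm (F x u) \<le> B + K n" if "u \<in> U" for u x using F_bd[OF that, of x] K by linarith
      show "\<bar>c' x u\<bar> \<le> B + K n" if "u \<in> U" for u x using c_bd[OF that, of x] kd(1)[of X x] unfolding c'_def by linarith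
      show "\<bar>\<phi>' x\<bar> \<le> B + K n" for x using \<phi>_bd[of x] kd(1)[of XT x] unfolding \<phi>'_def by linarith
      show "norm (F x u - F y u) \<le> (L + K n) * norm (x - y)" if "u \<in> U" for u x y
        using F_lip[OF that, of x y] K mult_right_mono[of L "L + K n" "norm (x - y)"] by simp
      show "\<bar>c' x u - c' y u\<bar> \<le> (L + K n) * norm (x - y)" if "u \<in> U" for u x y
        using c_lip[OF that, of x y] kd(2)[of X x y] unfolding c'_def distrib_right by linarith
      show "\<bar>\<phi>' x - \<phi>' y\<bar> \<le> (L + K n) * norm (x - y)" for x y
        using \<phi>_lip[of x y] kd(2)[of XT x y] unfolding \<phi>'_def distrib_right by linarith
    qed (use ne L K in auto)
    have "0 < min \<epsilon>0 (1 / K n)" using \<epsilon>0 K by simp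
    from smooth_subsolution_near_V[OF t0T this, of x0] obtain \<tau> N v D where
      \<tau>: "0 < \<tau>" "\<tau> < min \<epsilon>0 (1 / K n)" and N: "T - t0 \<le> real N * \<tau>" "real N * \<tau> \<le> T - t0 + \<tau>"
      and v: "\<And>z. (v has_derivative (\<lambda>h. D z \<bullet> h)) (at z)" "continuous_on UNIV D"
      and ham: "\<And>t x u. t \<in> {t0..T} \<Longrightarrow> u \<in> U \<Longrightarrow> 0 \<le> c' x u + D (t, x) \<bullet> (1, F x u)"
      and ter: "\<And>x. v (T, x) \<le> \<phi>' x"
      and near: "V \<tau> N x0 - min \<epsilon>0 (1 / K n) \<le> v (t0, x0)" by blast
    have "dual_admissible l lT f X U XT T t0 v"
    proof (rule smooth_function_dual_admissible[OF v])
      show "0 \<le> l (x, u) + D (t, x) \<bullet> (1, f (x, u))" if "t \<in> {t0..T}" "x \<in> X" "u \<in> U" for t x u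
        using ham[OF that(1,3), of x] clipped_dist_eq_0_iff[OF Xc Xne, of x] that(2)
        by (simp add: c'_def c_def F_def \<pi>_id)
      show "v (T, x) \<le> lT x" if "x \<in> XT" for x
        using ter[of x] clipped_dist_eq_0_iff[OF XTc ne(2), of x] that XT(2)
        by (simp add: \<phi>'_def \<phi>_def \<pi>_id subsetD)
    qed
    then have "ereal (v (t0, x0)) \<le> dual_value l lT f X U XT T (t0, x0)"
      unfolding dual_value_def prod.case by (intro SUP_upper2[of v]) auto
    then have "v (t0, x0) < r1" using r1(1) by (metis less_ereal.simps(1) order_le_less_trans)
    then have "V \<tau> N x0 < r2" using near unfolding \<epsilon>0_def by linarith
    from V_less_imp_euler[OF \<tau>(1) this] obtain w where "\<And>i. w i \<in> U"
      "\<tau> * (\<Sum>i<N. c' (euler F \<tau> x0 w i) (w i)) + \<phi>' (euler F \<tau> x0 w N) < r2" by blast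
    then show ?thesis using \<tau> N unfolding c'_def \<phi>'_def cheap_def by (intro exI[of _ \<tau>] exI[of _ N] exI[of _ w]) simp
  qed
  obtain \<tau> N w where cheap: "\<And>n. cheap n (\<tau> n) (N n) (w n)" using penalty by metis
  have \<tau>: "\<And>n. 0 < \<tau> n" "\<And>n. \<tau> n < 1 / K n"
    and N: "\<And>n. T - t0 \<le> real (N n) * \<tau> n" "\<And>n. real (N n) * \<tau> n \<le> T - t0 + \<tau> n"
    and w: "\<And>n i. w n i \<in> U"
    and cost: "\<And>n. \<tau> n * (\<Sum>i<N n. c (euler F (\<tau> n) x0 (w n) i) (w n i) + K n * clipped_dist X (euler F (\<tau> n) x0 (w n) i))
        + (\<phi> (euler F (\<tau> n) x0 (w n) (N n)) + K n * clipped_dist XT (euler F (\<tau> n) x0 (w n) (N n))) < r2"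
    using cheap unfolding cheap_def by blast+
  have Kinv: "(\<lambda>n. 1 / K n) \<longlonglongrightarrow> 0" using LIMSEQ_inverse_real_of_nat by (simp add: K_def inverse_eq_divide add.commute)
  have \<tau>0: "\<tau> \<longlonglongrightarrow> 0"
    by (rule Lim_null_comparison[OF _ Kinv]) (use \<tau> in \<open>auto intro!: always_eventually less_imp_le simp: abs_of_pos\<close>)
  have N0: "(\<lambda>n. real (N n) * \<tau> n) \<longlonglongrightarrow> T - t0"
  proof (rule tendsto_sandwich[OF _ _ tendsto_const])
    show "(\<lambda>n. T - t0 + \<tau> n) \<longlonglongrightarrow> T - t0" using tendsto_add[OF tendsto_const \<tau>0, of "T - t0"] by simp
  qed (use N in auto)
  have cF: "continuous_on A (F z)" and cc: "continuous_on A (c z)" for A z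
    unfolding F_def c_def
    by (auto intro!: continuous_on_compose2[OF cont_f[of UNIV]] continuous_on_compose2[OF cont_l[of UNIV]] continuous_intros)
  \<comment> \<open>State and cost together have dimension one more than the state, and Caratheodory's theorem needs one
    more point than that; \<open>'n option option\<close> is an index type of this size.\<close>
  have card: "DIM(real^'n) + 2 \<le> CARD('n option option)" by (simp add: card_UNIV_option)
  obtain r x \<omega> where r: "strict_mono (r :: nat \<Rightarrow> nat)" and xc: "continuous_on UNIV x"
    and \<omega>: "\<omega> \<in> borel \<rightarrow>\<^sub>M prob_algebra (restrict_space borel U)"
    and ode: "\<And>t. t \<in> {t0..T} \<Longrightarrow> x t = x0 + (LINT s:{t0..t}|lborel. LINT u|\<omega> s. F (x s) u)"
    and climit: "(\<lambda>n. \<tau> (r n) * (\<Sum>i<N (r n). c (euler F (\<tau> (r n)) x0 (w (r n)) i) (w (r n) i)))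
       \<longlonglongrightarrow> (LINT s:{t0..T}|lborel. LINT u|\<omega> s. c (x s) u)"
    and xlim: "\<And>t. t \<in> {t0..T} \<Longrightarrow> (\<lambda>n. euler F (\<tau> (r n)) x0 (w (r n)) (cell t0 (\<tau> (r n)) t)) \<longlonglongrightarrow> x t"
    and xTlim: "(\<lambda>n. euler F (\<tau> (r n)) x0 (w (r n)) (N (r n))) \<longlonglongrightarrow> x T"
    by (rule euler_relaxed_limit[where F=F and c=c and U=U and B=B and L=L and ?t0.0=t0 and T=T and \<tau>=\<tau> and v=w and N=N
          and ?x0.0=x0 and 'k="'n option option"])
      (assumption | rule card U ne(1) cF cc F_bd c_bd F_lip c_lip L t0T \<tau>(1) \<tau>0 w N0 that)+
  define e where "e = (\<lambda>n. euler F (\<tau> (r n)) x0 (w (r n)))"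
  define dX where "dX = (\<lambda>n. \<tau> (r n) * (\<Sum>i<N (r n). clipped_dist X (e n i)))"
  define dT where "dT = (\<lambda>n. clipped_dist XT (e n (N (r n))))"
  define cs where "cs = (\<lambda>n. \<tau> (r n) * (\<Sum>i<N (r n). c (e n i) (w (r n) i)) + \<phi> (e n (N (r n))))"
  have total: "cs n + K (r n) * (dX n + dT n) < r2" for n
    using cost[of "r n"] unfolding cs_def dX_def dT_def e_def
    by (simp add: sum.distrib algebra_simps sum_distrib_left)
  have d0: "0 \<le> dX n" "0 \<le> dT n" for n
    using \<tau>(1)[of "r n"] by (auto simp: dX_def dT_def clipped_dist_bounds intro!: mult_nonneg_nonneg sum_nonneg)
  have \<phi>c: "continuous_on UNIV \<phi>" unfolding \<phi>_def by (rule continuous_on_compose2[OF cont_lT[of UNIV] \<pi>_cont]) simp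
  have "(\<lambda>n. \<phi> (e n (N (r n)))) \<longlonglongrightarrow> \<phi> (x T)"
    unfolding e_def by (rule isCont_tendsto_compose[OF _ xTlim]) (use \<phi>c in \<open>auto simp: continuous_on_eq_continuous_at\<close>)
  then have cslim: "cs \<longlonglongrightarrow> (LINT s:{t0..T}|lborel. LINT u|\<omega> s. c (x s) u) + \<phi> (x T)"
    unfolding cs_def e_def by (intro tendsto_add climit)
  have cs_le: "cs n \<le> r2" for n
  proof -
    have "0 \<le> K (r n) * (dX n + dT n)" using d0[of n] by (intro mult_nonneg_nonneg) (auto simp: K_def)
    then show ?thesis using total[of n] by linarith
  qed
  obtain M where M: "\<And>n. \<bar>cs n\<bar> \<le> M"
    using convergent_imp_Bseq[OF convergentI[OF cslim]] by (auto simp: Bseq_def)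
  have Kr: "(\<lambda>n. 1 / K (r n)) \<longlonglongrightarrow> 0" using LIMSEQ_subseq_LIMSEQ[OF Kinv r] by (simp add: o_def)
  \<comment> \<open>The unpenalized costs are bounded, so the penalties are at most a constant divided by their weight.\<close>
  have dsum: "dX n + dT n \<le> (\<bar>r2\<bar> + M) * (1 / K (r n))" for n
  proof -
    have "0 < K (r n)" by (simp add: K_def)
    moreover have "K (r n) * (dX n + dT n) \<le> \<bar>r2\<bar> + M" using total[of n] M[of n] by linarith
    ultimately show ?thesis by (simp add: field_simps)
  qed
  have lim0: "(\<lambda>n. (\<bar>r2\<bar> + M) * (1 / K (r n))) \<longlonglongrightarrow> 0" by (rule tendsto_mult_right_zero[OF Kr])
  have dXlim: "dX \<longlonglongrightarrow> 0" and dTlim: "dT \<longlonglongrightarrow> 0"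
    using dsum d0 by (auto intro!: Lim_null_comparison[OF _ lim0] always_eventually intro: order_trans[OF _ dsum])
  have xT: "x T \<in> XT"
  proof -
    have "dT \<longlonglongrightarrow> clipped_dist XT (x T)"
      unfolding dT_def e_def
      by (rule isCont_tendsto_compose[OF _ xTlim]) (use continuous_clipped_dist[of UNIV XT] in \<open>auto simp: continuous_on_eq_continuous_at\<close>)
    then have "clipped_dist XT (x T) = 0" using dTlim LIMSEQ_unique by blast
    then show ?thesis using clipped_dist_eq_0_iff[OF XTc ne(2)] by simp
  qed
  have xX: "x t \<in> X" if t: "t \<in> {t0..T}" for t
  proof (cases "t0 = T")
    case True
    then show ?thesis using t xT XT(2) by auto
  next
    case False
    let ?g = "\<lambda>n s. clipped_dist X (e n (cell t0 (\<tau> (r n)) s))"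
    have gm: "?g n \<in> borel_measurable borel" for n by (rule measurable_cell)
    have gb: "norm (?g n s) \<le> 1" for n s
      using clipped_dist_bounds[of X "e n (cell t0 (\<tau> (r n)) s)"] by simp
    have gi: "set_integrable lborel {a..b} (?g n)" for n a b by (rule set_integrable_bounded_Icc[OF gm gb])
    have le: "(LINT s:{t0..T}|lborel. ?g n s) \<le> dX n" for n
    proof -
      have T': "T \<le> t0 + real (N (r n)) * \<tau> (r n)" using N(1)[of "r n"] by linarith
      have "(LINT s:{t0..t0 + real (N (r n)) * \<tau> (r n)}|lborel. ?g n s) = dX n"
        unfolding dX_def by (subst integral_step_function[OF \<tau>(1), of "\<lambda>i. clipped_dist X (e n i)" 1]) (auto simp: clipped_dist_bounds)
      moreover have "0 \<le> (LINT s:{T..t0 + real (N (r n)) * \<tau> (r n)}|lborel. ?g n s)"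
        unfolding set_lebesgue_integral_def by (intro integral_nonneg_AE AE_I2) (simp add: clipped_dist_bounds)
      ultimately show ?thesis using set_integral_Icc_combine[OF gi t0T T', of n] by linarith
    qed
    have ge: "0 \<le> (LINT s:{t0..T}|lborel. ?g n s)" for n
      unfolding set_lebesgue_integral_def by (intro integral_nonneg_AE AE_I2) (simp add: clipped_dist_bounds)
    have l1: "(\<lambda>n. LINT s:{t0..T}|lborel. ?g n s) \<longlonglongrightarrow> 0"
      by (rule tendsto_sandwich[OF _ _ tendsto_const dXlim]) (use le ge in auto)
    have dxc: "continuous_on A (\<lambda>s. clipped_dist X (x s))" for A
      by (rule continuous_on_compose2[OF continuous_clipped_dist[of UNIV] continuous_on_subset[OF xc]]) auto
    have "(\<lambda>n. LINT s:{t0..T}|lborel. ?g n s) \<longlonglongrightarrow> (LINT s:{t0..T}|lborel. clipped_dist X (x s))"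
      unfolding set_lebesgue_integral_def
    proof (rule integral_dominated_convergence[where w="\<lambda>s. indicator {t0..T} s"])
      show "integrable lborel (\<lambda>s. indicator {t0..T} s :: real)" by (intro integrable_real_indicator) (auto simp: emeasure_lborel_Icc_eq)
      show "(\<lambda>s. indicator {t0..T} s *\<^sub>R clipped_dist X (x s)) \<in> borel_measurable lborel"
        using borel_measurable_continuous_onI[OF dxc[of UNIV]] by measurable
      show "(\<lambda>s. indicator {t0..T} s *\<^sub>R ?g n s) \<in> borel_measurable lborel" for n
        using gm[of n] by measurable
      show "AE s in lborel. (\<lambda>n. indicator {t0..T} s *\<^sub>R ?g n s) \<longlonglongrightarrow> indicator {t0..T} s *\<^sub>R clipped_dist X (x s)"
      proof (rule AE_I2)
        fix s
        show "(\<lambda>n. indicator {t0..T} s *\<^sub>R ?g n s) \<longlonglongrightarrow> indicator {t0..T} s *\<^sub>R clipped_dist X (x s)"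
        proof (cases "s \<in> {t0..T}")
          case True
          have "(\<lambda>n. ?g n s) \<longlonglongrightarrow> clipped_dist X (x s)"
            unfolding e_def
            by (rule isCont_tendsto_compose[OF _ xlim[OF True]])
              (use continuous_clipped_dist[of UNIV X] in \<open>auto simp: continuous_on_eq_continuous_at\<close>)
          then show ?thesis using True by simp
        qed simp
      qed
      show "AE s in lborel. norm (indicator {t0..T} s *\<^sub>R ?g n s) \<le> indicator {t0..T} s" for n
        using gb by (intro AE_I2) (auto simp: indicator_def)
    qed
    then have "(LINT s:{t0..T}|lborel. clipped_dist X (x s)) = 0" using l1 LIMSEQ_unique by blast
    moreover have si: "set_integrable lborel {t0..T} (\<lambda>s. clipped_dist X (x s))"
      by (rule borel_integrable_atLeastAtMost'[OF dxc])
    ultimately have "((\<lambda>s. clipped_dist X (x s)) has_integral 0) (cbox t0 T)"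
      using set_borel_integral_eq_integral[OF si] by (simp add: has_integral_integrable_integral)
    then have "clipped_dist X (x t) = 0"
      using has_integral_0_cbox_imp_0[of t0 T "\<lambda>s. clipped_dist X (x s)" t, OF dxc] clipped_dist_bounds t t0T False
      by (auto simp: box_real)
    then show ?thesis using clipped_dist_eq_0_iff[OF Xc Xne] by simp
  qed
  have avg: "(\<lambda>s. LINT u|\<omega> s. h (\<pi> (x s), u)) \<in> borel_measurable borel" if h: "continuous_on UNIV h"
    for h :: "(real^'n) \<times> (real^'m) \<Rightarrow> 'z::euclidean_space"
  proof -
    have "(\<lambda>s. \<pi> (x s)) \<in> borel_measurable borel"
      by (intro borel_measurable_continuous_onI continuous_on_compose2[OF \<pi>_cont xc]) auto
    from measurable_relaxed_average[OF this _ \<omega> compact_cball[of 0 R] U h] \<pi>_in show ?thesis by blast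
  qed
  have convert: "(LINT s:{t0..t}|lborel. LINT u|\<omega> s. h (\<pi> (x s), u)) = (LINT s:{t0..t}|lebesgue. LINT u|\<omega> s. h (x s, u))"
    if h: "continuous_on UNIV h" and t: "t \<le> T" for h :: "(real^'n) \<times> (real^'m) \<Rightarrow> 'z::euclidean_space" and t
  proof -
    have "(LINT s:{t0..t}|lborel. LINT u|\<omega> s. h (\<pi> (x s), u)) = (LINT s:{t0..t}|lebesgue. LINT u|\<omega> s. h (\<pi> (x s), u))"
      unfolding set_lebesgue_integral_def using avg[OF h] by (intro integral_completion[symmetric]) measurable
    also have "\<dots> = (LINT s:{t0..t}|lebesgue. LINT u|\<omega> s. h (x s, u))"
      using t xX by (intro set_lebesgue_integral_cong) (auto simp: \<pi>_id)
    finally show ?thesis .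
  qed
  have "radm t0 x0 x \<omega>"
    unfolding relaxed_admissible_def
  proof (intro conjI ballI xX xT)
    show "x \<in> borel_measurable (lebesgue_on {t0..T})"
      by (rule continuous_imp_measurable_on_sets_lebesgue[OF continuous_on_subset[OF xc]]) auto
    show "\<omega> \<in> lebesgue_on {t0..T} \<rightarrow>\<^sub>M prob_algebra (restrict_space borel U)"
      using \<omega> by (intro measurable_restrict_space1 measurable_completion) simp
    show "x t = x0 + (LINT s:{t0..t}|lebesgue. LINT u|\<omega> s. f (x s, u))" if "t \<in> {t0..T}" for t
      using ode[OF that] that unfolding F_def by (subst (asm) convert[OF cont_f]) auto
  qed
  then have "relaxed_value l lT f X U XT T (t0, x0) \<le> ereal (relaxed_cost l lT T t0 x \<omega>)"
    unfolding relaxed_value_def prod.case by (intro INF_lower2[of "(x, \<omega>)"]) auto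
  moreover have "relaxed_cost l lT T t0 x \<omega> \<le> r2"
  proof -
    have "(LINT s:{t0..T}|lborel. LINT u|\<omega> s. c (x s) u) + \<phi> (x T) \<le> r2"
      by (rule LIMSEQ_le_const2[OF cslim]) (use cs_le in auto)
    moreover have "\<phi> (x T) = lT (x T)" using xX[of T] t0T by (simp add: \<phi>_def \<pi>_id)
    ultimately show ?thesis unfolding relaxed_cost_def c_def convert[OF cont_l order_refl] by simp
  qed
  ultimately show False using r2(2) by (meson ereal_less_eq(3) leD order_trans)
qed

end

section \<open>Convergence along relaxed minimizers\<close>

text \<open>
  Weak duality on the tails gives the inequalities.  Together with the two comparisons of the relaxed
  value, with the value function and with the dual value, it identifies the dual value with the value
  at \<open>(t0, x0)\<close>, which gives the limit.
\<close>

theorem theorem1: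
  fixes l :: "(real^'n) \<times> (real^'m) \<Rightarrow> real"
    and lT :: "real^'n \<Rightarrow> real"
    and f :: "(real^'n) \<times> (real^'m) \<Rightarrow> real^'n"
    and X XT :: "(real^'n) set"
    and U :: "(real^'m) set"
    and T t0 :: real
    and x0 :: "real^'n"
    and v :: "nat \<Rightarrow> real \<times> (real^'n) \<Rightarrow> real"
  assumes "real_polynomial_function l"
    and "real_polynomial_function lT"
    and "polynomial_function f"
    and "compact X" and "compact U" and "compact XT" and "XT \<subseteq> X"
    and "0 \<le> T"
    and "no_relaxation_gap f X U XT T"
    and "(t0, x0) \<in> admissible_data f X U XT T"
    and "\<And>k. dual_admissible l lT f X U XT T t0 (v k)"
    and "(\<lambda>k. ereal (v k (t0, x0))) \<longlonglongrightarrow> dual_value l lT f X U XT T (t0, x0)"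
  shows "(\<forall>x \<omega>. relaxed_minimizer l lT f X U XT T t0 x0 x \<omega> \<longrightarrow>
           (\<forall>t\<in>{t0..T}. \<forall>k.
              0 \<le> value_fun l lT f X U XT T (t, x t) - ereal (v k (t, x t)) \<and>
              value_fun l lT f X U XT T (t, x t) - ereal (v k (t, x t))
                \<le> value_fun l lT f X U XT T (t0, x0) - ereal (v k (t0, x0)))) \<and>
         (\<lambda>k. value_fun l lT f X U XT T (t0, x0) - ereal (v k (t0, x0))) \<longlonglongrightarrow> 0"
proof -
  interpret polynomial_control_problem l lT f X XT U T
    by unfold_locales (use assms in auto)
  note gap = assms(9) and dual = assms(11)
  let ?W = "value_fun l lT f X U XT T"
  from assms(10) obtain xa ua where t0: "t0 \<in> {0..T}" and x0: "x0 \<in> X" and adm: "admissible f X U XT T t0 x0 xa ua"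
    unfolding admissible_data_def by auto
  have t0T: "t0 \<le> T" using t0 by simp
  have "ua t0 \<in> U" "xa T \<in> XT" using adm t0 by (auto simp: admissible_def)
  then have ne: "U \<noteq> {}" "XT \<noteq> {}" by auto
  have "?W (t0, x0) \<le> ereal (cost l lT T t0 xa ua)"
    unfolding value_fun_def prod.case by (rule INF_lower2[of "(xa, ua)"]) (use adm in auto)
  moreover have "ereal (v 0 (t0, x0)) \<le> ?W (t0, x0)" by (rule dual_le_value[OF dual order_refl t0T])
  ultimately obtain \<alpha> where \<alpha>: "?W (t0, x0) = ereal \<alpha>"
    by (cases "?W (t0, x0)") auto
  have "dual_value l lT f X U XT T (t0, x0) \<le> ?W (t0, x0)"
    unfolding dual_value_def prod.case by (rule SUP_least) (auto intro: dual_le_value t0T)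
  moreover have "?W (t0, x0) \<le> dual_value l lT f X U XT T (t0, x0)"
    using value_le_relaxed_value[OF gap t0 x0] relaxed_value_le_dual_value[OF t0T x0 ne] by (rule order_trans)
  ultimately have "dual_value l lT f X U XT T (t0, x0) = ereal \<alpha>" using \<alpha> by simp
  then have "(\<lambda>k. v k (t0, x0)) \<longlonglongrightarrow> \<alpha>" using assms(12) by simp
  then have "(\<lambda>k. \<alpha> - v k (t0, x0)) \<longlonglongrightarrow> \<alpha> - \<alpha>" by (intro tendsto_intros)
  then have conv: "(\<lambda>k. ?W (t0, x0) - ereal (v k (t0, x0))) \<longlonglongrightarrow> 0"
    unfolding \<alpha> by (simp add: zero_ereal_def)
  have "0 \<le> ?W (t, x t) - ereal (v k (t, x t)) \<and> ?W (t, x t) - ereal (v k (t, x t)) \<le> ?W (t0, x0) - ereal (v k (t0, x0))"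
    if min: "relaxed_minimizer l lT f X U XT T t0 x0 x \<omega>" and t: "t \<in> {t0..T}" for x \<omega> t k
  proof -
    have r: "radm t0 x0 x \<omega>" and opt: "ereal (relaxed_cost l lT T t0 x \<omega>) = relaxed_value l lT f X U XT T (t0, x0)"
      using min unfolding relaxed_minimizer_def by auto
    have tail: "radm t (x t) x \<omega>" by (rule relaxed_admissible_tail[OF r t])
    have xt: "x t \<in> X" using r t unfolding relaxed_admissible_def by auto
    have low: "ereal (v k (t, x t)) \<le> ?W (t, x t)" by (rule dual_le_value[OF dual]) (use t in auto)
    have up: "?W (t, x t) \<le> ereal (relaxed_cost l lT T t x \<omega>)"
      by (rule value_le_relaxed_cost[OF gap tail _ xt]) (use t t0 in auto)
    obtain \<beta> where \<beta>: "?W (t, x t) = ereal \<beta>" using low up by (cases "?W (t, x t)") auto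
    have "relaxed_cost l lT T t0 x \<omega> \<le> \<alpha>"
      using relaxed_value_le_value[of t0 x0] unfolding opt[symmetric] \<alpha> by simp
    moreover have "v k (t0, x0) \<le> v k (t, x t) + (LINT s:{t0..t}|lebesgue. LINT u|\<omega> s. l (x s, u))"
      using dual_increment_le_running_cost[OF dual r order_refl, of t k] relaxed_initial[OF r t0T] t by auto
    moreover have "(LINT s:{t0..t}|lebesgue. LINT u|\<omega> s. l (x s, u)) + (LINT s:{t..T}|lebesgue. LINT u|\<omega> s. l (x s, u))
        = (LINT s:{t0..T}|lebesgue. LINT u|\<omega> s. l (x s, u))"
      using t by (intro set_integral_lebesgue_Icc_combine relaxed_average_set_integrable[OF r cont_l]) auto
    ultimately have "\<beta> - v k (t, x t) \<le> \<alpha> - v k (t0, x0)"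
      using up unfolding \<beta> relaxed_cost_def by simp
    then show ?thesis using low unfolding \<alpha> \<beta> by simp
  qed
  with conv show ?thesis by blast
qed

end
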